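(* A variety of ordered algebras which is a lax (respectively colax) protomodular category is not necessarily an $\mathsf{Ord}$-Mal'tsev category. That is, there exists a variety of ordered algebras which is lax protomodular but is not an $\mathsf{Ord}$-Mal'tsev category, and there exists a variety of ordered algebras which is colax protomodular but is not an $\mathsf{Ord}$-Mal'tsev category.
   Context: Ordered set means preordered set (reflexive and transitive relation). $\mathsf{Ord}$ is the category of preordered sets and monotone maps; an $\mathsf{Ord}$-category is a category whose hom-sets are preordered with composition monotone in each variable, and an $\mathsf{Ord}$-functor is a functor that is monotone on hom-sets. Varieties of ordered algebras. Let $\mathcal{J}$ be the full subcategory of $\mathsf{Ord}$ of finite preordered sets (the arities). The power (cotensor) of an object $C$ of an $\mathsf{Ord}$-category by a preordered set $X$ is an object $X\pitchfork C$ with natural isomorphisms of preordered sets $\mathrm{Hom}(D,X\pitchfork C)\cong \mathsf{Ord}(X,\mathrm{Hom}(D,C))$; in $\mathsf{Ord}$, $X\pitchfork C=C^X$ is the set of monotone maps $X\to C$ with the pointwise order. An $\mathsf{Ord}$-algebraic theory is an $\mathsf{Ord}$-category $\mathcal{T}$ with an $\mathsf{Ord}$-functor $\tau\colon\mathcal{J}^{\mathrm{op}}\to\mathcal{T}$ which preserves powers (by finite preordered sets) and is surjective on objects. Writing $T=\tau(1)$, where $1$ is the one-element preordered set, one has $\tau(X)=X\pitchfork T$ for all $X\in\mathcal{J}$. A $\mathcal{T}$-algebra is a power-preserving $\mathsf{Ord}$-functor $A\colon\mathcal{T}\to\mathsf{Ord}$; it is identified with the preordered set $A(T)$, also written $A$,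 and $A(X\pitchfork T)=A^X$. Homomorphisms are natural transformations, identified with their $T$-components. $\mathsf{Alg}(\mathcal{T})$ is the $\mathsf{Ord}$-category of $\mathcal{T}$-algebras and homomorphisms, with hom-sets preordered pointwise. A variety of ordered algebras is an $\mathsf{Ord}$-category $\mathcal{V}\cong\mathsf{Alg}(\mathcal{T})$ for some $\mathsf{Ord}$-algebraic theory $\mathcal{T}$. Each morphism $\theta\colon X\pitchfork T\to T$ of $\mathcal{T}$ (an operation of arity $X$) induces a monotone map $\theta_A\colon A^X\to A$ on each algebra $A$. (Co)lax protomodularity. In an $\mathsf{Ord}$-category $\mathbb{C}$, the comma object of an ordered pair $(f\colon A\to B,\ g\colon C\to B)$ is the universal object $f\downarrow g$ with morphisms $p_1\colon f\downarrow g\to A$, $p_2\colon f\downarrow g\to C$ such that $fp_1\le gp_2$: any $h\colon W\to A$, $k\colon W\to C$ with $fh\le gk$ factor uniquely as $h=p_1\langle h,k\rangle$, $k=p_2\langle h,k\rangle$, and for $u,v\colon W\to f\downarrow g$, $p_1u\le p_1v$ and $p_2u\le p_2v$ imply $u\le v$. $\mathsf{Pt}_B(\mathbb{C})$ is the category of points over $B$: objects are pairs $(f\colon A\to B,\ s\colon B\to A)$ with $fs=1_B$; morphisms $(f,s)\to(f',s')$ are $\gamma\colon A\to A'$ with $f'\gamma=f$, $\gamma s=s'$. For $g\colon C\to B$, the vertical change-of-base functor $V_g\colon\mathsf{Pt}_B(\mathbb{C})\to\mathsf{Pt}_C(\mathbb{C})$ sends $(f,s)$ to $(\pi_1,s_1)$,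 where $\pi_1\colon g\downarrow f\to C$, $\pi_2\colon g\downarrow f\to A$ are the projections (so $g\pi_1\le f\pi_2$) and $s_1=\langle 1_C,sg\rangle$; the horizontal change-of-base functor $H_g\colon\mathsf{Pt}_B(\mathbb{C})\to\mathsf{Pt}_C(\mathbb{C})$ sends $(f,s)$ to $(\rho_2,s_2)$, where $\rho_1\colon f\downarrow g\to A$, $\rho_2\colon f\downarrow g\to C$ are the projections (so $f\rho_1\le g\rho_2$) and $s_2=\langle sg,1_C\rangle$; on morphisms both are induced by the universal property. A finitely complete $\mathsf{Ord}$-category with comma objects and 2-pullbacks is lax protomodular (respectively colax protomodular) when $V_g$ (respectively $H_g$) is conservative (reflects isomorphisms) for every morphism $g$. $\mathsf{Ord}$-Mal'tsev categories. In an $\mathsf{Ord}$-category $\mathbb{C}$, a relation from $A$ to $B$ is a span $A\xleftarrow{r_1}R\xrightarrow{r_2}B$ that is jointly ff-monomorphic: $(r_1,r_2)$ is jointly monic and, for all $a,a'\colon W\to R$, $r_1a\le r_1a'$ and $r_2a\le r_2a'$ imply $a\le a'$. For $x\colon W\to A$, $y\colon W\to B$, write $(x,y)\in_W R$ when there is a (unique) $h\colon W\to R$ with $r_1h=x$, $r_2h=y$. A relation $R$ from $A$ to $B$ is an ideal when, for all $W$ and all $x,x'\colon W\to A$, $y,y'\colon W\to B$: $x'\le x$, $(x,y)\in_W R$ and $y\le y'$ imply $(x',y')\in_W R$. $\mathbb{C}$ is an $\mathsf{Ord}$-Mal'tsev category when every ideal $D$ from $A$ to $B$ (for all $A,B$)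 satisfies: for all $x,u,u'\colon W\to A$ and $y,y',v\colon W\to B$, if $(x,y)\in_W D$, $y\le y'$, $(u,y')\in_W D$, $u\le u'$ and $(u',v)\in_W D$, then $(x,v)\in_W D$. *)

theory Defs
  imports "HOL-Library.FuncSet"
begin

section \<open>Preordered sets\<close>

record 'a preord =
  Car :: "'a set"
  Rel :: "('a \<times> 'a) set"

definition is_preord :: "'a preord \<Rightarrow> bool" where
  "is_preord X \<longleftrightarrow> preorder_on (Car X) (Rel X)"

definition mono_maps :: "'a preord \<Rightarrow> 'b preord \<Rightarrow> ('a \<Rightarrow> 'b) set" where
  "mono_maps X Y =
     {h \<in> Car X \<rightarrow>\<^sub>E Car Y. \<forall>x y. (x, y) \<in> Rel X \<longrightarrow> (h x, h y) \<in> Rel Y}"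

definition mono_preord :: "'a preord \<Rightarrow> 'b preord \<Rightarrow> ('a \<Rightarrow> 'b) preord" where
  "mono_preord X Y =
     \<lparr>Car = mono_maps X Y,
      Rel = {(h, k). h \<in> mono_maps X Y \<and> k \<in> mono_maps X Y \<and>
                     (\<forall>x\<in>Car X. (h x, k x) \<in> Rel Y)}\<rparr>"

definition preord_iso :: "'a preord \<Rightarrow> 'b preord \<Rightarrow> ('a \<Rightarrow> 'b) \<Rightarrow> bool" where
  "preord_iso X Y \<phi> \<longleftrightarrow> bij_betw \<phi> (Car X) (Car Y) \<and>
     (\<forall>x\<in>Car X. \<forall>y\<in>Car X. (x, y) \<in> Rel X \<longleftrightarrow> (\<phi> x, \<phi> y) \<in> Rel Y)"


section \<open>Ord-categories and Ord-functors\<close>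

text \<open>\<open>Comp C g f\<close> is the composite "g after f". The relation \<open>Le C\<close> is only
  meaningful between parallel arrows.\<close>

record ('o, 'm) ordcat =
  Obj :: "'o set"
  Arr :: "'m set"
  Dom :: "'m \<Rightarrow> 'o"
  Cod :: "'m \<Rightarrow> 'o"
  Idt :: "'o \<Rightarrow> 'm"
  Comp :: "'m \<Rightarrow> 'm \<Rightarrow> 'm"
  Le :: "'m \<Rightarrow> 'm \<Rightarrow> bool"

definition hom :: "('o, 'm) ordcat \<Rightarrow> 'o \<Rightarrow> 'o \<Rightarrow> 'm set" where
  "hom C a b = {f \<in> Arr C. Dom C f = a \<and> Cod C f = b}"

definition hom_preord :: "('o, 'm) ordcat \<Rightarrow> 'o \<Rightarrow> 'o \<Rightarrow> 'm preord" where
  "hom_preord C a b =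
     \<lparr>Car = hom C a b, Rel = {(f, g). f \<in> hom C a b \<and> g \<in> hom C a b \<and> Le C f g}\<rparr>"

locale ord_category =
  fixes C :: "('o, 'm) ordcat"
  assumes dom_obj: "f \<in> Arr C \<Longrightarrow> Dom C f \<in> Obj C"
    and cod_obj: "f \<in> Arr C \<Longrightarrow> Cod C f \<in> Obj C"
    and id_hom: "a \<in> Obj C \<Longrightarrow> Idt C a \<in> hom C a a"
    and comp_hom: "\<lbrakk>f \<in> hom C a b; g \<in> hom C b c\<rbrakk> \<Longrightarrow> Comp C g f \<in> hom C a c"
    and id_left: "f \<in> hom C a b \<Longrightarrow> Comp C (Idt C b) f = f"
    and id_right: "f \<in> hom C a b \<Longrightarrow> Comp C f (Idt C a) = f"
    and assoc: "\<lbrakk>f \<in> hom C a b; g \<in> hom C b c; h \<in> hom C c d\<rbrakk>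
      \<Longrightarrow> Comp C h (Comp C g f) = Comp C (Comp C h g) f"
    and hom_is_preord: "\<lbrakk>a \<in> Obj C; b \<in> Obj C\<rbrakk> \<Longrightarrow> is_preord (hom_preord C a b)"
    and comp_mono_left: "\<lbrakk>f \<in> hom C a b; g \<in> hom C b c; g' \<in> hom C b c; Le C g g'\<rbrakk>
      \<Longrightarrow> Le C (Comp C g f) (Comp C g' f)"
    and comp_mono_right: "\<lbrakk>f \<in> hom C a b; f' \<in> hom C a b; g \<in> hom C b c; Le C f f'\<rbrakk>
      \<Longrightarrow> Le C (Comp C g f) (Comp C g f')"

definition is_iso :: "('o, 'm) ordcat \<Rightarrow> 'm \<Rightarrow> bool" where
  "is_iso C f \<longleftrightarrow> f \<in> Arr C \<and>
     (\<exists>g \<in> hom C (Cod C f) (Dom C f).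
        Comp C g f = Idt C (Dom C f) \<and> Comp C f g = Idt C (Cod C f))"

text \<open>The opposite reverses the arrows and keeps the order of the hom-sets.\<close>

definition op_cat :: "('o, 'm) ordcat \<Rightarrow> ('o, 'm) ordcat" where
  "op_cat C = C\<lparr>Dom := Cod C, Cod := Dom C, Comp := (\<lambda>g f. Comp C f g)\<rparr>"

definition full_subcat :: "('o, 'm) ordcat \<Rightarrow> 'o set \<Rightarrow> ('o, 'm) ordcat" where
  "full_subcat C S =
     C\<lparr>Obj := S, Arr := {f \<in> Arr C. Dom C f \<in> S \<and> Cod C f \<in> S}\<rparr>"

record ('o, 'm, 'p, 'n) functr =
  FObj :: "'o \<Rightarrow> 'p"
  FArr :: "'m \<Rightarrow> 'n"

definition ord_functor ::
  "('o, 'm) ordcat \<Rightarrow> ('p, 'n) ordcat \<Rightarrow> ('o, 'm, 'p, 'n) functr \<Rightarrow> bool" where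
  "ord_functor C D F \<longleftrightarrow>
     FObj F \<in> Obj C \<rightarrow>\<^sub>E Obj D \<and>
     FArr F \<in> Arr C \<rightarrow>\<^sub>E Arr D \<and>
     (\<forall>f\<in>Arr C. Dom D (FArr F f) = FObj F (Dom C f) \<and> Cod D (FArr F f) = FObj F (Cod C f)) \<and>
     (\<forall>a\<in>Obj C. FArr F (Idt C a) = Idt D (FObj F a)) \<and>
     (\<forall>f\<in>Arr C. \<forall>g\<in>Arr C. Cod C f = Dom C g \<longrightarrow>
        FArr F (Comp C g f) = Comp D (FArr F g) (FArr F f)) \<and>
     (\<forall>f\<in>Arr C. \<forall>g\<in>Arr C. Dom C f = Dom C g \<and> Cod C f = Cod C g \<and> Le C f g \<longrightarrow>
        Le D (FArr F f) (FArr F g))"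

definition ord_isomorphic :: "('o, 'm) ordcat \<Rightarrow> ('p, 'n) ordcat \<Rightarrow> bool" where
  "ord_isomorphic C D \<longleftrightarrow>
     (\<exists>F G. ord_functor C D F \<and> ord_functor D C G \<and>
        (\<forall>a\<in>Obj C. FObj G (FObj F a) = a) \<and> (\<forall>f\<in>Arr C. FArr G (FArr F f) = f) \<and>
        (\<forall>b\<in>Obj D. FObj F (FObj G b) = b) \<and> (\<forall>g\<in>Arr D. FArr F (FArr G g) = g))"

definition conservative ::
  "('o, 'm) ordcat \<Rightarrow> ('p, 'n) ordcat \<Rightarrow> ('o, 'm, 'p, 'n) functr \<Rightarrow> bool" where
  "conservative C D F \<longleftrightarrow> (\<forall>f\<in>Arr C. is_iso D (FArr F f) \<longrightarrow> is_iso C f)"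


section \<open>Powers\<close>

text \<open>The natural isomorphisms \<open>Hom(D, P) \<cong> Ord(X, Hom(D, c))\<close> exhibiting \<open>P\<close> as the power of
  \<open>c\<close> by \<open>X\<close> are given by the image \<open>\<kappa>\<close> of the identity of \<open>P\<close>, which determines
  them by naturality.\<close>

definition is_power ::
  "('o, 'm) ordcat \<Rightarrow> 'x preord \<Rightarrow> 'o \<Rightarrow> 'o \<Rightarrow> ('x \<Rightarrow> 'm) \<Rightarrow> bool" where
  "is_power C X c P \<kappa> \<longleftrightarrow>
     c \<in> Obj C \<and> P \<in> Obj C \<and> \<kappa> \<in> mono_maps X (hom_preord C P c) \<and>
     (\<forall>D\<in>Obj C. preord_iso (hom_preord C D P) (mono_preord X (hom_preord C D c))
        (\<lambda>h. \<lambda>x\<in>Car X. Comp C (\<kappa> x) h))"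

definition preserves_powers ::
  "'x preord set \<Rightarrow> ('o, 'm) ordcat \<Rightarrow> ('p, 'n) ordcat \<Rightarrow> ('o, 'm, 'p, 'n) functr \<Rightarrow> bool" where
  "preserves_powers \<X> C D F \<longleftrightarrow>
     (\<forall>X\<in>\<X>. \<forall>c P \<kappa>. is_power C X c P \<kappa> \<longrightarrow>
        is_power D X (FObj F c) (FObj F P) (\<lambda>x\<in>Car X. FArr F (\<kappa> x)))"


section \<open>The Ord-category of preordered sets\<close>

text \<open>An arrow with explicit source and target; it is also used below for natural
  transformations and for morphisms of points.\<close>

record ('o, 'f) arrow =
  Src :: 'o
  Fn :: 'f
  Tgt :: 'o

type_synonym 'a pmap = "('a preord, 'a \<Rightarrow> 'a) arrow"

text \<open>The type \<open>'a\<close> plays the role of the universe: all preordered sets are carried by subsets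
  of \<open>'a\<close>. For infinite \<open>'a\<close> these are closed, up to isomorphism, under finite limits, comma
  objects and powers by finite preordered sets.\<close>

definition ORD :: "('a preord, 'a pmap) ordcat" where
  "ORD =
     \<lparr>Obj = {X. is_preord X},
      Arr = {f. is_preord (Src f) \<and> is_preord (Tgt f) \<and> Fn f \<in> mono_maps (Src f) (Tgt f)},
      Dom = Src,
      Cod = Tgt,
      Idt = (\<lambda>X. \<lparr>Src = X, Fn = (\<lambda>x\<in>Car X. x), Tgt = X\<rparr>),
      Comp = (\<lambda>g f. \<lparr>Src = Src f, Fn = compose (Car (Src f)) (Fn g) (Fn f), Tgt = Tgt g\<rparr>),
      Le = (\<lambda>f g. \<forall>x\<in>Car (Src f). (Fn f x, Fn g x) \<in> Rel (Tgt f))\<rparr>"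

definition JJ :: "('a preord, 'a pmap) ordcat" where
  "JJ = full_subcat ORD {X. is_preord X \<and> finite (Car X)}"


section \<open>Varieties of ordered algebras\<close>

definition ord_algebraic_theory ::
  "('o, 'm) ordcat \<Rightarrow> ('a preord, 'a pmap, 'o, 'm) functr \<Rightarrow> bool" where
  "ord_algebraic_theory T \<tau> \<longleftrightarrow>
     ord_category T \<and> ord_functor (op_cat JJ) T \<tau> \<and>
     preserves_powers (Obj (JJ :: ('a preord, 'a pmap) ordcat)) (op_cat JJ) T \<tau> \<and>
     FObj \<tau> ` Obj (JJ :: ('a preord, 'a pmap) ordcat) = Obj T"

definition is_algebra ::
  "('o, 'm) ordcat \<Rightarrow> ('o, 'm, 'a preord, 'a pmap) functr \<Rightarrow> bool" where
  "is_algebra T A \<longleftrightarrow> ord_functor T ORD A \<and>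
     preserves_powers (Obj (JJ :: ('a preord, 'a pmap) ordcat)) T ORD A"

type_synonym ('o, 'm, 'a) alg = "('o, 'm, 'a preord, 'a pmap) functr"
type_synonym ('o, 'm, 'a) alg_hom = "(('o, 'm, 'a) alg, 'o \<Rightarrow> 'a pmap) arrow"

definition is_alg_hom :: "('o, 'm) ordcat \<Rightarrow> ('o, 'm, 'a) alg_hom \<Rightarrow> bool" where
  "is_alg_hom T \<alpha> \<longleftrightarrow>
     is_algebra T (Src \<alpha>) \<and> is_algebra T (Tgt \<alpha>) \<and>
     Fn \<alpha> \<in> (\<Pi>\<^sub>E t\<in>Obj T. hom ORD (FObj (Src \<alpha>) t) (FObj (Tgt \<alpha>) t)) \<and>
     (\<forall>f\<in>Arr T. Comp ORD (Fn \<alpha> (Cod T f)) (FArr (Src \<alpha>) f) =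
                Comp ORD (FArr (Tgt \<alpha>) f) (Fn \<alpha> (Dom T f)))"

definition Alg ::
  "('o, 'm) ordcat \<Rightarrow> (('o, 'm, 'a) alg, ('o, 'm, 'a) alg_hom) ordcat" where
  "Alg T =
     \<lparr>Obj = {A. is_algebra T A},
      Arr = {\<alpha>. is_alg_hom T \<alpha>},
      Dom = Src,
      Cod = Tgt,
      Idt = (\<lambda>A. \<lparr>Src = A, Fn = (\<lambda>t\<in>Obj T. Idt ORD (FObj A t)), Tgt = A\<rparr>),
      Comp = (\<lambda>\<beta> \<alpha>. \<lparr>Src = Src \<alpha>, Fn = (\<lambda>t\<in>Obj T. Comp ORD (Fn \<beta> t) (Fn \<alpha> t)), Tgt = Tgt \<beta>\<rparr>),
      Le = (\<lambda>\<alpha> \<beta>. \<forall>t\<in>Obj T. Le ORD (Fn \<alpha> t) (Fn \<beta> t))\<rparr>"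

text \<open>The objects of a theory are indexed by finite preordered sets, and for infinite \<open>'a\<close> the type
  \<open>'a pmap\<close> has at least as many elements as there are subsets of \<open>'a\<close>; so up to isomorphism the
  bound variable \<open>T\<close> ranges over all theories that are small relative to \<open>'a\<close>.\<close>

definition ordered_variety ::
  "(('a preord, 'a pmap, 'a) alg, ('a preord, 'a pmap, 'a) alg_hom) ordcat \<Rightarrow> bool" where
  "ordered_variety V \<longleftrightarrow> ord_category V \<and>
     (\<exists>(T :: ('a preord, 'a pmap) ordcat) (\<tau> :: ('a preord, 'a pmap, 'a preord, 'a pmap) functr).
        ord_algebraic_theory T \<tau> \<and>
        ord_isomorphic V (Alg T :: (('a preord, 'a pmap, 'a) alg, ('a preord, 'a pmap, 'a) alg_hom) ordcat))"


section \<open>Limits and comma objects\<close>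

text \<open>A finite diagram is a functor from a finite category, here with the discrete order on its
  hom-sets; every finite category is isomorphic to one on natural numbers.\<close>

definition is_cone ::
  "(nat, nat) ordcat \<Rightarrow> ('o, 'm) ordcat \<Rightarrow> (nat, nat, 'o, 'm) functr \<Rightarrow> 'o \<Rightarrow> (nat \<Rightarrow> 'm) \<Rightarrow> bool" where
  "is_cone S C F L p \<longleftrightarrow> L \<in> Obj C \<and>
     (\<forall>i\<in>Obj S. p i \<in> hom C L (FObj F i)) \<and>
     (\<forall>e\<in>Arr S. Comp C (FArr F e) (p (Dom S e)) = p (Cod S e))"

definition finitely_complete :: "('o, 'm) ordcat \<Rightarrow> bool" where
  "finitely_complete C \<longleftrightarrow>
     (\<forall>S F. ord_category S \<and> finite (Obj S) \<and> finite (Arr S) \<and>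
        (\<forall>e\<in>Arr S. \<forall>e'\<in>Arr S. Le S e e' \<longleftrightarrow> e = e') \<and> ord_functor S C F \<longrightarrow>
        (\<exists>L p. is_cone S C F L p \<and>
           (\<forall>W q. is_cone S C F W q \<longrightarrow>
              (\<exists>!h. h \<in> hom C W L \<and> (\<forall>i\<in>Obj S. Comp C (p i) h = q i)))))"

definition is_two_pullback ::
  "('o, 'm) ordcat \<Rightarrow> 'm \<Rightarrow> 'm \<Rightarrow> 'o \<Rightarrow> 'm \<Rightarrow> 'm \<Rightarrow> bool" where
  "is_two_pullback C f g P p1 p2 \<longleftrightarrow>
     p1 \<in> hom C P (Dom C f) \<and> p2 \<in> hom C P (Dom C g) \<and> Comp C f p1 = Comp C g p2 \<and>
     (\<forall>W. \<forall>h\<in>hom C W (Dom C f). \<forall>k\<in>hom C W (Dom C g). Comp C f h = Comp C g k \<longrightarrow>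
        (\<exists>!u. u \<in> hom C W P \<and> Comp C p1 u = h \<and> Comp C p2 u = k)) \<and>
     (\<forall>W. \<forall>u\<in>hom C W P. \<forall>v\<in>hom C W P.
        Le C (Comp C p1 u) (Comp C p1 v) \<and> Le C (Comp C p2 u) (Comp C p2 v) \<longrightarrow> Le C u v)"

definition is_comma ::
  "('o, 'm) ordcat \<Rightarrow> 'm \<Rightarrow> 'm \<Rightarrow> 'o \<Rightarrow> 'm \<Rightarrow> 'm \<Rightarrow> bool" where
  "is_comma C f g P p1 p2 \<longleftrightarrow>
     p1 \<in> hom C P (Dom C f) \<and> p2 \<in> hom C P (Dom C g) \<and> Le C (Comp C f p1) (Comp C g p2) \<and>
     (\<forall>W. \<forall>h\<in>hom C W (Dom C f). \<forall>k\<in>hom C W (Dom C g). Le C (Comp C f h) (Comp C g k) \<longrightarrow>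
        (\<exists>!u. u \<in> hom C W P \<and> Comp C p1 u = h \<and> Comp C p2 u = k)) \<and>
     (\<forall>W. \<forall>u\<in>hom C W P. \<forall>v\<in>hom C W P.
        Le C (Comp C p1 u) (Comp C p1 v) \<and> Le C (Comp C p2 u) (Comp C p2 v) \<longrightarrow> Le C u v)"

definition has_two_pullbacks :: "('o, 'm) ordcat \<Rightarrow> bool" where
  "has_two_pullbacks C \<longleftrightarrow>
     (\<forall>f\<in>Arr C. \<forall>g\<in>Arr C. Cod C f = Cod C g \<longrightarrow> (\<exists>P p1 p2. is_two_pullback C f g P p1 p2))"

definition has_commas :: "('o, 'm) ordcat \<Rightarrow> bool" where
  "has_commas C \<longleftrightarrow>
     (\<forall>f\<in>Arr C. \<forall>g\<in>Arr C. Cod C f = Cod C g \<longrightarrow> (\<exists>P p1 p2. is_comma C f g P p1 p2))"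

text \<open>A chosen comma object, as a triple of the object and its two projections.\<close>

definition comma :: "('o, 'm) ordcat \<Rightarrow> 'm \<Rightarrow> 'm \<Rightarrow> 'o \<times> 'm \<times> 'm" where
  "comma C f g = (SOME (P, p1, p2). is_comma C f g P p1 p2)"

definition comma_obj :: "('o, 'm) ordcat \<Rightarrow> 'm \<Rightarrow> 'm \<Rightarrow> 'o" where
  "comma_obj C f g = fst (comma C f g)"

definition comma_fst :: "('o, 'm) ordcat \<Rightarrow> 'm \<Rightarrow> 'm \<Rightarrow> 'm" where
  "comma_fst C f g = fst (snd (comma C f g))"

definition comma_snd :: "('o, 'm) ordcat \<Rightarrow> 'm \<Rightarrow> 'm \<Rightarrow> 'm" where
  "comma_snd C f g = snd (snd (comma C f g))"

definition comma_pair :: "('o, 'm) ordcat \<Rightarrow> 'm \<Rightarrow> 'm \<Rightarrow> 'm \<Rightarrow> 'm \<Rightarrow> 'm" where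
  "comma_pair C f g h k =
     (THE u. u \<in> hom C (Dom C h) (comma_obj C f g) \<and>
             Comp C (comma_fst C f g) u = h \<and> Comp C (comma_snd C f g) u = k)"


section \<open>Points and change of base\<close>

definition is_point :: "('o, 'm) ordcat \<Rightarrow> 'o \<Rightarrow> 'm \<times> 'm \<Rightarrow> bool" where
  "is_point C B q \<longleftrightarrow>
     (\<exists>A\<in>Obj C. fst q \<in> hom C A B \<and> snd q \<in> hom C B A \<and> Comp C (fst q) (snd q) = Idt C B)"

text \<open>Points over \<open>B\<close> as pairs \<open>(f, s)\<close>; a morphism is recorded together with its source and target
  points. The order on the hom-sets is inherited from \<open>C\<close>.\<close>

definition Pt :: "('o, 'm) ordcat \<Rightarrow> 'o \<Rightarrow> ('m \<times> 'm, ('m \<times> 'm, 'm) arrow) ordcat" where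
  "Pt C B =
     \<lparr>Obj = {q. is_point C B q},
      Arr = {\<gamma>. is_point C B (Src \<gamma>) \<and> is_point C B (Tgt \<gamma>) \<and>
                Fn \<gamma> \<in> hom C (Dom C (fst (Src \<gamma>))) (Dom C (fst (Tgt \<gamma>))) \<and>
                Comp C (fst (Tgt \<gamma>)) (Fn \<gamma>) = fst (Src \<gamma>) \<and>
                Comp C (Fn \<gamma>) (snd (Src \<gamma>)) = snd (Tgt \<gamma>)},
      Dom = Src,
      Cod = Tgt,
      Idt = (\<lambda>q. \<lparr>Src = q, Fn = Idt C (Dom C (fst q)), Tgt = q\<rparr>),
      Comp = (\<lambda>\<delta> \<gamma>. \<lparr>Src = Src \<gamma>, Fn = Comp C (Fn \<delta>) (Fn \<gamma>), Tgt = Tgt \<delta>\<rparr>),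
      Le = (\<lambda>\<gamma> \<delta>. Le C (Fn \<gamma>) (Fn \<delta>))\<rparr>"

definition V_obj :: "('o, 'm) ordcat \<Rightarrow> 'm \<Rightarrow> 'm \<times> 'm \<Rightarrow> 'm \<times> 'm" where
  "V_obj C g = (\<lambda>(f, s).
     (comma_fst C g f, comma_pair C g f (Idt C (Dom C g)) (Comp C s g)))"

definition V_fun ::
  "('o, 'm) ordcat \<Rightarrow> 'm \<Rightarrow>
     ('m \<times> 'm, ('m \<times> 'm, 'm) arrow, 'm \<times> 'm, ('m \<times> 'm, 'm) arrow) functr" where
  "V_fun C g =
     \<lparr>FObj = restrict (V_obj C g) (Obj (Pt C (Cod C g))),
      FArr = (\<lambda>\<gamma>\<in>Arr (Pt C (Cod C g)).
        \<lparr>Src = V_obj C g (Src \<gamma>),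
         Fn = comma_pair C g (fst (Tgt \<gamma>))
                (comma_fst C g (fst (Src \<gamma>)))
                (Comp C (Fn \<gamma>) (comma_snd C g (fst (Src \<gamma>)))),
         Tgt = V_obj C g (Tgt \<gamma>)\<rparr>)\<rparr>"

definition H_obj :: "('o, 'm) ordcat \<Rightarrow> 'm \<Rightarrow> 'm \<times> 'm \<Rightarrow> 'm \<times> 'm" where
  "H_obj C g = (\<lambda>(f, s).
     (comma_snd C f g, comma_pair C f g (Comp C s g) (Idt C (Dom C g))))"

definition H_fun ::
  "('o, 'm) ordcat \<Rightarrow> 'm \<Rightarrow>
     ('m \<times> 'm, ('m \<times> 'm, 'm) arrow, 'm \<times> 'm, ('m \<times> 'm, 'm) arrow) functr" where
  "H_fun C g =
     \<lparr>FObj = restrict (H_obj C g) (Obj (Pt C (Cod C g))),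
      FArr = (\<lambda>\<gamma>\<in>Arr (Pt C (Cod C g)).
        \<lparr>Src = H_obj C g (Src \<gamma>),
         Fn = comma_pair C (fst (Tgt \<gamma>)) g
                (Comp C (Fn \<gamma>) (comma_fst C (fst (Src \<gamma>)) g))
                (comma_snd C (fst (Src \<gamma>)) g),
         Tgt = H_obj C g (Tgt \<gamma>)\<rparr>)\<rparr>"

definition lax_protomodular :: "('o, 'm) ordcat \<Rightarrow> bool" where
  "lax_protomodular C \<longleftrightarrow>
     ord_category C \<and> finitely_complete C \<and> has_commas C \<and> has_two_pullbacks C \<and>
     (\<forall>g\<in>Arr C. conservative (Pt C (Cod C g)) (Pt C (Dom C g)) (V_fun C g))"

definition colax_protomodular :: "('o, 'm) ordcat \<Rightarrow> bool" where
  "colax_protomodular C \<longleftrightarrow>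
     ord_category C \<and> finitely_complete C \<and> has_commas C \<and> has_two_pullbacks C \<and>
     (\<forall>g\<in>Arr C. conservative (Pt C (Cod C g)) (Pt C (Dom C g)) (H_fun C g))"


section \<open>Ord-Mal'tsev categories\<close>

definition is_relation :: "('o, 'm) ordcat \<Rightarrow> 'o \<Rightarrow> 'o \<Rightarrow> 'o \<Rightarrow> 'm \<Rightarrow> 'm \<Rightarrow> bool" where
  "is_relation C A B R r1 r2 \<longleftrightarrow>
     r1 \<in> hom C R A \<and> r2 \<in> hom C R B \<and>
     (\<forall>W. \<forall>a\<in>hom C W R. \<forall>a'\<in>hom C W R.
        Comp C r1 a = Comp C r1 a' \<and> Comp C r2 a = Comp C r2 a' \<longrightarrow> a = a') \<and>
     (\<forall>W. \<forall>a\<in>hom C W R. \<forall>a'\<in>hom C W R.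
        Le C (Comp C r1 a) (Comp C r1 a') \<and> Le C (Comp C r2 a) (Comp C r2 a') \<longrightarrow> Le C a a')"

definition rel_mem ::
  "('o, 'm) ordcat \<Rightarrow> 'o \<Rightarrow> 'o \<Rightarrow> 'm \<Rightarrow> 'm \<Rightarrow> 'm \<Rightarrow> 'm \<Rightarrow> bool" where
  "rel_mem C W R r1 r2 x y \<longleftrightarrow> (\<exists>h\<in>hom C W R. Comp C r1 h = x \<and> Comp C r2 h = y)"

definition is_ideal :: "('o, 'm) ordcat \<Rightarrow> 'o \<Rightarrow> 'o \<Rightarrow> 'o \<Rightarrow> 'm \<Rightarrow> 'm \<Rightarrow> bool" where
  "is_ideal C A B R r1 r2 \<longleftrightarrow> is_relation C A B R r1 r2 \<and>
     (\<forall>W. \<forall>x\<in>hom C W A. \<forall>x'\<in>hom C W A. \<forall>y\<in>hom C W B. \<forall>y'\<in>hom C W B.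
        Le C x' x \<and> rel_mem C W R r1 r2 x y \<and> Le C y y' \<longrightarrow> rel_mem C W R r1 r2 x' y')"

definition ord_maltsev :: "('o, 'm) ordcat \<Rightarrow> bool" where
  "ord_maltsev C \<longleftrightarrow>
     (\<forall>A B D d1 d2. is_ideal C A B D d1 d2 \<longrightarrow>
       (\<forall>W. \<forall>x\<in>hom C W A. \<forall>u\<in>hom C W A. \<forall>u'\<in>hom C W A.
            \<forall>y\<in>hom C W B. \<forall>y'\<in>hom C W B. \<forall>v\<in>hom C W B.
          rel_mem C W D d1 d2 x y \<and> Le C y y' \<and> rel_mem C W D d1 d2 u y' \<and>
          Le C u u' \<and> rel_mem C W D d1 d2 u' v \<longrightarrow> rel_mem C W D d1 d2 x v))"

end

(*
  The variety is that of preordered sets with two constants z, t subject to z <= x <= t; it is both lax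
  and colax protomodular.  Since g z <= f a for all a, the elements (z, a) of the comma object of (g, f)
  form a copy of the domain A of the point f, so an isomorphism of comma objects over the domain of g
  restricts to one of the domains of the points; dually for (a, t) and the comma object of (f, g).  No
  operation beyond the two constants is present, so an ideal on bounded preordered sets is just a
  down/up-closed relation that contains (z, z) and (t, t), and a small one violates the Mal'tsev condition.

  The theory is the opposite of the category of the finite free algebras bd X = X + {z, t}.  An algebra A
  is determined by A (bd one), and conversely a bounded preordered set M yields the algebra that
  sends bd X to the set of bounded maps from bd X to M, encoded in the universe.
*)
theory Submission
  imports Defs
begin

section \<open>Encoding finite families\<close>

text \<open>All carriers are subsets of the one type \<open>'a\<close>, whereas limits and powers
  are sets of functions. Infinity of \<open>'a\<close> makes such sets codable in \<open>'a\<close>;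
  only finite index sets occur, so coding finite families suffices. The same need to stay inside
  \<open>'a\<close> requires an injection \<open>e\<close> of \<open>'a\<close> that misses two
  points before bounds can be adjoined freely. The order-theoretic argument is kept apart from the
  functorial encoding of algebras: the locale \<open>bounded_preord_category\<close> assumes only a
  fully faithful passage to bounded preorders, also on the order of hom-sets, that reaches every
  bounded preorder on a subset of \<open>'a\<close>. Limits, change of base and the counterexample
  are treated at that level, and \<open>Alg T\<close> is an instance. Power preservation quantifies
  over all universal cones. It is reduced to one explicit power per arity and object, because any
  two powers are isomorphic. In the opposite of the free algebras that power is the free algebra on
  a product, so currying is the computation behind it.\<close>

primrec list_code :: "('a \<times> 'a \<Rightarrow> 'a) \<Rightarrow> 'a \<Rightarrow> 'a \<Rightarrow> 'a list \<Rightarrow> 'a" where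
  "list_code p a b [] = p (a, a)"
| "list_code p a b (x # xs) = p (b, p (x, list_code p a b xs))"

text \<open>The first component of each pair is a tag, \<open>a\<close> for the end of the list and
  \<open>b\<close> for one more entry, so \<open>a \<noteq> b\<close> makes decoding
  unambiguous.\<close>

lemma inj_list_code:
  assumes p: "inj p" and ab: "a \<noteq> b"
  shows "inj (list_code p a b)"
proof (rule injI)
  fix xs ys :: "'a list"
  show "list_code p a b xs = list_code p a b ys \<Longrightarrow> xs = ys"
  proof (induction xs arbitrary: ys)
    case Nil
    then show ?case using ab by (cases ys) (auto dest!: injD[OF p])
  next
    case (Cons x xs)
    then show ?case using ab by (cases ys) (auto dest!: injD[OF p])
  qed
qed

text \<open>Cardinal arithmetic of infinite sets supplies a pairing function, and infinity also
  supplies a second element to serve as the other tag.\<close>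

lemma list_injection:
  assumes "infinite (UNIV :: 'a set)"
  shows "\<exists>c :: 'a list \<Rightarrow> 'a. inj c"
proof -
  obtain p :: "'a \<times> 'a \<Rightarrow> 'a" where "bij_betw p (UNIV \<times> UNIV) UNIV"
    using card_of_Times_same_infinite[OF assms] card_of_ordIso by blast
  then have p: "inj p" by (simp add: bij_betw_def)
  obtain a :: 'a where True by blast
  have "infinite (UNIV - {a} :: 'a set)" using assms by simp
  then obtain b where "b \<noteq> a" by (metis Diff_eq_empty_iff finite.emptyI insertI1 subsetI)
  then show ?thesis using inj_list_code[OF p, of a b] by blast
qed

text \<open>An extensional function on \<open>I\<close> is determined by its list of values along an
  enumeration of \<open>I\<close>. This is what brings finite products and powers of carriers back
  into \<open>'a\<close>.\<close>

lemma finite_family_injection: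
  assumes "infinite (UNIV :: 'a set)" "finite I"
  shows "\<exists>c :: ('i \<Rightarrow> 'a) \<Rightarrow> 'a. inj_on c (extensional I)"
proof -
  obtain c :: "'a list \<Rightarrow> 'a" where c: "inj c" using list_injection[OF assms(1)] by blast
  obtain xs where xs: "set xs = I" using finite_list[OF assms(2)] by blast
  have "inj_on (\<lambda>f. c (map f xs)) (extensional I)"
  proof (rule inj_onI)
    fix f g :: "'i \<Rightarrow> 'a"
    assume fg: "f \<in> extensional I" "g \<in> extensional I" and eq: "c (map f xs) = c (map g xs)"
    have "\<forall>i\<in>I. f i = g i" using injD[OF c eq] xs by auto
    then show "f = g" using fg by (meson extensionalityI)
  qed
  then show ?thesis by blast
qed


section \<open>Ord-categories equivalent to bounded preordered sets\<close>

text \<open>The bounds are part of the data: a preorder may have many least or greatest elements,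
  and homomorphisms must preserve the chosen ones. The case \<open>z = t\<close> is allowed.\<close>

definition bounded_preord :: "'a preord \<Rightarrow> 'a \<Rightarrow> 'a \<Rightarrow> bool" where
  "bounded_preord X z t \<longleftrightarrow> is_preord X \<and> z \<in> Car X \<and> t \<in> Car X \<and>
     (\<forall>x\<in>Car X. (z, x) \<in> Rel X \<and> (x, t) \<in> Rel X)"

section \<open>Preordered sets, monotone maps and transport of structure along injections\<close>

lemma is_preord_iff:
  "is_preord X \<longleftrightarrow> Rel X \<subseteq> Car X \<times> Car X \<and> (\<forall>x\<in>Car X. (x, x) \<in> Rel X) \<and>
     (\<forall>x y z. (x, y) \<in> Rel X \<longrightarrow> (y, z) \<in> Rel X \<longrightarrow> (x, z) \<in> Rel X)"
  unfolding is_preord_def preorder_on_def refl_on_def trans_def by blast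

lemma mono_mapsI:
  assumes "\<And>x. x \<in> Car X \<Longrightarrow> h x \<in> Car Y" "h \<in> extensional (Car X)"
    "\<And>x y. (x, y) \<in> Rel X \<Longrightarrow> (h x, h y) \<in> Rel Y"
  shows "h \<in> mono_maps X Y"
  using assms unfolding mono_maps_def by (auto simp: PiE_def)

lemma mono_mapsD:
  assumes "h \<in> mono_maps X Y"
  shows "x \<in> Car X \<Longrightarrow> h x \<in> Car Y" "h \<in> extensional (Car X)"
    "(x, y) \<in> Rel X \<Longrightarrow> (h x, h y) \<in> Rel Y"
  using assms unfolding mono_maps_def by (auto simp: PiE_def)

lemma mono_maps_eqI:
  "f \<in> mono_maps X Y \<Longrightarrow> g \<in> mono_maps X Y' \<Longrightarrow> (\<And>x. x \<in> Car X \<Longrightarrow> f x = g x) \<Longrightarrow> f = g"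
  by (meson extensionalityI mono_mapsD(2))

lemma preord_isoI:
  assumes "inj_on \<phi> (Car X)" "\<phi> ` Car X = Car Y"
    and "\<And>x y. x \<in> Car X \<Longrightarrow> y \<in> Car X \<Longrightarrow> (x, y) \<in> Rel X \<longleftrightarrow> (\<phi> x, \<phi> y) \<in> Rel Y"
  shows "preord_iso X Y \<phi>"
  using assms unfolding preord_iso_def bij_betw_def by blast

lemma preord_isoD:
  assumes "preord_iso X Y \<phi>"
  shows "inj_on \<phi> (Car X)" "\<phi> ` Car X = Car Y" "x \<in> Car X \<Longrightarrow> \<phi> x \<in> Car Y"
    "x \<in> Car X \<Longrightarrow> y \<in> Car X \<Longrightarrow> (x, y) \<in> Rel X \<longleftrightarrow> (\<phi> x, \<phi> y) \<in> Rel Y"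
  using assms unfolding preord_iso_def bij_betw_def by blast+

lemma preord_iso_trans:
  assumes "preord_iso X Y \<phi>" "preord_iso Y Z \<psi>"
  shows "preord_iso X Z (\<psi> \<circ> \<phi>)"
  using assms bij_betw_trans unfolding preord_iso_def by (auto dest: bij_betwE)

lemma preord_iso_inverse:
  assumes "preord_iso X Y \<phi>"
  shows "preord_iso Y X (the_inv_into (Car X) \<phi>)"
proof -
  have b: "bij_betw \<phi> (Car X) (Car Y)" using assms unfolding preord_iso_def by simp
  have "(x, y) \<in> Rel Y \<longleftrightarrow> (the_inv_into (Car X) \<phi> x, the_inv_into (Car X) \<phi> y) \<in> Rel X"
    if "x \<in> Car Y" "y \<in> Car Y" for x y
  proof -
    let ?g = "the_inv_into (Car X) \<phi>"
    have "?g x \<in> Car X" "?g y \<in> Car X" using bij_betwE[OF bij_betw_the_inv_into[OF b]] that by auto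
    from preord_isoD(4)[OF assms this] show ?thesis
      using f_the_inv_into_f_bij_betw[OF b] that by simp
  qed
  then show ?thesis using bij_betw_the_inv_into[OF b] unfolding preord_iso_def by blast
qed

definition image_preord :: "('a \<Rightarrow> 'b) \<Rightarrow> 'a preord \<Rightarrow> 'b preord" where
  "image_preord c X = \<lparr>Car = c ` Car X, Rel = {(c x, c y) | x y. (x, y) \<in> Rel X}\<rparr>"

lemma preord_iso_image:
  assumes c: "inj_on c (Car X)" and X: "is_preord X"
  shows "preord_iso X (image_preord c X) c"
proof (rule preord_isoI[OF c])
  fix x y assume xy: "x \<in> Car X" "y \<in> Car X"
  have "x' = x \<and> y' = y" if "(x', y') \<in> Rel X" "c x' = c x" "c y' = c y" for x' y'
  proof -
    have "x' \<in> Car X" "y' \<in> Car X" using X that(1) unfolding is_preord_iff by blast+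
    then show ?thesis using inj_onD[OF c that(2)] inj_onD[OF c that(3)] xy by blast
  qed
  then show "(x, y) \<in> Rel X \<longleftrightarrow> (c x, c y) \<in> Rel (image_preord c X)"
    unfolding image_preord_def by auto
qed (simp add: image_preord_def)

lemma is_preord_image:
  assumes c: "inj_on c (Car X)" and X: "is_preord X"
  shows "is_preord (image_preord c X)"
proof -
  have R: "x \<in> Car X \<and> y \<in> Car X" if "(x, y) \<in> Rel X" for x y
    using X that unfolding is_preord_iff by blast
  have "(a, d) \<in> Rel (image_preord c X)"
    if ab: "(a, b) \<in> Rel (image_preord c X)" and bd: "(b, d) \<in> Rel (image_preord c X)" for a b d
  proof -
    from ab obtain x y where xy: "a = c x" "b = c y" "(x, y) \<in> Rel X"
      unfolding image_preord_def by auto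
    from bd obtain y' w where yw: "b = c y'" "d = c w" "(y', w) \<in> Rel X"
      unfolding image_preord_def by auto
    have "y = y'" using inj_onD[OF c, of y y'] xy yw R by simp
    then have "(x, w) \<in> Rel X" using xy yw X unfolding is_preord_iff by blast
    then show ?thesis using xy yw unfolding image_preord_def by auto
  qed
  moreover have "(x, x) \<in> Rel (image_preord c X)" if "x \<in> Car (image_preord c X)" for x
    using that X unfolding is_preord_iff image_preord_def by auto
  moreover have "Rel (image_preord c X) \<subseteq> Car (image_preord c X) \<times> Car (image_preord c X)"
    using R unfolding image_preord_def by auto
  ultimately show ?thesis unfolding is_preord_iff by blast
qed

text \<open>An interface to the variety that hides functors and natural transformations:
  \<open>u_inj\<close> is faithfulness, \<open>u_full\<close> fullness, \<open>Le_iff\<close>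
  compares the orders on hom-sets, and \<open>realized\<close> is essential surjectivity onto the
  bounded preorders carried by subsets of \<open>'a\<close>.\<close>

locale bounded_preord_category = ord_category C for C :: "('o, 'm) ordcat" +
  fixes U :: "'o \<Rightarrow> 'a preord" and bt tp :: "'o \<Rightarrow> 'a" and u :: "'m \<Rightarrow> 'a \<Rightarrow> 'a"
  assumes infinite_universe: "infinite (UNIV :: 'a set)"
    and U_bounded: "A \<in> Obj C \<Longrightarrow> bounded_preord (U A) (bt A) (tp A)"
    and u_mono: "f \<in> hom C A B \<Longrightarrow> u f \<in> mono_maps (U A) (U B)"
    and u_bt: "f \<in> hom C A B \<Longrightarrow> u f (bt A) = bt B"
    and u_tp: "f \<in> hom C A B \<Longrightarrow> u f (tp A) = tp B"
    and u_comp: "\<lbrakk>f \<in> hom C A B; g \<in> hom C B D; x \<in> Car (U A)\<rbrakk> \<Longrightarrow> u (Comp C g f) x = u g (u f x)"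
    and u_id: "\<lbrakk>A \<in> Obj C; x \<in> Car (U A)\<rbrakk> \<Longrightarrow> u (Idt C A) x = x"
    and u_full: "\<lbrakk>A \<in> Obj C; B \<in> Obj C; m \<in> mono_maps (U A) (U B); m (bt A) = bt B; m (tp A) = tp B\<rbrakk>
      \<Longrightarrow> \<exists>f\<in>hom C A B. \<forall>x\<in>Car (U A). u f x = m x"
    and u_inj: "\<lbrakk>f \<in> hom C A B; g \<in> hom C A B; \<And>x. x \<in> Car (U A) \<Longrightarrow> u f x = u g x\<rbrakk> \<Longrightarrow> f = g"
    and Le_iff: "\<lbrakk>f \<in> hom C A B; g \<in> hom C A B\<rbrakk>
      \<Longrightarrow> Le C f g \<longleftrightarrow> (\<forall>x\<in>Car (U A). (u f x, u g x) \<in> Rel (U B))"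
    and realized: "bounded_preord (M :: 'a preord) z t
      \<Longrightarrow> \<exists>A\<in>Obj C. \<exists>j. preord_iso (U A) M j \<and> j (bt A) = z \<and> j (tp A) = t"
begin

section \<open>Finite limits, 2-pullbacks and comma objects from subsets of products\<close>

lemma U_pre: "A \<in> Obj C \<Longrightarrow> is_preord (U A)"
  and U_bt: "A \<in> Obj C \<Longrightarrow> bt A \<in> Car (U A)"
  and U_tp: "A \<in> Obj C \<Longrightarrow> tp A \<in> Car (U A)"
  and U_bt_le: "A \<in> Obj C \<Longrightarrow> x \<in> Car (U A) \<Longrightarrow> (bt A, x) \<in> Rel (U A)"
  and U_le_tp: "A \<in> Obj C \<Longrightarrow> x \<in> Car (U A) \<Longrightarrow> (x, tp A) \<in> Rel (U A)"
  using U_bounded unfolding bounded_preord_def by auto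

lemma U_refl: "A \<in> Obj C \<Longrightarrow> x \<in> Car (U A) \<Longrightarrow> (x, x) \<in> Rel (U A)"
  and U_Rel: "A \<in> Obj C \<Longrightarrow> (x, y) \<in> Rel (U A) \<Longrightarrow> x \<in> Car (U A) \<and> y \<in> Car (U A)"
  and U_trans: "A \<in> Obj C \<Longrightarrow> (x, y) \<in> Rel (U A) \<Longrightarrow> (y, z) \<in> Rel (U A) \<Longrightarrow> (x, z) \<in> Rel (U A)"
  using U_pre[of A] unfolding is_preord_iff by blast+

lemma u_Car: "f \<in> hom C A B \<Longrightarrow> x \<in> Car (U A) \<Longrightarrow> u f x \<in> Car (U B)"
  by (rule mono_mapsD(1)[OF u_mono])

lemma u_Rel: "f \<in> hom C A B \<Longrightarrow> (x, y) \<in> Rel (U A) \<Longrightarrow> (u f x, u f y) \<in> Rel (U B)"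
  by (rule mono_mapsD(3)[OF u_mono])

lemma hom_Obj: "f \<in> hom C A B \<Longrightarrow> A \<in> Obj C \<and> B \<in> Obj C"
  using dom_obj cod_obj unfolding hom_def by auto

text \<open>Limits are carried by sets of functions, not by subsets of \<open>'a\<close>.
  Transporting such a set along an injective code makes \<open>realized\<close> applicable, and
  decoding afterwards recovers the original elements.\<close>

lemma realized_coded:
  fixes M :: "'b preord" and c :: "'b \<Rightarrow> 'a"
  assumes M: "bounded_preord M z t" and c: "inj_on c (Car M)"
  shows "\<exists>A\<in>Obj C. \<exists>j. preord_iso (U A) M j \<and> j (bt A) = z \<and> j (tp A) = t"
proof -
  have pM: "is_preord M" using M unfolding bounded_preord_def by simp
  note ic = preord_iso_image[OF c pM]
  have "bounded_preord (image_preord c M) (c z) (c t)"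
    using M is_preord_image[OF c pM] unfolding bounded_preord_def image_preord_def by auto
  from realized[OF this] obtain A j where A: "A \<in> Obj C"
    and j: "preord_iso (U A) (image_preord c M) j" "j (bt A) = c z" "j (tp A) = c t" by blast
  let ?d = "the_inv_into (Car M) c"
  have "preord_iso (U A) M (?d \<circ> j)" by (rule preord_iso_trans[OF j(1) preord_iso_inverse[OF ic]])
  moreover have "(?d \<circ> j) (bt A) = z" "(?d \<circ> j) (tp A) = t"
    using j the_inv_into_f_f[OF c] M unfolding bounded_preord_def by auto
  ultimately show ?thesis using A by blast
qed

text \<open>All finite limits, 2-pullbacks and comma objects are instances of this construction: a
  subset \<open>S\<close> of a finite product which contains the bounds.\<close>

definition is_subproduct :: "'i set \<Rightarrow> ('i \<Rightarrow> 'o) \<Rightarrow> ('i \<Rightarrow> 'a) set \<Rightarrow> 'o \<Rightarrow> ('i \<Rightarrow> 'm) \<Rightarrow> bool" where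
  "is_subproduct I A S L p \<longleftrightarrow> L \<in> Obj C \<and> (\<forall>i\<in>I. p i \<in> hom C L (A i)) \<and>
    (\<forall>x\<in>Car (U L). (\<lambda>i\<in>I. u (p i) x) \<in> S) \<and>
    (\<forall>W q. W \<in> Obj C \<and> (\<forall>i\<in>I. q i \<in> hom C W (A i)) \<and> (\<forall>w\<in>Car (U W). (\<lambda>i\<in>I. u (q i) w) \<in> S) \<longrightarrow>
      (\<exists>!h. h \<in> hom C W L \<and> (\<forall>i\<in>I. Comp C (p i) h = q i))) \<and>
    (\<forall>W. \<forall>h\<in>hom C W L. \<forall>k\<in>hom C W L. (\<forall>i\<in>I. Le C (Comp C (p i) h) (Comp C (p i) k)) \<longrightarrow> Le C h k)"

lemma is_subproductD:
  assumes "is_subproduct I A S L p"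
  shows "L \<in> Obj C" "\<And>i. i \<in> I \<Longrightarrow> p i \<in> hom C L (A i)"
    "\<And>x. x \<in> Car (U L) \<Longrightarrow> (\<lambda>i\<in>I. u (p i) x) \<in> S"
    "\<And>W q. \<lbrakk>W \<in> Obj C; \<And>i. i \<in> I \<Longrightarrow> q i \<in> hom C W (A i);
        \<And>w. w \<in> Car (U W) \<Longrightarrow> (\<lambda>i\<in>I. u (q i) w) \<in> S\<rbrakk>
      \<Longrightarrow> \<exists>!h. h \<in> hom C W L \<and> (\<forall>i\<in>I. Comp C (p i) h = q i)"
    "\<And>W h k. \<lbrakk>h \<in> hom C W L; k \<in> hom C W L;
        \<And>i. i \<in> I \<Longrightarrow> Le C (Comp C (p i) h) (Comp C (p i) k)\<rbrakk> \<Longrightarrow> Le C h k"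
  using assms unfolding is_subproduct_def by simp_all

text \<open>With the componentwise order, \<open>S\<close> is bounded by the two tuples of bounds,
  so it is realized by an object once its elements are coded in \<open>'a\<close>. The projections
  are evaluations at \<open>i\<close>; these are bounded maps and lift to arrows by
  fullness.\<close>

lemma subproduct:
  fixes I :: "'b set"
  assumes I: "finite I" and A: "\<And>i. i \<in> I \<Longrightarrow> A i \<in> Obj C"
    and S: "S \<subseteq> (\<Pi>\<^sub>E i\<in>I. Car (U (A i)))"
    and Sb: "(\<lambda>i\<in>I. bt (A i)) \<in> S" and St: "(\<lambda>i\<in>I. tp (A i)) \<in> S"
  shows "\<exists>L p. is_subproduct I A S L p"
proof -
  define M where "M = \<lparr>Car = S, Rel = {(x, y). x \<in> S \<and> y \<in> S \<and> (\<forall>i\<in>I. (x i, y i) \<in> Rel (U (A i)))}\<rparr>"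
  have Si: "x i \<in> Car (U (A i))" if "x \<in> S" "i \<in> I" for x i using S that by auto
  have pM: "is_preord M"
    unfolding is_preord_iff
  proof (intro conjI allI impI)
    show "Rel M \<subseteq> Car M \<times> Car M" by (auto simp: M_def)
    show "\<forall>x\<in>Car M. (x, x) \<in> Rel M" using Si U_refl A by (auto simp: M_def)
  next
    fix x y z assume "(x, y) \<in> Rel M" "(y, z) \<in> Rel M"
    then show "(x, z) \<in> Rel M" using U_trans A by (auto simp: M_def)
  qed
  have bM: "bounded_preord M (\<lambda>i\<in>I. bt (A i)) (\<lambda>i\<in>I. tp (A i))"
    unfolding bounded_preord_def using pM Sb St Si U_bt_le U_le_tp A by (auto simp: M_def)
  obtain c :: "('b \<Rightarrow> 'a) \<Rightarrow> 'a" where c: "inj_on c (extensional I)"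
    using finite_family_injection[OF infinite_universe I] by blast
  have "Car M \<subseteq> extensional I" using S by (auto simp: M_def PiE_def)
  then have "inj_on c (Car M)" using c inj_on_subset by blast
  from realized_coded[OF bM this] obtain L j where L: "L \<in> Obj C" and j: "preord_iso (U L) M j"
    and jb: "j (bt L) = (\<lambda>i\<in>I. bt (A i))" and jt: "j (tp L) = (\<lambda>i\<in>I. tp (A i))" by blast
  have jS: "j x \<in> S" if "x \<in> Car (U L)" for x
    using j that unfolding preord_iso_def M_def by (auto simp: bij_betw_def)
  have jR: "(x, y) \<in> Rel (U L) \<longleftrightarrow> (\<forall>i\<in>I. (j x i, j y i) \<in> Rel (U (A i)))"
    if "x \<in> Car (U L)" "y \<in> Car (U L)" for x y
    using j that jS unfolding preord_iso_def M_def by auto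
  have jinj: "inj_on j (Car (U L))" and jsurj: "j ` Car (U L) = S"
    using j unfolding preord_iso_def M_def by (auto simp: bij_betw_def)
  have "\<exists>f\<in>hom C L (A i). \<forall>x\<in>Car (U L). u f x = (\<lambda>x\<in>Car (U L). j x i) x" if i: "i \<in> I" for i
  proof (rule u_full[OF L A[OF i]])
    show "(\<lambda>x\<in>Car (U L). j x i) \<in> mono_maps (U L) (U (A i))"
    proof (rule mono_mapsI)
      fix x y assume xy: "(x, y) \<in> Rel (U L)"
      then have "x \<in> Car (U L)" "y \<in> Car (U L)" using U_Rel[OF L xy] by auto
      then show "((\<lambda>x\<in>Car (U L). j x i) x, (\<lambda>x\<in>Car (U L). j x i) y) \<in> Rel (U (A i))"
        using jR xy i by simp
    qed (use Si[OF jS i] in simp_all)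
    show "(\<lambda>x\<in>Car (U L). j x i) (bt L) = bt (A i)" using jb i U_bt[OF L] by simp
    show "(\<lambda>x\<in>Car (U L). j x i) (tp L) = tp (A i)" using jt i U_tp[OF L] by simp
  qed
  then have "\<forall>i. \<exists>f. i \<in> I \<longrightarrow> f \<in> hom C L (A i) \<and> (\<forall>x\<in>Car (U L). u f x = j x i)"
    by (auto simp: Bex_def)
  then obtain p where p: "\<And>i. i \<in> I \<Longrightarrow> p i \<in> hom C L (A i)"
    and pj: "\<And>i x. i \<in> I \<Longrightarrow> x \<in> Car (U L) \<Longrightarrow> u (p i) x = j x i" by metis
  have ext: "(\<lambda>i\<in>I. u (p i) x) = j x" if "x \<in> Car (U L)" for x
  proof (rule extensionalityI)
    show "j x \<in> extensional I" using jS[OF that] S by (auto simp: PiE_def)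
  qed (use pj that in auto)
  have le: "Le C h k" if h: "h \<in> hom C W L" and k: "k \<in> hom C W L"
    and ik: "\<And>i. i \<in> I \<Longrightarrow> Le C (Comp C (p i) h) (Comp C (p i) k)" for W h k
    unfolding Le_iff[OF h k]
  proof
    fix w assume w: "w \<in> Car (U W)"
    have "(j (u h w) i, j (u k w) i) \<in> Rel (U (A i))" if i: "i \<in> I" for i
    proof -
      have "(u (Comp C (p i) h) w, u (Comp C (p i) k) w) \<in> Rel (U (A i))"
        using ik[OF i] Le_iff[OF comp_hom[OF h p[OF i]] comp_hom[OF k p[OF i]]] w by blast
      then show ?thesis
        using u_comp[OF h p[OF i] w] u_comp[OF k p[OF i] w] pj[OF i] u_Car[OF h w] u_Car[OF k w] by simp
    qed
    then show "(u h w, u k w) \<in> Rel (U L)" using jR u_Car[OF h w] u_Car[OF k w] by blast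
  qed
  have ex1: "\<exists>!h. h \<in> hom C W L \<and> (\<forall>i\<in>I. Comp C (p i) h = q i)"
    if W: "W \<in> Obj C" and q: "\<And>i. i \<in> I \<Longrightarrow> q i \<in> hom C W (A i)"
      and qS: "\<And>w. w \<in> Car (U W) \<Longrightarrow> (\<lambda>i\<in>I. u (q i) w) \<in> S" for W q
  proof -
    \<comment> \<open>The only candidate for a mediating map: the element of \<open>L\<close> that
      \<open>j\<close> decodes to the tuple of the values at \<open>w\<close>. Injectivity of
      \<open>j\<close> then shows that it preserves the bounds.\<close>
    define m where "m = (\<lambda>w\<in>Car (U W). the_inv_into (Car (U L)) j (\<lambda>i\<in>I. u (q i) w))"
    have m: "m w \<in> Car (U L)" "j (m w) = (\<lambda>i\<in>I. u (q i) w)" if w: "w \<in> Car (U W)" for w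
    proof -
      have *: "(\<lambda>i\<in>I. u (q i) w) \<in> j ` Car (U L)" unfolding jsurj by (rule qS[OF w])
      show "m w \<in> Car (U L)" using the_inv_into_into[OF jinj * subset_refl] w by (simp add: m_def)
      show "j (m w) = (\<lambda>i\<in>I. u (q i) w)" using f_the_inv_into_f[OF jinj *] w by (simp add: m_def)
    qed
    have mm: "m \<in> mono_maps (U W) (U L)"
    proof (rule mono_mapsI)
      fix x y assume xy: "(x, y) \<in> Rel (U W)"
      then have "x \<in> Car (U W)" "y \<in> Car (U W)" using U_Rel[OF W] by auto
      then show "(m x, m y) \<in> Rel (U L)" using jR[OF m(1) m(1)] m(2) u_Rel[OF q xy] by simp
    qed (use m(1) in \<open>simp_all add: m_def\<close>)
    have mb: "m (bt W) = bt L"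
    proof (rule inj_onD[OF jinj])
      show "j (m (bt W)) = j (bt L)" 
        unfolding m(2)[OF U_bt[OF W]] jb using u_bt[OF q] by (simp cong: restrict_cong)
    qed (rule m(1)[OF U_bt[OF W]], rule U_bt[OF L])
    have mt: "m (tp W) = tp L"
    proof (rule inj_onD[OF jinj])
      show "j (m (tp W)) = j (tp L)" 
        unfolding m(2)[OF U_tp[OF W]] jt using u_tp[OF q] by (simp cong: restrict_cong)
    qed (rule m(1)[OF U_tp[OF W]], rule U_tp[OF L])
    from u_full[OF W L mm mb mt] obtain h where h: "h \<in> hom C W L"
      and hm: "\<And>x. x \<in> Car (U W) \<Longrightarrow> u h x = m x" by blast
    have hq: "Comp C (p i) h = q i" if i: "i \<in> I" for i
    proof (rule u_inj[OF comp_hom[OF h p[OF i]] q[OF i]])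
      fix w assume w: "w \<in> Car (U W)"
      then show "u (Comp C (p i) h) w = u (q i) w"
        using u_comp[OF h p[OF i] w] hm[OF w] pj[OF i m(1)[OF w]] m(2)[OF w] i by simp
    qed
    have "k = h" if k: "k \<in> hom C W L" and kq: "\<forall>i\<in>I. Comp C (p i) k = q i" for k
    proof (rule u_inj[OF k h])
      fix w assume w: "w \<in> Car (U W)"
      have "u (p i) (u k w) = u (p i) (u h w)" if i: "i \<in> I" for i
        using u_comp[OF k p[OF i] w] u_comp[OF h p[OF i] w] kq hq[OF i] i by simp
      then have "(\<lambda>i\<in>I. u (p i) (u k w)) = (\<lambda>i\<in>I. u (p i) (u h w))"
        by (intro restrict_ext)
      then have "j (u k w) = j (u h w)" using ext u_Car[OF k w] u_Car[OF h w] by simp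
      then show "u k w = u h w" by (rule inj_onD[OF jinj _ u_Car[OF k w] u_Car[OF h w]])
    qed
    then show ?thesis using h hq by blast
  qed
  have "is_subproduct I A S L p"
    unfolding is_subproduct_def
  proof (intro conjI)
    show "\<forall>x\<in>Car (U L). (\<lambda>i\<in>I. u (p i) x) \<in> S" using ext jS by simp
    show "\<forall>W q. W \<in> Obj C \<and> (\<forall>i\<in>I. q i \<in> hom C W (A i)) \<and> (\<forall>w\<in>Car (U W). (\<lambda>i\<in>I. u (q i) w) \<in> S) \<longrightarrow>
        (\<exists>!h. h \<in> hom C W L \<and> (\<forall>i\<in>I. Comp C (p i) h = q i))"
      by (intro allI impI, rule ex1) auto
    show "\<forall>W. \<forall>h\<in>hom C W L. \<forall>k\<in>hom C W L.
        (\<forall>i\<in>I. Le C (Comp C (p i) h) (Comp C (p i) k)) \<longrightarrow> Le C h k"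
      by (intro allI ballI impI, rule le) auto
  qed (use L p in blast)+
  then show ?thesis by blast
qed

text \<open>The limit consists of the compatible families. Both families of bounds are compatible
  because the arrows of the diagram preserve bounds, so \<open>subproduct\<close> applies.\<close>

lemma finitely_complete: "finitely_complete C"
  unfolding finitely_complete_def
proof (intro allI impI)
  fix S :: "(nat, nat) ordcat" and F
  assume *: "ord_category S \<and> finite (Obj S) \<and> finite (Arr S) \<and>
    (\<forall>e\<in>Arr S. \<forall>e'\<in>Arr S. Le S e e' \<longleftrightarrow> e = e') \<and> ord_functor S C F"
  then interpret S: ord_category S by blast
  let ?A = "FObj F"
  have A: "?A i \<in> Obj C" if "i \<in> Obj S" for i
    using * that unfolding ord_functor_def by (auto simp: PiE_def Pi_def)
  have Fe: "FArr F e \<in> hom C (?A (Dom S e)) (?A (Cod S e))" if "e \<in> Arr S" for e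
    using * that unfolding ord_functor_def hom_def by (auto simp: PiE_def Pi_def)
  define Q where "Q = {x \<in> \<Pi>\<^sub>E i\<in>Obj S. Car (U (?A i)). \<forall>e\<in>Arr S. u (FArr F e) (x (Dom S e)) = x (Cod S e)}"
  have bt: "(\<lambda>i\<in>Obj S. bt (?A i)) \<in> Q" and tp: "(\<lambda>i\<in>Obj S. tp (?A i)) \<in> Q"
    using A U_bt U_tp S.dom_obj S.cod_obj u_bt[OF Fe] u_tp[OF Fe] unfolding Q_def by auto
  have fin: "finite (Obj S)" using * by blast
  have Q: "Q \<subseteq> (\<Pi>\<^sub>E i\<in>Obj S. Car (U (?A i)))" by (auto simp: Q_def)
  have "\<exists>L p. is_subproduct (Obj S) ?A Q L p" by (rule subproduct[OF fin A Q bt tp])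
  then obtain L p where Lp: "is_subproduct (Obj S) ?A Q L p" by blast
  note L = is_subproductD(1)[OF Lp] and p = is_subproductD(2)[OF Lp] and pS = is_subproductD(3)[OF Lp]
    and ex1 = is_subproductD(4)[OF Lp]
  have "Comp C (FArr F e) (p (Dom S e)) = p (Cod S e)" if e: "e \<in> Arr S" for e
  proof (rule u_inj[OF comp_hom[OF p[OF S.dom_obj[OF e]] Fe[OF e]] p[OF S.cod_obj[OF e]]])
    fix x assume x: "x \<in> Car (U L)"
    then show "u (Comp C (FArr F e) (p (Dom S e))) x = u (p (Cod S e)) x"
      using u_comp[OF p[OF S.dom_obj[OF e]] Fe[OF e] x] pS[OF x] e S.dom_obj[OF e] S.cod_obj[OF e]
      unfolding Q_def by auto
  qed
  then have "is_cone S C F L p" unfolding is_cone_def using L p by blast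
  moreover have "\<exists>!h. h \<in> hom C W L \<and> (\<forall>i\<in>Obj S. Comp C (p i) h = q i)"
    if cone: "is_cone S C F W q" for W q
  proof (rule ex1)
    show "W \<in> Obj C" using cone unfolding is_cone_def by blast
    show q: "q i \<in> hom C W (?A i)" if "i \<in> Obj S" for i
      using cone that unfolding is_cone_def by blast
    show "(\<lambda>i\<in>Obj S. u (q i) w) \<in> Q" if w: "w \<in> Car (U W)" for w
    proof -
      have "u (FArr F e) (u (q (Dom S e)) w) = u (q (Cod S e)) w" if e: "e \<in> Arr S" for e
        using u_comp[OF q[OF S.dom_obj[OF e]] Fe[OF e] w] cone e unfolding is_cone_def by auto
      then show ?thesis
        using u_Car[OF q w] S.dom_obj S.cod_obj unfolding Q_def by auto
    qed
  qed
  ultimately show "\<exists>L p. is_cone S C F L p \<and> (\<forall>W q. is_cone S C F W q \<longrightarrow>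
      (\<exists>!h. h \<in> hom C W L \<and> (\<forall>i\<in>Obj S. Comp C (p i) h = q i)))" by blast
qed

definition is_binary_subproduct :: "'o \<Rightarrow> 'o \<Rightarrow> ('a \<times> 'a) set \<Rightarrow> 'o \<Rightarrow> 'm \<Rightarrow> 'm \<Rightarrow> bool" where
  "is_binary_subproduct A B S P p1 p2 \<longleftrightarrow> p1 \<in> hom C P A \<and> p2 \<in> hom C P B \<and>
    (\<forall>x\<in>Car (U P). (u p1 x, u p2 x) \<in> S) \<and>
    (\<forall>W. \<forall>h\<in>hom C W A. \<forall>k\<in>hom C W B. (\<forall>w\<in>Car (U W). (u h w, u k w) \<in> S) \<longrightarrow>
      (\<exists>!v. v \<in> hom C W P \<and> Comp C p1 v = h \<and> Comp C p2 v = k)) \<and>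
    (\<forall>W. \<forall>v\<in>hom C W P. \<forall>v'\<in>hom C W P.
      Le C (Comp C p1 v) (Comp C p1 v') \<and> Le C (Comp C p2 v) (Comp C p2 v') \<longrightarrow> Le C v v')"

lemma is_binary_subproductD:
  assumes "is_binary_subproduct A B S P p1 p2"
  shows "p1 \<in> hom C P A" "p2 \<in> hom C P B" "\<And>x. x \<in> Car (U P) \<Longrightarrow> (u p1 x, u p2 x) \<in> S"
    "\<And>W h k. \<lbrakk>h \<in> hom C W A; k \<in> hom C W B; \<And>w. w \<in> Car (U W) \<Longrightarrow> (u h w, u k w) \<in> S\<rbrakk>
      \<Longrightarrow> \<exists>!v. v \<in> hom C W P \<and> Comp C p1 v = h \<and> Comp C p2 v = k"
    "\<And>W v v'. \<lbrakk>v \<in> hom C W P; v' \<in> hom C W P; Le C (Comp C p1 v) (Comp C p1 v');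
      Le C (Comp C p2 v) (Comp C p2 v')\<rbrakk> \<Longrightarrow> Le C v v'"
  using assms unfolding is_binary_subproduct_def by simp_all

lemma binary_subproduct:
  assumes A: "A \<in> Obj C" and B: "B \<in> Obj C" and S: "S \<subseteq> Car (U A) \<times> Car (U B)"
    and Sb: "(bt A, bt B) \<in> S" and St: "(tp A, tp B) \<in> S"
  shows "\<exists>P p1 p2. is_binary_subproduct A B S P p1 p2"
proof -
  let ?I = "{0, 1 :: nat}"
  let ?A = "\<lambda>i :: nat. if i = 0 then A else B"
  define Q where "Q = {x \<in> \<Pi>\<^sub>E i\<in>?I. Car (U (?A i)). (x 0, x 1) \<in> S}"
  have QI: "(\<lambda>i\<in>?I. y i) \<in> Q \<longleftrightarrow> (y 0, y 1) \<in> S" for y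
    using S unfolding Q_def by auto
  have A': "?A i \<in> Obj C" for i using A B by simp
  have bt: "(\<lambda>i\<in>?I. bt (?A i)) \<in> Q" and tp: "(\<lambda>i\<in>?I. tp (?A i)) \<in> Q"
    unfolding QI using Sb St by simp_all
  have fin: "finite ?I" by simp
  have Q: "Q \<subseteq> (\<Pi>\<^sub>E i\<in>?I. Car (U (?A i)))" by (auto simp: Q_def)
  have "\<exists>P p. is_subproduct ?I ?A Q P p" by (rule subproduct[OF fin A' Q bt tp])
  then obtain P p where Pp: "is_subproduct ?I ?A Q P p" by blast
  note p = is_subproductD(2)[OF Pp] and pS = is_subproductD(3)[OF Pp]
    and ex1 = is_subproductD(4)[OF Pp] and le = is_subproductD(5)[OF Pp]
  have "is_binary_subproduct A B S P (p 0) (p 1)"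
    unfolding is_binary_subproduct_def
  proof (intro conjI ballI allI impI)
    show "p 0 \<in> hom C P A" "p 1 \<in> hom C P B" using p[of 0] p[of 1] by simp_all
    show "(u (p 0) x, u (p 1) x) \<in> S" if "x \<in> Car (U P)" for x
      using pS[OF that] unfolding QI .
  next
    fix W h k assume h: "h \<in> hom C W A" and k: "k \<in> hom C W B"
      and hk: "\<forall>w\<in>Car (U W). (u h w, u k w) \<in> S"
    have "\<exists>!v. v \<in> hom C W P \<and> (\<forall>i\<in>?I. Comp C (p i) v = (if i = 0 then h else k))"
    proof (rule ex1)
      show "W \<in> Obj C" using hom_Obj[OF h] by simp
      show "(if i = 0 then h else k) \<in> hom C W (?A i)" for i :: nat using h k by simp
      show "(\<lambda>i\<in>?I. u (if i = 0 then h else k) w) \<in> Q" if "w \<in> Car (U W)" for w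
        unfolding QI using hk that by simp
    qed
    then show "\<exists>!v. v \<in> hom C W P \<and> Comp C (p 0) v = h \<and> Comp C (p 1) v = k" by simp
  next
    fix W v v' assume v: "v \<in> hom C W P" "v' \<in> hom C W P"
      and "Le C (Comp C (p 0) v) (Comp C (p 0) v') \<and> Le C (Comp C (p 1) v) (Comp C (p 1) v')"
    then show "Le C v v'" by (intro le[OF v]) auto
  qed
  then show ?thesis by blast
qed

text \<open>A common form of 2-pullbacks (\<open>R\<close> and \<open>Q\<close> are equality) and
  comma objects (\<open>R\<close> is \<open>Le C\<close>, \<open>Q\<close> the order of the base).
  All that is needed is that \<open>R\<close> is \<open>Q\<close> taken pointwise and that
  \<open>Q\<close> relates each bound to itself, which puts the pairs of bounds into the
  subset.\<close>

lemma binary_limit: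
  assumes f: "f \<in> hom C A B" and g: "g \<in> hom C A' B"
    and Qb: "Q (bt B) (bt B)" and Qt: "Q (tp B) (tp B)"
    and R: "\<And>W h k. \<lbrakk>h \<in> hom C W B; k \<in> hom C W B\<rbrakk> \<Longrightarrow> R h k \<longleftrightarrow> (\<forall>w\<in>Car (U W). Q (u h w) (u k w))"
  shows "\<exists>P p1 p2. p1 \<in> hom C P A \<and> p2 \<in> hom C P A' \<and> R (Comp C f p1) (Comp C g p2) \<and>
    (\<forall>W. \<forall>h\<in>hom C W A. \<forall>k\<in>hom C W A'. R (Comp C f h) (Comp C g k) \<longrightarrow>
      (\<exists>!v. v \<in> hom C W P \<and> Comp C p1 v = h \<and> Comp C p2 v = k)) \<and>
    (\<forall>W. \<forall>v\<in>hom C W P. \<forall>v'\<in>hom C W P.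
      Le C (Comp C p1 v) (Comp C p1 v') \<and> Le C (Comp C p2 v) (Comp C p2 v') \<longrightarrow> Le C v v')"
proof -
  have AB: "A \<in> Obj C" "A' \<in> Obj C" using hom_Obj[OF f] hom_Obj[OF g] by auto
  define S where "S = {(x, y). x \<in> Car (U A) \<and> y \<in> Car (U A') \<and> Q (u f x) (u g y)}"
  have S: "S \<subseteq> Car (U A) \<times> Car (U A')" "(bt A, bt A') \<in> S" "(tp A, tp A') \<in> S"
    using AB U_bt U_tp u_bt[OF f] u_bt[OF g] u_tp[OF f] u_tp[OF g] Qb Qt by (auto simp: S_def)
  have RS: "R (Comp C f h) (Comp C g k) \<longleftrightarrow> (\<forall>w\<in>Car (U W). (u h w, u k w) \<in> S)"
    if h: "h \<in> hom C W A" and k: "k \<in> hom C W A'" for W h k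
    using R[OF comp_hom[OF h f] comp_hom[OF k g]] u_comp[OF h f] u_comp[OF k g] u_Car[OF h] u_Car[OF k]
    by (simp add: S_def)
  obtain P p1 p2 where P: "is_binary_subproduct A A' S P p1 p2" using binary_subproduct[OF AB S] by blast
  note p = is_binary_subproductD(1,2)[OF P]
  have "R (Comp C f p1) (Comp C g p2)" using RS[OF p] is_binary_subproductD(3)[OF P] by blast
  then show ?thesis using P RS unfolding is_binary_subproduct_def by (intro exI[of _ P] exI[of _ p1] exI[of _ p2]) simp
qed

lemma has_two_pullbacks: "has_two_pullbacks C"
  unfolding has_two_pullbacks_def
proof (intro ballI impI)
  fix f g assume "f \<in> Arr C" "g \<in> Arr C" "Cod C f = Cod C g"
  then have f: "f \<in> hom C (Dom C f) (Cod C f)" and g: "g \<in> hom C (Dom C g) (Cod C f)"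
    by (auto simp: hom_def)
  show "\<exists>P p1 p2. is_two_pullback C f g P p1 p2"
    unfolding is_two_pullback_def
    by (rule binary_limit[OF f g, where R = "(=)" and Q = "(=)"]) (use u_inj in auto)
qed

lemma has_commas: "has_commas C"
  unfolding has_commas_def
proof (intro ballI impI)
  fix f g assume "f \<in> Arr C" "g \<in> Arr C" "Cod C f = Cod C g"
  then have f: "f \<in> hom C (Dom C f) (Cod C f)" and g: "g \<in> hom C (Dom C g) (Cod C f)"
    by (auto simp: hom_def)
  have B: "Cod C f \<in> Obj C" using hom_Obj[OF f] by simp
  show "\<exists>P p1 p2. is_comma C f g P p1 p2"
    unfolding is_comma_def
    by (rule binary_limit[OF f g, where R = "Le C" and Q = "\<lambda>x y. (x, y) \<in> Rel (U (Cod C f))"])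
      (use Le_iff U_refl[OF B U_bt[OF B]] U_refl[OF B U_tp[OF B]] in simp_all)
qed

section \<open>The free object on one generator\<close>

definition is_generator :: "'o \<Rightarrow> 'a \<Rightarrow> bool" where
  "is_generator G e \<longleftrightarrow> G \<in> Obj C \<and> e \<in> Car (U G) \<and>
    (\<forall>x\<in>Car (U G). x = bt G \<or> x = e \<or> x = tp G) \<and>
    (\<forall>A\<in>Obj C. \<forall>a\<in>Car (U A). \<exists>f\<in>hom C G A. u f e = a)"

text \<open>An arrow out of this object amounts to an element of its codomain, so universal
  properties quantified over all \<open>W\<close> can be tested on elements. A three-element chain
  is free on its middle element, since every \<open>a\<close> lies between the bounds.\<close>

lemma generator: "\<exists>G e. is_generator G e"
proof -
  obtain z :: 'a where True by blast
  obtain w where w: "w \<noteq> z" using ex_new_if_finite[OF infinite_universe, of "{z}"] by auto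
  obtain t where t: "t \<noteq> z" "t \<noteq> w" using ex_new_if_finite[OF infinite_universe, of "{z, w}"] by auto
  define M where "M = \<lparr>Car = {z, w, t}, Rel = {(x, y). x \<in> {z, w, t} \<and> y \<in> {z, w, t} \<and> (x = z \<or> y = t \<or> x = y)}\<rparr>"
  have "bounded_preord M z t"
    unfolding bounded_preord_def is_preord_iff M_def using t w by auto
  from realized[OF this] obtain G j where G: "G \<in> Obj C" and j: "preord_iso (U G) M j"
    and jb: "j (bt G) = z" and jt: "j (tp G) = t" by blast
  have bij: "bij_betw j (Car (U G)) {z, w, t}" using j unfolding preord_iso_def M_def by simp
  then obtain g where g: "g \<in> Car (U G)" "j g = w" unfolding bij_betw_def by (metis imageE insertCI)
  have inj: "x = y" if "x \<in> Car (U G)" "y \<in> Car (U G)" "j x = j y" for x y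
    using bij that unfolding bij_betw_def by (metis inj_onD)
  have Car: "x = bt G \<or> x = g \<or> x = tp G" if x: "x \<in> Car (U G)" for x
  proof -
    have "j x = j (bt G) \<or> j x = j g \<or> j x = j (tp G)"
      using x bij jb jt g unfolding bij_betw_def by auto
    then show ?thesis using inj x g(1) U_bt[OF G] U_tp[OF G] by metis
  qed
  have ne: "g \<noteq> bt G" "g \<noteq> tp G" "bt G \<noteq> tp G" using jb jt g t w by auto
  have Rel: "x = bt G \<or> y = tp G \<or> x = y" if xy: "(x, y) \<in> Rel (U G)" for x y
  proof -
    have c: "x \<in> Car (U G)" "y \<in> Car (U G)" using U_Rel[OF G xy] by auto
    then have "(j x, j y) \<in> Rel M" using j xy unfolding preord_iso_def by blast
    then have "j x = j (bt G) \<or> j y = j (tp G) \<or> j x = j y" using jb jt by (auto simp: M_def)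
    then show ?thesis using inj c U_bt[OF G] U_tp[OF G] by metis
  qed
  have "\<exists>f\<in>hom C G A. u f g = a" if A: "A \<in> Obj C" and a: "a \<in> Car (U A)" for A a
  proof -
    define m where "m = (\<lambda>x\<in>Car (U G). if x = g then a else if x = bt G then bt A else tp A)"
    have m: "m g = a" "m (bt G) = bt A" "m (tp G) = tp A"
      using ne g U_bt[OF G] U_tp[OF G] by (auto simp: m_def)
    have mC: "m x \<in> Car (U A)" if "x \<in> Car (U G)" for x
      using Car[OF that] m a U_bt[OF A] U_tp[OF A] by auto
    have "m \<in> mono_maps (U G) (U A)"
    proof (rule mono_mapsI)
      fix x y assume xy: "(x, y) \<in> Rel (U G)"
      then have c: "x \<in> Car (U G)" "y \<in> Car (U G)" using U_Rel[OF G xy] by auto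
      show "(m x, m y) \<in> Rel (U A)"
        using Rel[OF xy] m U_bt_le[OF A mC[OF c(2)]] U_le_tp[OF A mC[OF c(1)]] U_refl[OF A mC[OF c(1)]]
        by auto
    qed (use mC in \<open>simp_all add: m_def\<close>)
    from u_full[OF G A this m(2,3)] show ?thesis using m(1) g(1) by auto
  qed
  then have "is_generator G g" unfolding is_generator_def using G g Car by blast
  then show ?thesis by blast
qed

text \<open>Both arrows send the bounds of \<open>G\<close> to the bounds of \<open>A\<close>, so
  the value at \<open>e\<close> is all that is left to compare.\<close>

lemma generator_le:
  assumes G: "is_generator G e" and f: "f \<in> hom C G A" and f': "f' \<in> hom C G A"
    and le: "(u f e, u f' e) \<in> Rel (U A)"
  shows "Le C f f'"
  unfolding Le_iff[OF f f']
proof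
  fix x assume "x \<in> Car (U G)"
  then have "x = bt G \<or> x = e \<or> x = tp G" using G unfolding is_generator_def by blast
  moreover have A: "A \<in> Obj C" using hom_Obj[OF f] by simp
  ultimately show "(u f x, u f' x) \<in> Rel (U A)"
    using le u_bt[OF f] u_bt[OF f'] u_tp[OF f] u_tp[OF f'] U_refl[OF A U_bt[OF A]] U_refl[OF A U_tp[OF A]]
    by auto
qed

lemma generator_eq:
  assumes G: "is_generator G e" and f: "f \<in> hom C G A" and f': "f' \<in> hom C G A"
    and eq: "u f e = u f' e"
  shows "f = f'"
proof (rule u_inj[OF f f'])
  fix x assume "x \<in> Car (U G)"
  then have "x = bt G \<or> x = e \<or> x = tp G" using G unfolding is_generator_def by blast
  then show "u f x = u f' x" using eq u_bt[OF f] u_bt[OF f'] u_tp[OF f] u_tp[OF f'] by auto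
qed

end

section \<open>Isomorphisms of points and the chosen comma objects\<close>

lemma is_isoI:
  assumes "f \<in> hom C a b" "g \<in> hom C b a" "Comp C g f = Idt C a" "Comp C f g = Idt C b"
  shows "is_iso C f"
  using assms unfolding is_iso_def hom_def by auto

lemma is_isoE:
  assumes "is_iso C f" "f \<in> hom C a b"
  obtains g where "g \<in> hom C b a" "Comp C g f = Idt C a" "Comp C f g = Idt C b"
  using assms unfolding is_iso_def hom_def by auto

lemma Pt_ArrD:
  assumes "\<gamma> \<in> Arr (Pt C B)" "Src \<gamma> = (f, s)" "Tgt \<gamma> = (f', s')"
  shows "Fn \<gamma> \<in> hom C (Dom C f) (Dom C f')" "Comp C f' (Fn \<gamma>) = f" "Comp C (Fn \<gamma>) s = s'"
    "f \<in> hom C (Dom C f) B" "s \<in> hom C B (Dom C f)" "f' \<in> hom C (Dom C f') B" "s' \<in> hom C B (Dom C f')"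
    "is_point C B (f, s)" "is_point C B (f', s')"
  using assms by (auto simp: Pt_def is_point_def hom_def)

text \<open>An inverse \<open>d\<close> of the underlying arrow \<open>c\<close> is automatically a
  morphism of points: \<open>f d = f' c d = f'\<close> and \<open>d s' = d c s = s\<close>.\<close>

lemma (in ord_category) Pt_iso_iff:
  assumes \<gamma>: "\<gamma> \<in> Arr (Pt C B)"
  shows "is_iso (Pt C B) \<gamma> \<longleftrightarrow> is_iso C (Fn \<gamma>)"
proof -
  obtain f s f' s' where S: "Src \<gamma> = (f, s)" and T: "Tgt \<gamma> = (f', s')" by fastforce
  let ?A = "Dom C f" and ?A' = "Dom C f'" and ?c = "Fn \<gamma>"
  note c = Pt_ArrD(1)[OF \<gamma> S T] and eq = Pt_ArrD(2,3)[OF \<gamma> S T] and f = Pt_ArrD(4,5)[OF \<gamma> S T]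
    and f' = Pt_ArrD(6)[OF \<gamma> S T] and pt = Pt_ArrD(8,9)[OF \<gamma> S T]
  show ?thesis
  proof
    assume "is_iso (Pt C B) \<gamma>"
    then obtain \<delta> where \<delta>: "\<delta> \<in> hom (Pt C B) (Tgt \<gamma>) (Src \<gamma>)"
      and 1: "Comp (Pt C B) \<delta> \<gamma> = Idt (Pt C B) (Src \<gamma>)"
        "Comp (Pt C B) \<gamma> \<delta> = Idt (Pt C B) (Tgt \<gamma>)"
      unfolding is_iso_def by (auto simp: Pt_def)
    have "Fn \<delta> \<in> hom C ?A' ?A" using \<delta> S T unfolding Pt_def hom_def by auto
    moreover have "Comp C (Fn \<delta>) ?c = Idt C ?A" "Comp C ?c (Fn \<delta>) = Idt C ?A'"
      using 1 S T unfolding Pt_def by auto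
    ultimately show "is_iso C ?c" using c by (intro is_isoI)
  next
    assume "is_iso C ?c"
    then obtain d where d: "d \<in> hom C ?A' ?A" and 1: "Comp C d ?c = Idt C ?A" "Comp C ?c d = Idt C ?A'"
      using c by (rule is_isoE)
    let ?\<delta> = "\<lparr>Src = (f', s'), Fn = d, Tgt = (f, s)\<rparr>"
    have "Comp C f d = f'"
      using assoc[OF d c f'] eq 1 id_right[OF f'] by simp
    moreover have "Comp C d s' = s"
      using assoc[OF f(2) c d] eq 1 id_left[OF f(2)] by simp
    ultimately have "?\<delta> \<in> hom (Pt C B) (f', s') (f, s)"
      using d pt unfolding Pt_def hom_def by auto
    moreover have "\<gamma> \<in> hom (Pt C B) (f, s) (f', s')"
      using \<gamma> S T unfolding hom_def by (simp add: Pt_def)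
    ultimately show "is_iso (Pt C B) \<gamma>"
      using 1 S T by (intro is_isoI[of \<gamma> "Pt C B" "(f, s)" "(f', s')" ?\<delta>]) (simp_all add: Pt_def)
  qed
qed

lemma comma_is_comma:
  assumes "has_commas C" "f \<in> Arr C" "g \<in> Arr C" "Cod C f = Cod C g"
  shows "is_comma C f g (comma_obj C f g) (comma_fst C f g) (comma_snd C f g)"
proof -
  have "\<exists>x. (\<lambda>(P, p1, p2). is_comma C f g P p1 p2) x"
    using assms unfolding has_commas_def by auto
  then have "(\<lambda>(P, p1, p2). is_comma C f g P p1 p2) (comma C f g)"
    unfolding comma_def by (rule someI_ex)
  then show ?thesis unfolding comma_obj_def comma_fst_def comma_snd_def by (simp add: case_prod_beta)
qed

lemma comma_pair:
  assumes "is_comma C f g (comma_obj C f g) (comma_fst C f g) (comma_snd C f g)"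
    and "h \<in> hom C W (Dom C f)" "k \<in> hom C W (Dom C g)" "Le C (Comp C f h) (Comp C g k)"
  shows "comma_pair C f g h k \<in> hom C W (comma_obj C f g)"
    "Comp C (comma_fst C f g) (comma_pair C f g h k) = h"
    "Comp C (comma_snd C f g) (comma_pair C f g h k) = k"
proof -
  have W: "Dom C h = W" using assms(2) by (simp add: hom_def)
  have "\<exists>!u. u \<in> hom C W (comma_obj C f g) \<and> Comp C (comma_fst C f g) u = h \<and> Comp C (comma_snd C f g) u = k"
    using assms unfolding is_comma_def by blast
  from theI'[OF this]
  show "comma_pair C f g h k \<in> hom C W (comma_obj C f g)"
    "Comp C (comma_fst C f g) (comma_pair C f g h k) = h"
    "Comp C (comma_snd C f g) (comma_pair C f g h k) = k"
    unfolding comma_pair_def W by blast+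
qed

section \<open>Conservativity of both change-of-base functors, and failure of the Mal'tsev
  condition\<close>

context bounded_preord_category
begin

text \<open>A bijective monotone map need not be invertible. Reflecting the order makes the
  set-theoretic inverse monotone, and fullness then turns it into an arrow.\<close>

lemma is_iso_if_order_iso:
  assumes c: "c \<in> hom C A A'" and inj: "inj_on (u c) (Car (U A))" and surj: "u c ` Car (U A) = Car (U A')"
    and refl: "\<And>x y. \<lbrakk>x \<in> Car (U A); y \<in> Car (U A); (u c x, u c y) \<in> Rel (U A')\<rbrakk> \<Longrightarrow> (x, y) \<in> Rel (U A)"
  shows "is_iso C c"
proof -
  have A: "A \<in> Obj C" "A' \<in> Obj C" using hom_Obj[OF c] by auto
  define m where "m = (\<lambda>y\<in>Car (U A'). the_inv_into (Car (U A)) (u c) y)"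
  have m1: "m y \<in> Car (U A)" "u c (m y) = y" if "y \<in> Car (U A')" for y
    using that surj the_inv_into_into[OF inj, of y] f_the_inv_into_f[OF inj, of y] by (auto simp: m_def)
  have m2: "m (u c x) = x" if "x \<in> Car (U A)" for x
    using that surj the_inv_into_f_f[OF inj, of x] by (auto simp: m_def)
  have "m \<in> mono_maps (U A') (U A)"
  proof (rule mono_mapsI)
    fix x y assume xy: "(x, y) \<in> Rel (U A')"
    then have "x \<in> Car (U A')" "y \<in> Car (U A')" using U_Rel[OF A(2) xy] by auto
    then show "(m x, m y) \<in> Rel (U A)" using refl[OF m1(1) m1(1)] m1(2) xy by simp
  qed (use m1(1) in \<open>simp_all add: m_def\<close>)
  moreover have "m (bt A') = bt A" "m (tp A') = tp A"
    using m2[OF U_bt[OF A(1)]] m2[OF U_tp[OF A(1)]] u_bt[OF c] u_tp[OF c] by simp_all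
  ultimately obtain d where d: "d \<in> hom C A' A" and dm: "\<And>y. y \<in> Car (U A') \<Longrightarrow> u d y = m y"
    using u_full[OF A(2,1)] by blast
  have "Comp C d c = Idt C A"
  proof (rule u_inj[OF comp_hom[OF c d] id_hom[OF A(1)]])
    fix x assume x: "x \<in> Car (U A)"
    then show "u (Comp C d c) x = u (Idt C A) x"
      using u_comp[OF c d x] dm[OF u_Car[OF c x]] m2[OF x] u_id[OF A(1) x] by simp
  qed
  moreover have "Comp C c d = Idt C A'"
  proof (rule u_inj[OF comp_hom[OF d c] id_hom[OF A(2)]])
    fix x assume x: "x \<in> Car (U A')"
    then show "u (Comp C c d) x = u (Idt C A') x"
      using u_comp[OF d c x] dm[OF x] m1[OF x] u_id[OF A(2) x] by simp
  qed
  ultimately show ?thesis using c d by (intro is_isoI)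
qed

text \<open>The chosen comma object is known only through its universal property, not as the
  subproduct constructed above. Testing it on arrows out of the free object \<open>G\<close> shows
  that its elements still behave like related pairs with the componentwise order.\<close>

lemma comma_elements:
  assumes cm: "is_comma C f g P p1 p2" and f: "f \<in> hom C A B" and g: "g \<in> hom C A' B"
  shows "\<And>x y. \<lbrakk>x \<in> Car (U A); y \<in> Car (U A'); (u f x, u g y) \<in> Rel (U B)\<rbrakk>
      \<Longrightarrow> \<exists>w\<in>Car (U P). u p1 w = x \<and> u p2 w = y"
    and "\<And>w w'. \<lbrakk>w \<in> Car (U P); w' \<in> Car (U P); (u p1 w, u p1 w') \<in> Rel (U A);
      (u p2 w, u p2 w') \<in> Rel (U A')\<rbrakk> \<Longrightarrow> (w, w') \<in> Rel (U P)"
    and "\<And>w w'. \<lbrakk>w \<in> Car (U P); w' \<in> Car (U P); u p1 w = u p1 w'; u p2 w = u p2 w'\<rbrakk> \<Longrightarrow> w = w'"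
proof -
  have dom: "Dom C f = A" "Dom C g = A'" using f g by (auto simp: hom_def)
  have p1: "p1 \<in> hom C P A" and p2: "p2 \<in> hom C P A'"
    using cm unfolding is_comma_def dom by blast+
  have le12: "Le C (Comp C f p1) (Comp C g p2)"
    and ex1: "\<And>W h k. \<lbrakk>h \<in> hom C W A; k \<in> hom C W A'; Le C (Comp C f h) (Comp C g k)\<rbrakk>
      \<Longrightarrow> \<exists>!v. v \<in> hom C W P \<and> Comp C p1 v = h \<and> Comp C p2 v = k"
    and le: "\<And>W v v'. \<lbrakk>v \<in> hom C W P; v' \<in> hom C W P; Le C (Comp C p1 v) (Comp C p1 v');
      Le C (Comp C p2 v) (Comp C p2 v')\<rbrakk> \<Longrightarrow> Le C v v'"
    using cm unfolding is_comma_def dom by simp_all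
  have ob: "A \<in> Obj C" "A' \<in> Obj C" "P \<in> Obj C" using hom_Obj[OF p1] hom_Obj[OF p2] by auto
  obtain G e where G: "is_generator G e" using generator by blast
  then have e: "e \<in> Car (U G)"
    and gen: "\<And>A a. A \<in> Obj C \<Longrightarrow> a \<in> Car (U A) \<Longrightarrow> \<exists>f\<in>hom C G A. u f e = a"
    unfolding is_generator_def by simp_all
  {
    fix x y assume x: "x \<in> Car (U A)" and y: "y \<in> Car (U A')" and xy: "(u f x, u g y) \<in> Rel (U B)"
    obtain h where h: "h \<in> hom C G A" "u h e = x" using gen[OF ob(1) x] by blast
    obtain k where k: "k \<in> hom C G A'" "u k e = y" using gen[OF ob(2) y] by blast
    have "Le C (Comp C f h) (Comp C g k)"
      using xy h k u_comp[OF h(1) f e] u_comp[OF k(1) g e]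
      by (intro generator_le[OF G, OF comp_hom[OF h(1) f] comp_hom[OF k(1) g]]) simp
    from ex1[OF h(1) k(1) this] obtain v where v: "v \<in> hom C G P" "Comp C p1 v = h" "Comp C p2 v = k"
      by blast
    show "\<exists>w\<in>Car (U P). u p1 w = x \<and> u p2 w = y"
      using u_comp[OF v(1) p1 e] u_comp[OF v(1) p2 e] v h k u_Car[OF v(1) e] by (intro bexI[of _ "u v e"]) simp_all
  }
  {
    fix w w' assume w: "w \<in> Car (U P)" "w' \<in> Car (U P)"
    obtain h where h: "h \<in> hom C G P" "u h e = w" using gen[OF ob(3) w(1)] by blast
    obtain k where k: "k \<in> hom C G P" "u k e = w'" using gen[OF ob(3) w(2)] by blast
    note c = comp_hom[OF h(1) p1] comp_hom[OF k(1) p1] comp_hom[OF h(1) p2] comp_hom[OF k(1) p2]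
    note e' = u_comp[OF h(1) p1 e] u_comp[OF k(1) p1 e] u_comp[OF h(1) p2 e] u_comp[OF k(1) p2 e]
    {
      assume "(u p1 w, u p1 w') \<in> Rel (U A)" "(u p2 w, u p2 w') \<in> Rel (U A')"
      then have "Le C (Comp C p1 h) (Comp C p1 k)" "Le C (Comp C p2 h) (Comp C p2 k)"
        using e' h k generator_le[OF G, OF c(1,2)] generator_le[OF G, OF c(3,4)] by simp_all
      then have "Le C h k" using le[OF h(1) k(1)] by blast
      then show "(w, w') \<in> Rel (U P)" using Le_iff[OF h(1) k(1)] e h k by auto
    }
    {
      assume "u p1 w = u p1 w'" "u p2 w = u p2 w'"
      then have eq: "Comp C p1 h = Comp C p1 k" "Comp C p2 h = Comp C p2 k"
        using e' h k generator_eq[OF G, OF c(1,2)] generator_eq[OF G, OF c(3,4)] by simp_all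
      \<comment> \<open>Uniqueness of the mediating arrow is available only for pairs satisfying the
        comma inequality; here it is inherited from the projections by composing with
        \<open>k\<close>.\<close>
      have "Le C (Comp C f (Comp C p1 k)) (Comp C g (Comp C p2 k))"
        using comp_mono_left[OF k(1) comp_hom[OF p1 f] comp_hom[OF p2 g] le12]
          assoc[OF k(1) p1 f] assoc[OF k(1) p2 g] by simp
      then have "h = k" using ex1[OF c(2,4)] eq h(1) k(1) by metis
      then show "w = w'" using h k by simp
    }
  }
qed

text \<open>Over a bound \<open>x0\<close> of the base, every element of \<open>A\<close> (and of \<open>A'\<close>) occurs in the comma object, so
  that object already determines \<open>A\<close>.\<close>

lemma iso_of_comma_iso:
  assumes c: "c \<in> hom C A A'" and v: "v \<in> hom C P P'" "is_iso C v"
    and q: "q \<in> hom C P A" "q' \<in> hom C P' A'" "Comp C q' v = Comp C c q"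
    and t: "t \<in> hom C P X" "t' \<in> hom C P' X" "Comp C t' v = t"
    and x0: "x0 \<in> Car (U X)"
    and el: "\<And>a. a \<in> Car (U A) \<Longrightarrow> \<exists>w\<in>Car (U P). u t w = x0 \<and> u q w = a"
    and el': "\<And>a. a \<in> Car (U A') \<Longrightarrow> \<exists>w\<in>Car (U P'). u t' w = x0 \<and> u q' w = a"
    and rf: "\<And>w w'. \<lbrakk>w \<in> Car (U P'); w' \<in> Car (U P'); (u t' w, u t' w') \<in> Rel (U X);
      (u q' w, u q' w') \<in> Rel (U A')\<rbrakk> \<Longrightarrow> (w, w') \<in> Rel (U P')"
    and ij: "\<And>w w'. \<lbrakk>w \<in> Car (U P'); w' \<in> Car (U P'); u t' w = u t' w'; u q' w = u q' w'\<rbrakk> \<Longrightarrow> w = w'"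
  shows "is_iso C c"
proof -
  obtain i where i: "i \<in> hom C P' P" and iv: "Comp C i v = Idt C P" and vi: "Comp C v i = Idt C P'"
    using is_isoE[OF v(2,1)] by blast
  have P: "P \<in> Obj C" "P' \<in> Obj C" "X \<in> Obj C" using hom_Obj[OF v(1)] hom_Obj[OF t(1)] by auto
  have ivx: "u i (u v w) = w" if "w \<in> Car (U P)" for w
    using u_comp[OF v(1) i that] iv u_id[OF P(1) that] by simp
  have vix: "u v (u i w) = w" if "w \<in> Car (U P')" for w
    using u_comp[OF i v(1) that] vi u_id[OF P(2) that] by simp
  have qv: "u q' (u v w) = u c (u q w)" and tv: "u t' (u v w) = u t w" if "w \<in> Car (U P)" for w
    using u_comp[OF v(1) q(2) that] u_comp[OF q(1) c that] q(3) u_comp[OF v(1) t(2) that] t(3) by simp_all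
  show ?thesis
  proof (rule is_iso_if_order_iso[OF c])
    show "inj_on (u c) (Car (U A))"
    proof (rule inj_onI)
      fix x y assume x: "x \<in> Car (U A)" and y: "y \<in> Car (U A)" and eq: "u c x = u c y"
      obtain w where w: "w \<in> Car (U P)" "u t w = x0" "u q w = x" using el[OF x] by blast
      obtain w' where w': "w' \<in> Car (U P)" "u t w' = x0" "u q w' = y" using el[OF y] by blast
      \<comment> \<open>Both elements lie over \<open>x0\<close>, and their other coordinates are
        \<open>u c x\<close> and \<open>u c y\<close>, which agree; so joint injectivity on
        \<open>P'\<close> identifies the images, and the inverse \<open>i\<close> of
        \<open>v\<close> gives \<open>w = w'\<close>.\<close>
      have "u v w = u v w'"
        by (rule ij) (use w w' eq qv[OF w(1)] qv[OF w'(1)] tv[OF w(1)] tv[OF w'(1)] u_Car[OF v(1)] in simp_all)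
      then have "u i (u v w) = u i (u v w')" by (rule arg_cong)
      then have "w = w'" unfolding ivx[OF w(1)] ivx[OF w'(1)] .
      then show "x = y" unfolding w(3)[symmetric] w'(3)[symmetric] by (rule arg_cong)
    qed
    show "(x, y) \<in> Rel (U A)" if x: "x \<in> Car (U A)" and y: "y \<in> Car (U A)"
      and le: "(u c x, u c y) \<in> Rel (U A')" for x y
    proof -
      obtain w where w: "w \<in> Car (U P)" "u t w = x0" "u q w = x" using el[OF x] by blast
      obtain w' where w': "w' \<in> Car (U P)" "u t w' = x0" "u q w' = y" using el[OF y] by blast
      have "(u v w, u v w') \<in> Rel (U P')"
        by (rule rf) (use w w' le qv[OF w(1)] qv[OF w'(1)] tv[OF w(1)] tv[OF w'(1)] u_Car[OF v(1)] U_refl[OF P(3) x0] in simp_all)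
      then have "(w, w') \<in> Rel (U P)" using u_Rel[OF i, of "u v w" "u v w'"] unfolding ivx[OF w(1)] ivx[OF w'(1)] by blast
      then show ?thesis using u_Rel[OF q(1), of w w'] unfolding w(3) w'(3) by blast
    qed
    show "u c ` Car (U A) = Car (U A')"
    proof
      show "u c ` Car (U A) \<subseteq> Car (U A')" using u_Car[OF c] by blast
      show "Car (U A') \<subseteq> u c ` Car (U A)"
      proof
        fix a assume "a \<in> Car (U A')"
        then obtain w where w: "w \<in> Car (U P')" "u q' w = a" using el' by blast
        then have "u c (u q (u i w)) = a" using qv[OF u_Car[OF i w(1)]] vix[OF w(1)] by simp
        then show "a \<in> u c ` Car (U A)" using u_Car[OF q(1) u_Car[OF i w(1)]] by blast
      qed
    qed
  qed
qed

lemma V_conservative: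
  assumes "g \<in> Arr C"
  shows "conservative (Pt C (Cod C g)) (Pt C (Dom C g)) (V_fun C g)"
  unfolding conservative_def
proof (intro ballI impI)
  fix \<gamma> assume \<gamma>: "\<gamma> \<in> Arr (Pt C (Cod C g))"
    and iso: "is_iso (Pt C (Dom C g)) (FArr (V_fun C g) \<gamma>)"
  let ?B = "Cod C g" and ?X = "Dom C g"
  obtain f s f' s' where S: "Src \<gamma> = (f, s)" and T: "Tgt \<gamma> = (f', s')" by fastforce
  let ?A = "Dom C f" and ?A' = "Dom C f'" and ?c = "Fn \<gamma>"
  note c = Pt_ArrD(1)[OF \<gamma> S T] and eq = Pt_ArrD(2)[OF \<gamma> S T] and f = Pt_ArrD(4)[OF \<gamma> S T]
    and f' = Pt_ArrD(6)[OF \<gamma> S T]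
  have g: "g \<in> hom C ?X ?B" using assms by (simp add: hom_def)
  have cm: "is_comma C g f (comma_obj C g f) (comma_fst C g f) (comma_snd C g f)"
    and cm': "is_comma C g f' (comma_obj C g f') (comma_fst C g f') (comma_snd C g f')"
    using comma_is_comma[OF has_commas] f f' g by (simp_all add: hom_def)
  let ?P = "comma_obj C g f" and ?P' = "comma_obj C g f'"
  let ?t = "comma_fst C g f" and ?t' = "comma_fst C g f'"
  let ?q = "comma_snd C g f" and ?q' = "comma_snd C g f'"
  have t: "?t \<in> hom C ?P ?X" "?t' \<in> hom C ?P' ?X" and q: "?q \<in> hom C ?P ?A" "?q' \<in> hom C ?P' ?A'"
    and le: "Le C (Comp C g ?t) (Comp C f ?q)"
    using cm cm' unfolding is_comma_def by auto
  let ?v = "comma_pair C g f' ?t (Comp C ?c ?q)"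
  \<comment> \<open>Since \<open>f' c = f\<close>, the inequality of the first comma object is also
    one for the second, so the definite description in \<open>comma_pair\<close> denotes an
    arrow.\<close>
  have "Le C (Comp C g ?t) (Comp C f' (Comp C ?c ?q))"
    using le assoc[OF q(1) c f'] eq by simp
  note v = comma_pair[OF cm' t(1) comp_hom[OF q(1) c] this]
  have "FArr (V_fun C g) \<gamma> \<in> Arr (Pt C ?X)" using iso unfolding is_iso_def by simp
  \<comment> \<open>Invertibility of a morphism of points is visible on its underlying arrow, which
    for the image under \<open>V_fun\<close> is the pairing \<open>?v\<close>.\<close>
  from Pt_iso_iff[OF this] iso have "is_iso C ?v"
    using \<gamma> S T by (simp add: V_fun_def)
  note X = hom_Obj[OF g, THEN conjunct1]
  note le_bt = U_bt_le[OF hom_Obj[OF g, THEN conjunct2]]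
  have "is_iso C ?c"
  proof (rule iso_of_comma_iso[OF c v(1) \<open>is_iso C ?v\<close> q v(3) t v(2) U_bt[OF X]])
    show "\<exists>w\<in>Car (U ?P). u ?t w = bt ?X \<and> u ?q w = a" if a: "a \<in> Car (U ?A)" for a
      using comma_elements(1)[OF cm g f U_bt[OF X] a] u_bt[OF g] le_bt[OF u_Car[OF f a]] by simp
    show "\<exists>w\<in>Car (U ?P'). u ?t' w = bt ?X \<and> u ?q' w = a" if a: "a \<in> Car (U ?A')" for a
      using comma_elements(1)[OF cm' g f' U_bt[OF X] a] u_bt[OF g] le_bt[OF u_Car[OF f' a]] by simp
  qed (rule comma_elements(2,3)[OF cm' g f']; assumption)+
  then show "is_iso (Pt C ?B) \<gamma>" using Pt_iso_iff[OF \<gamma>] by simp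
qed

lemma H_conservative:
  assumes "g \<in> Arr C"
  shows "conservative (Pt C (Cod C g)) (Pt C (Dom C g)) (H_fun C g)"
  unfolding conservative_def
proof (intro ballI impI)
  fix \<gamma> assume \<gamma>: "\<gamma> \<in> Arr (Pt C (Cod C g))"
    and iso: "is_iso (Pt C (Dom C g)) (FArr (H_fun C g) \<gamma>)"
  let ?B = "Cod C g" and ?X = "Dom C g"
  obtain f s f' s' where S: "Src \<gamma> = (f, s)" and T: "Tgt \<gamma> = (f', s')" by fastforce
  let ?A = "Dom C f" and ?A' = "Dom C f'" and ?c = "Fn \<gamma>"
  note c = Pt_ArrD(1)[OF \<gamma> S T] and eq = Pt_ArrD(2)[OF \<gamma> S T] and f = Pt_ArrD(4)[OF \<gamma> S T]
    and f' = Pt_ArrD(6)[OF \<gamma> S T]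
  have g: "g \<in> hom C ?X ?B" using assms by (simp add: hom_def)
  have cm: "is_comma C f g (comma_obj C f g) (comma_fst C f g) (comma_snd C f g)"
    and cm': "is_comma C f' g (comma_obj C f' g) (comma_fst C f' g) (comma_snd C f' g)"
    using comma_is_comma[OF has_commas] f f' g by (simp_all add: hom_def)
  let ?P = "comma_obj C f g" and ?P' = "comma_obj C f' g"
  let ?t = "comma_snd C f g" and ?t' = "comma_snd C f' g"
  let ?q = "comma_fst C f g" and ?q' = "comma_fst C f' g"
  have t: "?t \<in> hom C ?P ?X" "?t' \<in> hom C ?P' ?X" and q: "?q \<in> hom C ?P ?A" "?q' \<in> hom C ?P' ?A'"
    and le: "Le C (Comp C f ?q) (Comp C g ?t)"
    using cm cm' unfolding is_comma_def by auto
  let ?v = "comma_pair C f' g (Comp C ?c ?q) ?t"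
  have "Le C (Comp C f' (Comp C ?c ?q)) (Comp C g ?t)"
    using le assoc[OF q(1) c f'] eq by simp
  note v = comma_pair[OF cm' comp_hom[OF q(1) c] t(1) this]
  have "FArr (H_fun C g) \<gamma> \<in> Arr (Pt C ?X)" using iso unfolding is_iso_def by simp
  from Pt_iso_iff[OF this] iso have "is_iso C ?v"
    using \<gamma> S T by (simp add: H_fun_def)
  note X = hom_Obj[OF g, THEN conjunct1]
  note le_tp = U_le_tp[OF hom_Obj[OF g, THEN conjunct2]]
  have "is_iso C ?c"
  proof (rule iso_of_comma_iso[OF c v(1) \<open>is_iso C ?v\<close> q v(2) t v(3) U_tp[OF X]])
    show "\<exists>w\<in>Car (U ?P). u ?t w = tp ?X \<and> u ?q w = a" if a: "a \<in> Car (U ?A)" for a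
      using comma_elements(1)[OF cm f g a U_tp[OF X]] u_tp[OF g] le_tp[OF u_Car[OF f a]] by auto
    show "\<exists>w\<in>Car (U ?P'). u ?t' w = tp ?X \<and> u ?q' w = a" if a: "a \<in> Car (U ?A')" for a
      using comma_elements(1)[OF cm' f' g a U_tp[OF X]] u_tp[OF g] le_tp[OF u_Car[OF f' a]] by auto
  qed (rule comma_elements(2,3)[OF cm' f' g]; assumption)+
  then show "is_iso (Pt C ?B) \<gamma>" using Pt_iso_iff[OF \<gamma>] by simp
qed

theorem lax_protomodular: "lax_protomodular C"
  unfolding lax_protomodular_def
  using ord_category_axioms finitely_complete has_commas has_two_pullbacks V_conservative by blast

theorem colax_protomodular: "colax_protomodular C"
  unfolding colax_protomodular_def
  using ord_category_axioms finitely_complete has_commas has_two_pullbacks H_conservative by blast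

text \<open>The ideal generated by \<open>x \<mapsto> x\<close>, \<open>w \<mapsto> x\<close> and \<open>w \<mapsto> w\<close> on a bounded antichain
  \<open>{x, w}\<close> does not relate \<open>x\<close> to \<open>w\<close>.\<close>

theorem not_ord_maltsev: "\<not> ord_maltsev C"
proof
  assume mal: "ord_maltsev C"
  obtain z :: 'a where True by blast
  obtain w where w: "w \<noteq> z" using ex_new_if_finite[OF infinite_universe, of "{z}"] by auto
  obtain t where t: "t \<notin> {z, w}" using ex_new_if_finite[OF infinite_universe, of "{z, w}"] by auto
  obtain x where x: "x \<notin> {z, w, t}" using ex_new_if_finite[OF infinite_universe, of "{z, w, t}"] by auto
  let ?M = "{z, w, t, x}"
  \<comment> \<open>The elements \<open>x\<close> and \<open>w\<close> are incomparable and lie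
    between the bounds \<open>z\<close> and \<open>t\<close>.\<close>
  define M where "M = \<lparr>Car = ?M, Rel = {(a, b). a \<in> ?M \<and> b \<in> ?M \<and> (a = z \<or> b = t \<or> a = b)}\<rparr>"
  have "bounded_preord M z t"
    unfolding bounded_preord_def is_preord_iff M_def using t w x by auto
  from realized[OF this] obtain A j where A: "A \<in> Obj C" and j: "preord_iso (U A) M j"
    and jb: "j (bt A) = z" and jt: "j (tp A) = t" by blast
  have surj: "j ` Car (U A) = ?M" using j unfolding preord_iso_def M_def bij_betw_def by simp
  obtain a1 where a1: "a1 \<in> Car (U A)" "j a1 = x" using surj by (metis imageE insertCI)
  obtain a2 where a2: "a2 \<in> Car (U A)" "j a2 = w" using surj by (metis imageE insertCI)
  have jR: "j a = z \<or> j b = t \<or> j a = j b" if ab: "(a, b) \<in> Rel (U A)" for a b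
  proof -
    have "a \<in> Car (U A)" "b \<in> Car (U A)" using U_Rel[OF A ab] by auto
    then have "(j a, j b) \<in> Rel M" using j ab unfolding preord_iso_def by blast
    then show ?thesis by (auto simp: M_def)
  qed
  let ?D = "{(x, x), (w, x), (w, w)}"
  \<comment> \<open>Every subalgebra contains the pairs of bounds. Enlarging the right entry of
    \<open>(z, z)\<close> yields all pairs starting with \<open>z\<close>, and lowering the left
    entry of \<open>(t, t)\<close> yields all pairs ending with \<open>t\<close>. Closing the three
    pairs of \<open>?D\<close> in the same way adds nothing more.\<close>
  define S where "S = {(a, b). a \<in> Car (U A) \<and> b \<in> Car (U A) \<and> (j a = z \<or> j b = t \<or> (j a, j b) \<in> ?D)}"
  have S: "S \<subseteq> Car (U A) \<times> Car (U A)" "(bt A, bt A) \<in> S" "(tp A, tp A) \<in> S"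
    using jb jt U_bt[OF A] U_tp[OF A] by (auto simp: S_def)
  from binary_subproduct[OF A A S] obtain D d1 d2 where
    D: "is_binary_subproduct A A S D d1 d2" by blast
  note d = is_binary_subproductD(1,2)[OF D] and dS = is_binary_subproductD(3)[OF D]
    and ex1 = is_binary_subproductD(4)[OF D] and le = is_binary_subproductD(5)[OF D]
  have mem: "rel_mem C W D d1 d2 h k \<longleftrightarrow> (\<forall>y\<in>Car (U W). (u h y, u k y) \<in> S)"
    if h: "h \<in> hom C W A" and k: "k \<in> hom C W A" for W h k
  proof
    assume "rel_mem C W D d1 d2 h k"
    then obtain v where v: "v \<in> hom C W D" "Comp C d1 v = h" "Comp C d2 v = k"
      unfolding rel_mem_def by blast
    show "\<forall>y\<in>Car (U W). (u h y, u k y) \<in> S"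
    proof
      fix y assume y: "y \<in> Car (U W)"
      show "(u h y, u k y) \<in> S"
        using dS[OF u_Car[OF v(1) y]] u_comp[OF v(1) d(1) y] u_comp[OF v(1) d(2) y] v by simp
    qed
  next
    assume "\<forall>y\<in>Car (U W). (u h y, u k y) \<in> S"
    then show "rel_mem C W D d1 d2 h k" unfolding rel_mem_def using ex1[OF h k] by blast
  qed
  have dom: "a = a'" if "a \<in> hom C W D" "a' \<in> hom C W D"
    "Comp C d1 a = Comp C d1 a'" "Comp C d2 a = Comp C d2 a'" for W a a'
  proof -
    have "\<And>y. y \<in> Car (U W) \<Longrightarrow> (u (Comp C d1 a) y, u (Comp C d2 a) y) \<in> S"
      using dS u_Car[OF that(1)] u_comp[OF that(1) d(1)] u_comp[OF that(1) d(2)] by simp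
    from ex1[OF comp_hom[OF that(1) d(1)] comp_hom[OF that(1) d(2)] this] show ?thesis
      using that by metis
  qed
  have ideal: "is_ideal C A A D d1 d2"
    unfolding is_ideal_def is_relation_def
  proof (intro conjI allI ballI impI)
    show "d1 \<in> hom C D A" "d2 \<in> hom C D A" by (rule d(1), rule d(2))
    show "a = a'" if "a \<in> hom C W D" "a' \<in> hom C W D"
      "Comp C d1 a = Comp C d1 a' \<and> Comp C d2 a = Comp C d2 a'" for W a a'
      by (rule dom) (use that in auto)
    show "Le C a a'" if "a \<in> hom C W D" "a' \<in> hom C W D"
      "Le C (Comp C d1 a) (Comp C d1 a') \<and> Le C (Comp C d2 a) (Comp C d2 a')" for W a a'
      using le[OF that(1,2)] that(3) by blast
  next
    fix W h h' k k'
    assume h: "h \<in> hom C W A" "h' \<in> hom C W A" and k: "k \<in> hom C W A" "k' \<in> hom C W A"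
      and *: "Le C h' h \<and> rel_mem C W D d1 d2 h k \<and> Le C k k'"
    have "(u h' y, u k' y) \<in> S" if y: "y \<in> Car (U W)" for y
    proof -
      have "(u h y, u k y) \<in> S" using * y unfolding mem[OF h(1) k(1)] by blast
      moreover have "j (u h' y) = z \<or> j (u h y) = t \<or> j (u h' y) = j (u h y)"
        using * y Le_iff[OF h(2,1)] by (intro jR) blast
      moreover have "j (u k y) = z \<or> j (u k' y) = t \<or> j (u k y) = j (u k' y)"
        using * y Le_iff[OF k] by (intro jR) blast
      \<comment> \<open>The delicate case is \<open>j (u h y) = t\<close>: a pair in
        \<open>S\<close> with first value \<open>t\<close> also has second value \<open>t\<close>,
        and then the larger element \<open>u k' y\<close> has value \<open>t\<close> as
        well.\<close>
      ultimately show ?thesis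
        using t w x u_Car[OF h(2) y] u_Car[OF k(2) y] unfolding S_def by auto
    qed
    then show "rel_mem C W D d1 d2 h' k'" unfolding mem[OF h(2) k(2)] by blast
  qed
  obtain G e where G: "is_generator G e" using generator by blast
  then have e: "e \<in> Car (U G)"
    and gen: "\<And>A a. A \<in> Obj C \<Longrightarrow> a \<in> Car (U A) \<Longrightarrow> \<exists>f\<in>hom C G A. u f e = a"
    unfolding is_generator_def by simp_all
  obtain h where h: "h \<in> hom C G A" "u h e = a1" using gen[OF A a1(1)] by blast
  obtain k where k: "k \<in> hom C G A" "u k e = a2" using gen[OF A a2(1)] by blast
  \<comment> \<open>At the two bounds of \<open>G\<close> every pair of arrows yields a pair of
    bounds of \<open>A\<close>, which is in \<open>S\<close>; only the generator remains to be
    checked.\<close>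
  have mem': "rel_mem C G D d1 d2 a b \<longleftrightarrow> (u a e, u b e) \<in> S" if a: "a \<in> hom C G A" and b: "b \<in> hom C G A" for a b
  proof -
    have "(u a y, u b y) \<in> S" if "(u a e, u b e) \<in> S" "y \<in> Car (U G)" for y
    proof -
      have "y = bt G \<or> y = e \<or> y = tp G" using G that unfolding is_generator_def by blast
      then show ?thesis using that S u_bt[OF a] u_bt[OF b] u_tp[OF a] u_tp[OF b] by auto
    qed
    then show ?thesis unfolding mem[OF a b] using e by blast
  qed
  have refl: "Le C h h" "Le C k k"
    using generator_le[OF G h(1) h(1)] generator_le[OF G k(1) k(1)] h k U_refl[OF A] a1 a2 by simp_all
  have "rel_mem C G D d1 d2 h h" "rel_mem C G D d1 d2 k h" "rel_mem C G D d1 d2 k k"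
    unfolding mem'[OF h(1) h(1)] mem'[OF k(1) h(1)] mem'[OF k(1) k(1)]
    using a1 a2 h k by (auto simp: S_def)
  \<comment> \<open>The Mal'tsev condition with \<open>x = y = y' = h\<close> and
    \<open>u = u' = v = k\<close>; both inequalities are instances of reflexivity. Here
    \<open>h\<close> picks the element coded \<open>x\<close> and \<open>k\<close> the one coded
    \<open>w\<close>, so the conclusion is the missing pair.\<close>
  then have "rel_mem C G D d1 d2 h k"
    using mal ideal h(1) k(1) refl unfolding ord_maltsev_def by blast
  then have "(a1, a2) \<in> S" unfolding mem'[OF h(1) k(1)] using h k by simp
  then show False using a1 a2 w t x by (auto simp: S_def)
qed

end


section \<open>Powers\<close>

lemma mono_preord_simps [simp]:
  "Car (mono_preord X Y) = mono_maps X Y"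
  "(h, k) \<in> Rel (mono_preord X Y) \<longleftrightarrow>
     h \<in> mono_maps X Y \<and> k \<in> mono_maps X Y \<and> (\<forall>x\<in>Car X. (h x, k x) \<in> Rel Y)"
  by (simp_all add: mono_preord_def)

lemma hom_preord_simps [simp]:
  "Car (hom_preord C a b) = hom C a b"
  "(f, g) \<in> Rel (hom_preord C a b) \<longleftrightarrow> f \<in> hom C a b \<and> g \<in> hom C a b \<and> Le C f g"
  by (simp_all add: hom_preord_def)

lemma preord_RelD: "is_preord X \<Longrightarrow> (x, y) \<in> Rel X \<Longrightarrow> x \<in> Car X \<and> y \<in> Car X"
  and preord_refl: "is_preord X \<Longrightarrow> x \<in> Car X \<Longrightarrow> (x, x) \<in> Rel X"
  and preord_trans: "is_preord X \<Longrightarrow> (x, y) \<in> Rel X \<Longrightarrow> (y, w) \<in> Rel X \<Longrightarrow> (x, w) \<in> Rel X"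
  unfolding is_preord_iff by blast+

lemma preord_iso_cong:
  assumes "preord_iso X Y \<phi>" "\<And>x. x \<in> Car X \<Longrightarrow> \<phi> x = \<phi>' x"
  shows "preord_iso X Y \<phi>'"
  using assms bij_betw_cong[of "Car X" \<phi> \<phi>'] unfolding preord_iso_def by simp

text \<open>Two out of three. Comparison maps of powers are recognized as isomorphisms by composing
  them with a known isomorphism, which avoids constructing their inverses.\<close>

lemma preord_iso_cancel:
  assumes \<psi>: "preord_iso Y Z \<psi>" and \<chi>: "preord_iso X Z \<chi>"
    and map: "\<And>x. x \<in> Car X \<Longrightarrow> \<phi> x \<in> Car Y" and eq: "\<And>x. x \<in> Car X \<Longrightarrow> \<psi> (\<phi> x) = \<chi> x"
  shows "preord_iso X Y \<phi>"
proof -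
  have "preord_iso X Y (the_inv_into (Car Y) \<psi> \<circ> \<chi>)"
    by (rule preord_iso_trans[OF \<chi> preord_iso_inverse[OF \<psi>]])
  then show ?thesis
  proof (rule preord_iso_cong)
    show "(the_inv_into (Car Y) \<psi> \<circ> \<chi>) x = \<phi> x" if "x \<in> Car X" for x
      using the_inv_into_f_f[OF preord_isoD(1)[OF \<psi>] map[OF that]] eq[OF that] by simp
  qed
qed

lemma mono_preord_iso:
  assumes X: "is_preord X" and \<psi>: "preord_iso Y Z \<psi>"
  shows "preord_iso (mono_preord X Y) (mono_preord X Z) (\<lambda>k. \<lambda>x\<in>Car X. \<psi> (k x))"
proof (rule preord_isoI)
  have inj: "inj_on \<psi> (Car Y)" by (rule preord_isoD(1)[OF \<psi>])
  have map: "(\<lambda>x\<in>Car X. \<psi> (k x)) \<in> mono_maps X Z" if k: "k \<in> mono_maps X Y" for k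
  proof (rule mono_mapsI)
    fix x y assume xy: "(x, y) \<in> Rel X"
    then have "x \<in> Car X" "y \<in> Car X" using preord_RelD[OF X] by auto
    then show "((\<lambda>x\<in>Car X. \<psi> (k x)) x, (\<lambda>x\<in>Car X. \<psi> (k x)) y) \<in> Rel Z"
      using preord_isoD(4)[OF \<psi>] mono_mapsD(1)[OF k] mono_mapsD(3)[OF k xy] by simp
  qed (use preord_isoD(3)[OF \<psi> mono_mapsD(1)[OF k]] in simp_all)
  show "inj_on (\<lambda>k. \<lambda>x\<in>Car X. \<psi> (k x)) (Car (mono_preord X Y))"
  proof (rule inj_onI)
    fix k l assume k: "k \<in> Car (mono_preord X Y)" and l: "l \<in> Car (mono_preord X Y)"
      and eq: "(\<lambda>x\<in>Car X. \<psi> (k x)) = (\<lambda>x\<in>Car X. \<psi> (l x))"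
    have kl: "k \<in> mono_maps X Y" "l \<in> mono_maps X Y" using k l by simp_all
    show "k = l"
    proof (rule mono_maps_eqI[OF kl])
      fix x assume x: "x \<in> Car X"
      have "\<psi> (k x) = \<psi> (l x)" using fun_cong[OF eq, of x] x by simp
      then show "k x = l x" using inj_onD[OF inj] mono_mapsD(1)[OF kl(1) x] mono_mapsD(1)[OF kl(2) x] by blast
    qed
  qed
  show "(\<lambda>k. \<lambda>x\<in>Car X. \<psi> (k x)) ` Car (mono_preord X Y) = Car (mono_preord X Z)"
  proof (intro equalityI subsetI)
    fix l assume "l \<in> Car (mono_preord X Z)"
    then have l: "l \<in> mono_maps X Z" by simp
    let ?g = "the_inv_into (Car Y) \<psi>"
    note g = preord_iso_inverse[OF \<psi>]
    have lx: "l x \<in> Car Z" "?g (l x) \<in> Car Y" "\<psi> (?g (l x)) = l x" if "x \<in> Car X" for x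
      using mono_mapsD(1)[OF l that] preord_isoD(3)[OF g]
        f_the_inv_into_f[OF inj] preord_isoD(2)[OF \<psi>] by auto
    let ?k = "\<lambda>x\<in>Car X. ?g (l x)"
    have kk: "?k \<in> mono_maps X Y"
    proof (rule mono_mapsI)
      fix x y assume xy: "(x, y) \<in> Rel X"
      then have "x \<in> Car X" "y \<in> Car X" using preord_RelD[OF X] by auto
      then show "(?k x, ?k y) \<in> Rel Y"
        using preord_isoD(4)[OF g] lx(1) mono_mapsD(3)[OF l xy] by simp
    qed (use lx in simp_all)
    have lk: "l = (\<lambda>x\<in>Car X. \<psi> (?k x))"
      by (rule extensionalityI[OF mono_mapsD(2)[OF l]]) (use lx in auto)
    show "l \<in> (\<lambda>k. \<lambda>x\<in>Car X. \<psi> (k x)) ` Car (mono_preord X Y)"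
      unfolding mono_preord_simps(1) by (rule image_eqI[OF _ kk]) (rule lk)
  qed (use map in auto)
  show "(k, l) \<in> Rel (mono_preord X Y) \<longleftrightarrow>
      ((\<lambda>x\<in>Car X. \<psi> (k x)), (\<lambda>x\<in>Car X. \<psi> (l x))) \<in> Rel (mono_preord X Z)"
    if "k \<in> Car (mono_preord X Y)" "l \<in> Car (mono_preord X Y)" for k l
  proof -
    have kl: "k \<in> mono_maps X Y" "l \<in> mono_maps X Y" using that by simp_all
    then show ?thesis
      using map preord_isoD(4)[OF \<psi> mono_mapsD(1)[OF kl(1)] mono_mapsD(1)[OF kl(2)]] by simp
  qed
qed

section \<open>Preordered sets and monotone maps as an Ord-category\<close>

definition pmap :: "'a preord \<Rightarrow> ('a \<Rightarrow> 'a) \<Rightarrow> 'a preord \<Rightarrow> 'a pmap" where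
  "pmap X h Y = \<lparr>Src = X, Fn = restrict h (Car X), Tgt = Y\<rparr>"

lemma pmap_simps [simp]:
  "Src (pmap X h Y) = X" "Tgt (pmap X h Y) = Y" "Fn (pmap X h Y) = restrict h (Car X)"
  by (simp_all add: pmap_def)

lemma hom_ORD_iff:
  "f \<in> hom ORD X Y \<longleftrightarrow> Src f = X \<and> Tgt f = Y \<and> is_preord X \<and> is_preord Y \<and> Fn f \<in> mono_maps X Y"
  unfolding hom_def ORD_def by auto

lemma ORD_simps [simp]:
  "X \<in> Obj ORD \<longleftrightarrow> is_preord X"
  "Dom ORD = Src" "Cod ORD = Tgt"
  "Src (Comp ORD g f) = Src f" "Tgt (Comp ORD g f) = Tgt g"
  "x \<in> Car (Src f) \<Longrightarrow> Fn (Comp ORD g f) x = Fn g (Fn f x)"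
  "Src (Idt ORD X) = X" "Tgt (Idt ORD X) = X"
  "x \<in> Car X \<Longrightarrow> Fn (Idt ORD X) x = x"
  by (simp_all add: ORD_def compose_def)

lemma Le_ORD: "Le ORD f g \<longleftrightarrow> (\<forall>x\<in>Car (Src f). (Fn f x, Fn g x) \<in> Rel (Tgt f))"
  by (simp add: ORD_def)

lemma Arr_ORD_iff: "f \<in> Arr ORD \<longleftrightarrow> f \<in> hom ORD (Src f) (Tgt f)"
  unfolding hom_ORD_iff by (simp add: ORD_def)

lemma hom_ORD_eqI:
  assumes f: "f \<in> hom ORD X Y" and g: "g \<in> hom ORD X Y" and eq: "\<And>x. x \<in> Car X \<Longrightarrow> Fn f x = Fn g x"
  shows "f = g"
proof -
  have "Fn f = Fn g" by (rule mono_maps_eqI[of _ X Y _ Y]) (use f g eq in \<open>auto simp: hom_ORD_iff\<close>)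
  then show ?thesis using f g by (auto simp: hom_ORD_iff intro!: arrow.equality)
qed

lemma hom_ORDD:
  assumes "f \<in> hom ORD X Y"
  shows "Src f = X" "Tgt f = Y" "is_preord X" "is_preord Y"
    "x \<in> Car X \<Longrightarrow> Fn f x \<in> Car Y" "(x, y) \<in> Rel X \<Longrightarrow> (Fn f x, Fn f y) \<in> Rel Y"
  using assms mono_mapsD[of "Fn f" X Y] unfolding hom_ORD_iff by blast+

lemma hom_ORD_extensional: "f \<in> hom ORD X Y \<Longrightarrow> Fn f \<in> extensional (Car X)"
  unfolding hom_ORD_iff using mono_mapsD(2) by blast

lemma pmap_hom:
  assumes "is_preord X" "is_preord Y" "\<And>x. x \<in> Car X \<Longrightarrow> h x \<in> Car Y"
    "\<And>x y. (x, y) \<in> Rel X \<Longrightarrow> (h x, h y) \<in> Rel Y"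
  shows "pmap X h Y \<in> hom ORD X Y"
  unfolding hom_ORD_iff using assms preord_RelD[OF assms(1)] by (auto intro!: mono_mapsI)

lemma Comp_ORD_hom:
  assumes f: "f \<in> hom ORD X Y" and g: "g \<in> hom ORD Y Z"
  shows "Comp ORD g f \<in> hom ORD X Z"
proof -
  have "Fn (Comp ORD g f) \<in> mono_maps X Z"
  proof (rule mono_mapsI)
    show "Fn (Comp ORD g f) \<in> extensional (Car X)"
      using hom_ORDD(1)[OF f] by (simp add: ORD_def)
    fix x y assume "(x, y) \<in> Rel X"
    then show "(Fn (Comp ORD g f) x, Fn (Comp ORD g f) y) \<in> Rel Z"
      using hom_ORDD[OF f] hom_ORDD[OF g] preord_RelD[of X x y] by simp
  qed (use hom_ORDD[OF f] hom_ORDD[OF g] in simp)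
  then show ?thesis using hom_ORDD[OF f] hom_ORDD[OF g] unfolding hom_ORD_iff by simp
qed

lemma Idt_ORD_hom: "is_preord X \<Longrightarrow> Idt ORD X \<in> hom ORD X X"
  unfolding hom_ORD_iff by (auto simp: ORD_def intro!: mono_mapsI dest: preord_RelD)

lemma ord_category_ORD: "ord_category (ORD :: ('a preord, 'a pmap) ordcat)"
proof
  fix f g h :: "'a pmap" and X Y Z W :: "'a preord"
  show "Dom ORD f \<in> Obj ORD" "Cod ORD f \<in> Obj ORD" if "f \<in> Arr ORD"
    using that by (auto simp: ORD_def)
  show "Idt ORD X \<in> hom ORD X X" if "X \<in> Obj ORD" using that Idt_ORD_hom by simp
  show "Comp ORD g f \<in> hom ORD X Z" if "f \<in> hom ORD X Y" "g \<in> hom ORD Y Z"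
    by (rule Comp_ORD_hom[OF that])
  show "Comp ORD (Idt ORD Y) f = f" if f: "f \<in> hom ORD X Y"
    by (rule hom_ORD_eqI[OF Comp_ORD_hom[OF f Idt_ORD_hom] f]) (use hom_ORDD[OF f] in simp_all)
  show "Comp ORD f (Idt ORD X) = f" if f: "f \<in> hom ORD X Y"
    by (rule hom_ORD_eqI[OF Comp_ORD_hom[OF Idt_ORD_hom f] f]) (use hom_ORDD[OF f] in simp_all)
  show "Comp ORD h (Comp ORD g f) = Comp ORD (Comp ORD h g) f"
    if f: "f \<in> hom ORD X Y" and g: "g \<in> hom ORD Y Z" and h: "h \<in> hom ORD Z W"
    by (rule hom_ORD_eqI[OF Comp_ORD_hom[OF Comp_ORD_hom[OF f g] h] Comp_ORD_hom[OF f Comp_ORD_hom[OF g h]]])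
      (use hom_ORDD[OF f] hom_ORDD[OF g] in simp)
  show "is_preord (hom_preord ORD X Y)"
    unfolding is_preord_iff
  proof (intro conjI allI impI)
    show "Rel (hom_preord ORD X Y) \<subseteq> Car (hom_preord ORD X Y) \<times> Car (hom_preord ORD X Y)" by auto
    show "\<forall>x\<in>Car (hom_preord ORD X Y). (x, x) \<in> Rel (hom_preord ORD X Y)"
      using hom_ORDD(1,2,4,5) preord_refl by (fastforce simp: Le_ORD)
    fix f g h assume fg: "(f, g) \<in> Rel (hom_preord ORD X Y)" and gh: "(g, h) \<in> Rel (hom_preord ORD X Y)"
    then have f: "f \<in> hom ORD X Y" and g: "g \<in> hom ORD X Y" by simp_all
    have "(Fn f x, Fn h x) \<in> Rel Y" if "x \<in> Car X" for x
    proof (rule preord_trans[OF hom_ORDD(4)[OF f]])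
      show "(Fn f x, Fn g x) \<in> Rel Y" "(Fn g x, Fn h x) \<in> Rel Y"
        using fg gh that hom_ORDD(1,2)[OF f] hom_ORDD(1,2)[OF g] by (simp_all add: Le_ORD)
    qed
    then show "(f, h) \<in> Rel (hom_preord ORD X Y)"
      using fg gh hom_ORDD(1,2)[OF f] by (simp add: Le_ORD)
  qed
  show "Le ORD (Comp ORD g f) (Comp ORD g' f)"
    if f: "f \<in> hom ORD X Y" and g: "g \<in> hom ORD Y Z" and g': "g' \<in> hom ORD Y Z" and "Le ORD g g'" for g'
    using that(4) hom_ORDD(1,2,5)[OF f] hom_ORDD(1,2)[OF g] by (simp add: Le_ORD)
  show "Le ORD (Comp ORD g f) (Comp ORD g f')"
    if f: "f \<in> hom ORD X Y" and f': "f' \<in> hom ORD X Y" and g: "g \<in> hom ORD Y Z" and "Le ORD f f'" for f'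
    using that(4) hom_ORDD(1,2)[OF f] hom_ORDD(1)[OF f'] hom_ORDD(2,6)[OF g] by (simp add: Le_ORD)
qed

section \<open>Powers of preordered sets, currying, and criteria for powers\<close>

definition evaluation :: "'x preord \<Rightarrow> ('x \<Rightarrow> 'a pmap) \<Rightarrow> 'a \<Rightarrow> 'x \<Rightarrow> 'a" where
  "evaluation X \<kappa> p = (\<lambda>x\<in>Car X. Fn (\<kappa> x) p)"

text \<open>Monotone maps out of a one-point preorder are elements, so the universal property tested
  on that single object already describes \<open>P\<close> elementwise.\<close>

lemma power_ORD_elements:
  fixes c P :: "'a preord"
  assumes X: "is_preord X" and pw: "is_power ORD X c P \<kappa>"
  shows "preord_iso P (mono_preord X c) (evaluation X \<kappa>)"
proof -
  \<comment> \<open>The one-point preorder; \<open>undefined\<close> merely names some element of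
    \<open>'a\<close>.\<close>
  define D where "D = \<lparr>Car = {undefined :: 'a}, Rel = {(undefined, undefined)}\<rparr>"
  have D: "is_preord D" "Car D = {undefined}" by (auto simp: D_def is_preord_iff)
  have cP: "is_preord c" "is_preord P" and \<kappa>: "\<kappa> \<in> mono_maps X (hom_preord ORD P c)"
    and iso: "preord_iso (hom_preord ORD D P) (mono_preord X (hom_preord ORD D c))
        (\<lambda>h. \<lambda>x\<in>Car X. Comp ORD (\<kappa> x) h)"
    using pw D(1) unfolding is_power_def by auto
  have \<kappa>h: "\<kappa> x \<in> hom ORD P c" if "x \<in> Car X" for x using mono_mapsD(1)[OF \<kappa> that] by simp
  have ptD: "pmap D (\<lambda>_. p) Y \<in> hom ORD D Y" if "is_preord Y" "p \<in> Car Y" for p Y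
    by (rule pmap_hom) (use that D preord_refl in auto)
  have pt: "pmap D (\<lambda>_. p) P \<in> hom ORD D P" if "p \<in> Car P" for p by (rule ptD[OF cP(2) that])
  have cpt: "Comp ORD (\<kappa> x) (pmap D (\<lambda>_. p) P) = pmap D (\<lambda>_. evaluation X \<kappa> p x) c"
    if "p \<in> Car P" "x \<in> Car X" for p x
  proof (rule hom_ORD_eqI)
    show "Comp ORD (\<kappa> x) (pmap D (\<lambda>_. p) P) \<in> hom ORD D c" by (rule Comp_ORD_hom[OF pt \<kappa>h]) fact+
    show "pmap D (\<lambda>_. evaluation X \<kappa> p x) c \<in> hom ORD D c"
      by (rule ptD[OF cP(1)]) (use that hom_ORDD(5)[OF \<kappa>h] in \<open>simp add: evaluation_def\<close>)
  qed (use that in \<open>simp add: evaluation_def\<close>)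
  have ev: "evaluation X \<kappa> p \<in> mono_maps X c" if p: "p \<in> Car P" for p
    unfolding evaluation_def
  proof (rule mono_mapsI)
    fix x y assume xy: "(x, y) \<in> Rel X"
    show "((\<lambda>x\<in>Car X. Fn (\<kappa> x) p) x, (\<lambda>x\<in>Car X. Fn (\<kappa> x) p) y) \<in> Rel c"
      using mono_mapsD(3)[OF \<kappa> xy] p preord_RelD[OF X xy] hom_ORDD(1,2)[OF \<kappa>h] by (auto simp: Le_ORD)
  qed (use hom_ORDD(5)[OF \<kappa>h] p in simp_all)
  have pt_iso: "preord_iso Y (hom_preord ORD D Y) (\<lambda>p. pmap D (\<lambda>_. p) Y)" if Y: "is_preord Y" for Y
  proof (rule preord_isoI)
    show "inj_on (\<lambda>p. pmap D (\<lambda>_. p) Y) (Car Y)"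
      by (rule inj_on_inverseI[of _ "\<lambda>f. Fn f undefined"]) (use D(2) in simp)
    show "(\<lambda>p. pmap D (\<lambda>_. p) Y) ` Car Y = Car (hom_preord ORD D Y)"
    proof (intro equalityI subsetI)
      fix f assume "f \<in> Car (hom_preord ORD D Y)"
      then have f: "f \<in> hom ORD D Y" and d: "Fn f undefined \<in> Car Y" using hom_ORDD(5) D(2) by fastforce+
      have "f = pmap D (\<lambda>_. Fn f undefined) Y"
        by (rule hom_ORD_eqI[OF f ptD[OF Y d]]) (use D(2) in simp)
      then show "f \<in> (\<lambda>p. pmap D (\<lambda>_. p) Y) ` Car Y" using d by blast
    qed (use ptD[OF Y] in auto)
  qed (use ptD[OF Y] D(2) in \<open>simp add: Le_ORD\<close>)
  show ?thesis
  proof (rule preord_iso_cancel[OF mono_preord_iso[OF X pt_iso[OF cP(1)]] preord_iso_trans[OF pt_iso[OF cP(2)] iso]])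
    fix p assume p: "p \<in> Car P"
    show "evaluation X \<kappa> p \<in> Car (mono_preord X c)" using ev[OF p] by simp
    show "(\<lambda>x\<in>Car X. pmap D (\<lambda>_. evaluation X \<kappa> p x) c) =
        ((\<lambda>h. \<lambda>x\<in>Car X. Comp ORD (\<kappa> x) h) \<circ> (\<lambda>p. pmap D (\<lambda>_. p) P)) p"
      unfolding o_apply by (rule restrict_ext) (simp add: cpt[OF p])
  qed
qed

definition prod_preord :: "'a preord \<Rightarrow> 'b preord \<Rightarrow> ('a \<times> 'b) preord" where
  "prod_preord X Y = \<lparr>Car = Car X \<times> Car Y,
     Rel = {((x, y), (x', y')). (x, x') \<in> Rel X \<and> (y, y') \<in> Rel Y}\<rparr>"

lemma is_preord_prod: "is_preord X \<Longrightarrow> is_preord Y \<Longrightarrow> is_preord (prod_preord X Y)"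
  unfolding is_preord_iff by (auto simp: prod_preord_def)

text \<open>Cartesian closure of preorders. The product is replaced by an isomorphic copy
  \<open>P\<close>, because \<open>prod_preord X Y\<close> lives on pairs while arities have to be
  carried by the universe.\<close>

lemma curry_iso:
  assumes X: "is_preord X" and Y: "is_preord Y" and P: "is_preord P" and N: "is_preord N"
    and p: "preord_iso (prod_preord X Y) P p"
  shows "preord_iso (mono_preord P N) (mono_preord X (mono_preord Y N))
    (\<lambda>m. \<lambda>x\<in>Car X. \<lambda>y\<in>Car Y. m (p (x, y)))" (is "preord_iso _ _ ?\<phi>")
proof (rule preord_isoI)
  have pC: "p (x, y) \<in> Car P" if "x \<in> Car X" "y \<in> Car Y" for x y
    using preord_isoD(3)[OF p] that by (simp add: prod_preord_def)
  have pR: "(p (x, y), p (x', y')) \<in> Rel P" if "(x, x') \<in> Rel X" "(y, y') \<in> Rel Y" for x x' y y'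
    using preord_isoD(4)[OF p, of "(x, y)" "(x', y')"] that preord_RelD[OF X that(1)] preord_RelD[OF Y that(2)]
    by (simp add: prod_preord_def)
  have surj: "\<exists>x\<in>Car X. \<exists>y\<in>Car Y. w = p (x, y)" if "w \<in> Car P" for w
  proof -
    have "w \<in> p ` Car (prod_preord X Y)" using preord_isoD(2)[OF p] that by simp
    then show ?thesis by (auto simp: prod_preord_def)
  qed
  have \<phi>1: "?\<phi> m x \<in> mono_maps Y N" if m: "m \<in> mono_maps P N" and x: "x \<in> Car X" for m x
  proof (rule mono_mapsI)
    fix y y' assume yy: "(y, y') \<in> Rel Y"
    then show "(?\<phi> m x y, ?\<phi> m x y') \<in> Rel N"
      using x mono_mapsD(3)[OF m pR[OF preord_refl[OF X x] yy]] preord_RelD[OF Y yy] by simp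
  qed (use mono_mapsD(1)[OF m pC] x in simp_all)
  have \<phi>: "?\<phi> m \<in> mono_maps X (mono_preord Y N)" if m: "m \<in> mono_maps P N" for m
  proof (rule mono_mapsI)
    fix x x' assume xx: "(x, x') \<in> Rel X"
    then have c: "x \<in> Car X" "x' \<in> Car X" using preord_RelD[OF X] by auto
    show "(?\<phi> m x, ?\<phi> m x') \<in> Rel (mono_preord Y N)"
      using \<phi>1[OF m c(1)] \<phi>1[OF m c(2)] c mono_mapsD(3)[OF m pR[OF xx preord_refl[OF Y]]] by simp
  qed (use \<phi>1[OF m] in simp_all)
  show "inj_on ?\<phi> (Car (mono_preord P N))"
  proof (rule inj_onI)
    fix m n assume "m \<in> Car (mono_preord P N)" "n \<in> Car (mono_preord P N)" and eq: "?\<phi> m = ?\<phi> n"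
    then have m: "m \<in> mono_maps P N" and n: "n \<in> mono_maps P N" by simp_all
    show "m = n"
    proof (rule mono_maps_eqI[OF m n])
      fix w assume "w \<in> Car P"
      then obtain x y where xy: "x \<in> Car X" "y \<in> Car Y" "w = p (x, y)" using surj by blast
      show "m w = n w" using fun_cong[OF fun_cong[OF eq, of x], of y] xy by simp
    qed
  qed
  show "?\<phi> ` Car (mono_preord P N) = Car (mono_preord X (mono_preord Y N))"
  proof (intro equalityI subsetI)
    fix k assume "k \<in> Car (mono_preord X (mono_preord Y N))"
    then have k: "k \<in> mono_maps X (mono_preord Y N)" by simp
    have kx: "k x \<in> mono_maps Y N" if "x \<in> Car X" for x using mono_mapsD(1)[OF k that] by simp
    define q where "q = the_inv_into (Car (prod_preord X Y)) p"
    have q: "q (p (x, y)) = (x, y)" if "x \<in> Car X" "y \<in> Car Y" for x y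
      unfolding q_def by (rule the_inv_into_f_f[OF preord_isoD(1)[OF p]]) (use that in \<open>simp add: prod_preord_def\<close>)
    define m where "m = (\<lambda>w\<in>Car P. k (fst (q w)) (snd (q w)))"
    have mp: "m (p (x, y)) = k x y" if "x \<in> Car X" "y \<in> Car Y" for x y
      using q[OF that] pC[OF that] by (simp add: m_def)
    have m: "m \<in> mono_maps P N"
    proof (rule mono_mapsI)
      show "m w \<in> Car N" if "w \<in> Car P" for w
        using surj[OF that] mp mono_mapsD(1)[OF kx] by force
      show "m \<in> extensional (Car P)" by (simp add: m_def)
      fix w w' assume ww: "(w, w') \<in> Rel P"
      obtain x y where xy: "x \<in> Car X" "y \<in> Car Y" "w = p (x, y)" using surj preord_RelD[OF P ww] by blast
      obtain x' y' where xy': "x' \<in> Car X" "y' \<in> Car Y" "w' = p (x', y')" using surj preord_RelD[OF P ww] by blast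
      have r: "(x, x') \<in> Rel X" "(y, y') \<in> Rel Y"
        using preord_isoD(4)[OF p, of "(x, y)" "(x', y')"] ww xy xy' by (auto simp: prod_preord_def)
      \<comment> \<open>Joint monotonicity is obtained by moving one variable at a time: first
        \<open>y\<close> at fixed \<open>x\<close>, then \<open>x\<close> at fixed
        \<open>y'\<close>.\<close>
      have "(k x y, k x y') \<in> Rel N" using mono_mapsD(3)[OF kx[OF xy(1)] r(2)] .
      moreover have "(k x y', k x' y') \<in> Rel N" using mono_mapsD(3)[OF k r(1)] xy'(2) by simp
      ultimately have "(k x y, k x' y') \<in> Rel N" by (rule preord_trans[OF N])
      then show "(m w, m w') \<in> Rel N" using mp xy xy' by simp
    qed
    have "k = ?\<phi> m"
    proof (rule extensionalityI[OF mono_mapsD(2)[OF k]])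
      fix x assume x: "x \<in> Car X"
      show "k x = ?\<phi> m x"
        by (rule mono_maps_eqI[OF kx[OF x] \<phi>1[OF m x]]) (use x mp in simp)
    qed simp
    then show "k \<in> ?\<phi> ` Car (mono_preord P N)" using m by simp
  qed (use \<phi> in auto)
  fix m n assume "m \<in> Car (mono_preord P N)" "n \<in> Car (mono_preord P N)"
  then have m: "m \<in> mono_maps P N" and n: "n \<in> mono_maps P N" by simp_all
  have "(\<forall>w\<in>Car P. (m w, n w) \<in> Rel N) \<longleftrightarrow> (\<forall>x\<in>Car X. \<forall>y\<in>Car Y. (m (p (x, y)), n (p (x, y))) \<in> Rel N)"
    using surj pC by fast
  then show "(m, n) \<in> Rel (mono_preord P N) \<longleftrightarrow> (?\<phi> m, ?\<phi> n) \<in> Rel (mono_preord X (mono_preord Y N))"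
    using m n \<phi>[OF m] \<phi>[OF n] \<phi>1[OF m] \<phi>1[OF n] by simp
qed

text \<open>Both sides are the monotone maps on the product: uncurry along \<open>prod.swap\<close>,
  then curry along the identity.\<close>

lemma swap_iso:
  assumes X: "is_preord X" and Y: "is_preord Y" and N: "is_preord N"
  shows "preord_iso (mono_preord Y (mono_preord X N)) (mono_preord X (mono_preord Y N))
    (\<lambda>k. \<lambda>x\<in>Car X. \<lambda>y\<in>Car Y. k y x)"
proof -
  let ?P = "prod_preord X Y"
  let ?c = "\<lambda>m. \<lambda>y\<in>Car Y. \<lambda>x\<in>Car X. m (prod.swap (y, x))"
  have P: "is_preord ?P" by (rule is_preord_prod[OF X Y])
  have "preord_iso ?P ?P id" "preord_iso (prod_preord Y X) ?P prod.swap"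
    by (rule preord_isoI; force simp: prod_preord_def)+
  note i = curry_iso[OF X Y P N this(1)] and c = curry_iso[OF Y X P N this(2)]
  show ?thesis
  proof (rule preord_iso_cong[OF preord_iso_trans[OF preord_iso_inverse[OF c] i]])
    fix k assume "k \<in> Car (mono_preord Y (mono_preord X N))"
    then have k: "k \<in> ?c ` Car (mono_preord ?P N)" unfolding preord_isoD(2)[OF c] .
    define m where "m = the_inv_into (Car (mono_preord ?P N)) ?c k"
    have "?c m = k" unfolding m_def by (rule f_the_inv_into_f[OF preord_isoD(1)[OF c] k])
    then have "k y x = m (x, y)" if "x \<in> Car X" "y \<in> Car Y" for x y
      using that by (metis restrict_apply' swap_simp)
    then show "((\<lambda>m. \<lambda>x\<in>Car X. \<lambda>y\<in>Car Y. m (id (x, y))) \<circ> the_inv_into (Car (mono_preord ?P N)) ?c) k =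
        (\<lambda>x\<in>Car X. \<lambda>y\<in>Car Y. k y x)"
      unfolding o_apply m_def[symmetric] by (simp cong: restrict_cong)
  qed
qed

text \<open>An arrow with fixed source and target is determined by its underlying function. The
  objects \<open>a\<close>, \<open>b\<close> are kept separate from \<open>c\<close>,
  \<open>D\<close> so that the lemma also covers opposite categories, where the function runs
  backwards.\<close>

lemma Fn_iso:
  assumes c: "is_preord c" "is_preord D" and h: "\<And>f. f \<in> hom C a b \<longleftrightarrow> f \<in> hom ORD c D \<and> Fn f \<in> Car Y"
    and le: "Le C = Le ORD" and sub: "Car Y \<subseteq> mono_maps c D"
    and Y: "\<And>m n. (m, n) \<in> Rel Y \<longleftrightarrow> m \<in> Car Y \<and> n \<in> Car Y \<and> (\<forall>x\<in>Car c. (m x, n x) \<in> Rel D)"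
  shows "preord_iso (hom_preord C a b) Y Fn"
proof (rule preord_isoI)
  show "inj_on Fn (Car (hom_preord C a b))"
    by (rule inj_onI) (auto simp: h intro: hom_ORD_eqI)
  show "Fn ` Car (hom_preord C a b) = Car Y"
  proof (intro equalityI subsetI)
    fix m assume "m \<in> Car Y"
    then have "\<lparr>Src = c, Fn = m, Tgt = D\<rparr> \<in> hom C a b" using c sub by (auto simp: h hom_ORD_iff)
    then show "m \<in> Fn ` Car (hom_preord C a b)" by force
  qed (auto simp: h)
  show "(f, g) \<in> Rel (hom_preord C a b) \<longleftrightarrow> (Fn f, Fn g) \<in> Rel Y"
    if "f \<in> Car (hom_preord C a b)" "g \<in> Car (hom_preord C a b)" for f g
    using that by (auto simp: h hom_ORD_iff Le_ORD le Y)
qed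

text \<open>A criterion for concrete categories: \<open>\<Phi>\<close> describes the arrows into
  \<open>c\<close> and \<open>\<chi>\<close> those into \<open>P\<close>. When
  \<open>\<kappa>\<close> is compatible with both descriptions, its comparison map is an isomorphism
  by two out of three.\<close>

lemma (in ord_category) power_if_iso:
  assumes X: "is_preord X" and ob: "c \<in> Obj C" "P \<in> Obj C" and \<kappa>: "\<kappa> \<in> mono_maps X (hom_preord C P c)"
    and \<Phi>: "\<And>D. D \<in> Obj C \<Longrightarrow> preord_iso (hom_preord C D c) (Y D) \<Phi>"
    and \<chi>: "\<And>D. D \<in> Obj C \<Longrightarrow> preord_iso (hom_preord C D P) (mono_preord X (Y D)) (\<chi> D)"
    and eq: "\<And>D h x. h \<in> hom C D P \<Longrightarrow> x \<in> Car X \<Longrightarrow> \<Phi> (Comp C (\<kappa> x) h) = \<chi> D h x"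
  shows "is_power C X c P \<kappa>"
  unfolding is_power_def
proof (intro conjI ballI ob \<kappa>)
  have k: "\<kappa> x \<in> hom C P c" if "x \<in> Car X" for x using mono_mapsD(1)[OF \<kappa> that] by simp
  fix D assume D: "D \<in> Obj C"
  let ?\<phi> = "\<lambda>h. \<lambda>x\<in>Car X. Comp C (\<kappa> x) h"
  show "preord_iso (hom_preord C D P) (mono_preord X (hom_preord C D c)) ?\<phi>"
  proof (rule preord_iso_cancel[OF mono_preord_iso[OF X \<Phi>[OF D]] \<chi>[OF D]])
    fix h assume hC: "h \<in> Car (hom_preord C D P)"
    then have h: "h \<in> hom C D P" by simp
    show "?\<phi> h \<in> Car (mono_preord X (hom_preord C D c))"
      unfolding mono_preord_simps(1)
    proof (rule mono_mapsI)
      fix x y assume xy: "(x, y) \<in> Rel X"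
      then have cx: "x \<in> Car X" "y \<in> Car X" using preord_RelD[OF X] by auto
      have "Le C (\<kappa> x) (\<kappa> y)" using mono_mapsD(3)[OF \<kappa> xy] by simp
      then show "(?\<phi> h x, ?\<phi> h y) \<in> Rel (hom_preord C D c)"
        using cx comp_hom[OF h k] comp_mono_left[OF h k[OF cx(1)] k[OF cx(2)]] by simp
    qed (use comp_hom[OF h k] in simp_all)
    have "\<chi> D h \<in> mono_maps X (Y D)" using preord_isoD(3)[OF \<chi>[OF D] hC] by simp
    then have "\<chi> D h \<in> extensional (Car X)" by (rule mono_mapsD(2))
    then show "(\<lambda>x\<in>Car X. \<Phi> (?\<phi> h x)) = \<chi> D h"
      by (rule extensionalityI[OF restrict_extensional]) (use eq[OF h] in auto)
  qed
qed

text \<open>The converse of \<open>power_ORD_elements\<close>. A map from \<open>D\<close> to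
  \<open>P\<close> becomes a family over \<open>D\<close> of monotone maps from \<open>X\<close> to
  \<open>c\<close>, and \<open>swap_iso\<close> turns it into a family over \<open>X\<close> of maps
  from \<open>D\<close> to \<open>c\<close>.\<close>

lemma power_ORD_if_elements:
  fixes c P :: "'a preord"
  assumes X: "is_preord X" and \<kappa>: "\<kappa> \<in> mono_maps X (hom_preord ORD P c)"
    and cP: "is_preord c" "is_preord P" and ev: "preord_iso P (mono_preord X c) (evaluation X \<kappa>)"
  shows "is_power ORD X c P \<kappa>"
proof (rule ord_category.power_if_iso[OF ord_category_ORD X _ _ \<kappa>])
  have F: "preord_iso (hom_preord ORD D Y) (mono_preord D Y) Fn" if "is_preord D" "is_preord Y" for D Y :: "'a preord"
    by (rule Fn_iso[where c = D and D = Y]) (use that in \<open>auto simp: hom_ORD_iff\<close>)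
  show "preord_iso (hom_preord ORD D c) (mono_preord D c) Fn" if "D \<in> Obj ORD" for D
    using F that cP by simp
  show "preord_iso (hom_preord ORD D P) (mono_preord X (mono_preord D c))
      ((\<lambda>k. \<lambda>x\<in>Car X. \<lambda>d\<in>Car D. k d x) \<circ> ((\<lambda>m. \<lambda>d\<in>Car D. evaluation X \<kappa> (m d)) \<circ> Fn))"
    if "D \<in> Obj ORD" for D
  proof -
    have D: "is_preord D" using that by simp
    show ?thesis
      by (rule preord_iso_trans[OF preord_iso_trans[OF F[OF D cP(2)] mono_preord_iso[OF D ev]] swap_iso[OF X D cP(1)]])
  qed
  fix D h x assume h: "h \<in> hom ORD D P" and x: "x \<in> Car X"
  have "\<kappa> x \<in> hom ORD P c" using mono_mapsD(1)[OF \<kappa> x] by simp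
  then have "Fn (Comp ORD (\<kappa> x) h) = (\<lambda>d\<in>Car D. evaluation X \<kappa> (Fn h d) x)"
    by (intro extensionalityI[OF hom_ORD_extensional[OF Comp_ORD_hom[OF h]]])
      (use x hom_ORDD(1)[OF h] in \<open>simp_all add: evaluation_def\<close>)
  then show "Fn (Comp ORD (\<kappa> x) h) =
      ((\<lambda>k. \<lambda>x\<in>Car X. \<lambda>d\<in>Car D. k d x) \<circ> ((\<lambda>m. \<lambda>d\<in>Car D. evaluation X \<kappa> (m d)) \<circ> Fn)) h x"
    using x by (simp cong: restrict_cong)
qed (use cP in simp_all)

section \<open>Uniqueness of powers and their preservation by functors\<close>

lemma (in ord_category) power_factor:
  assumes "is_power C X c P \<kappa>" "D \<in> Obj C" "k \<in> mono_maps X (hom_preord C D c)"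
  shows "\<exists>h\<in>hom C D P. \<forall>x\<in>Car X. Comp C (\<kappa> x) h = k x"
proof -
  have iso: "preord_iso (hom_preord C D P) (mono_preord X (hom_preord C D c)) (\<lambda>h. \<lambda>x\<in>Car X. Comp C (\<kappa> x) h)"
    using assms unfolding is_power_def by blast
  have "k \<in> (\<lambda>h. \<lambda>x\<in>Car X. Comp C (\<kappa> x) h) ` Car (hom_preord C D P)"
    unfolding preord_isoD(2)[OF iso] using assms by simp
  then obtain h where "k = (\<lambda>x\<in>Car X. Comp C (\<kappa> x) h)" "h \<in> Car (hom_preord C D P)" by (rule imageE)
  then show ?thesis by (intro bexI[of _ h]) simp_all
qed

lemma (in ord_category) power_unique:
  assumes "is_power C X c P \<kappa>" "h \<in> hom C D P" "k \<in> hom C D P"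
    "\<And>x. x \<in> Car X \<Longrightarrow> Comp C (\<kappa> x) h = Comp C (\<kappa> x) k"
  shows "h = k"
proof -
  have "D \<in> Obj C" using assms(2) dom_obj by (auto simp: hom_def)
  then have iso: "preord_iso (hom_preord C D P) (mono_preord X (hom_preord C D c)) (\<lambda>h. \<lambda>x\<in>Car X. Comp C (\<kappa> x) h)"
    using assms unfolding is_power_def by blast
  have "(\<lambda>x\<in>Car X. Comp C (\<kappa> x) h) = (\<lambda>x\<in>Car X. Comp C (\<kappa> x) k)" using assms(4) by (intro restrict_ext)
  then show ?thesis using inj_onD[OF preord_isoD(1)[OF iso]] assms(2,3) by simp
qed

lemma (in ord_category) power_iso:
  assumes X: "is_preord X" and pw: "is_power C X c P0 \<kappa>0"
    and h: "h \<in> hom C P P0" and k: "k \<in> hom C P0 P" and kh: "Comp C k h = Idt C P" and hk: "Comp C h k = Idt C P0"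
  shows "is_power C X c P (\<lambda>x\<in>Car X. Comp C (\<kappa>0 x) h)"
  unfolding is_power_def
proof (intro conjI ballI)
  show "c \<in> Obj C" using pw unfolding is_power_def by blast
  show "P \<in> Obj C" using h dom_obj by (auto simp: hom_def)
  have \<kappa>0: "\<kappa>0 \<in> mono_maps X (hom_preord C P0 c)" using pw unfolding is_power_def by blast
  have \<kappa>h: "\<kappa>0 x \<in> hom C P0 c" if "x \<in> Car X" for x using mono_mapsD(1)[OF \<kappa>0 that] by simp
  show "(\<lambda>x\<in>Car X. Comp C (\<kappa>0 x) h) \<in> mono_maps X (hom_preord C P c)"
  proof (rule mono_mapsI)
    fix x y assume xy: "(x, y) \<in> Rel X"
    then have c: "x \<in> Car X" "y \<in> Car X" using preord_RelD[OF X] by auto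
    have "Le C (\<kappa>0 x) (\<kappa>0 y)" using mono_mapsD(3)[OF \<kappa>0 xy] by simp
    then show "((\<lambda>x\<in>Car X. Comp C (\<kappa>0 x) h) x, (\<lambda>x\<in>Car X. Comp C (\<kappa>0 x) h) y) \<in> Rel (hom_preord C P c)"
      using c comp_hom[OF h \<kappa>h] comp_mono_left[OF h \<kappa>h[OF c(1)] \<kappa>h[OF c(2)]] by simp
  qed (use comp_hom[OF h \<kappa>h] in simp_all)
  fix D assume D: "D \<in> Obj C"
  have h_iso: "preord_iso (hom_preord C D P) (hom_preord C D P0) (Comp C h)"
  proof (rule preord_isoI)
    have kh_id: "Comp C k (Comp C h f) = f" if "f \<in> hom C D P" for f
      using assoc[OF that h k] kh id_left[OF that] by simp
    have hk_id: "Comp C h (Comp C k f) = f" if "f \<in> hom C D P0" for f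
      using assoc[OF that k h] hk id_left[OF that] by simp
    show "inj_on (Comp C h) (Car (hom_preord C D P))"
      by (rule inj_on_inverseI[of _ "Comp C k"]) (use kh_id in simp)
    show "Comp C h ` Car (hom_preord C D P) = Car (hom_preord C D P0)"
    proof (intro equalityI subsetI)
      fix f assume "f \<in> Car (hom_preord C D P0)"
      then have f: "f \<in> hom C D P0" by simp
      show "f \<in> Comp C h ` Car (hom_preord C D P)"
        unfolding hom_preord_simps(1) by (rule image_eqI[OF _ comp_hom[OF f k]]) (use hk_id[OF f] in simp)
    qed (use comp_hom[OF _ h] in auto)
    show "(f, g) \<in> Rel (hom_preord C D P) \<longleftrightarrow> (Comp C h f, Comp C h g) \<in> Rel (hom_preord C D P0)"
      if "f \<in> Car (hom_preord C D P)" "g \<in> Car (hom_preord C D P)" for f g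
    proof -
      have f: "f \<in> hom C D P" and g: "g \<in> hom C D P" using that by simp_all
      show ?thesis
        using f g comp_hom[OF f h] comp_hom[OF g h] comp_mono_right[OF f g h]
          comp_mono_right[OF comp_hom[OF f h] comp_hom[OF g h] k] kh_id[OF f] kh_id[OF g] by auto
    qed
  qed
  have \<kappa>0_iso: "preord_iso (hom_preord C D P0) (mono_preord X (hom_preord C D c)) (\<lambda>f. \<lambda>x\<in>Car X. Comp C (\<kappa>0 x) f)"
    using pw D unfolding is_power_def by blast
  show "preord_iso (hom_preord C D P) (mono_preord X (hom_preord C D c))
      (\<lambda>f. \<lambda>x\<in>Car X. Comp C ((\<lambda>x\<in>Car X. Comp C (\<kappa>0 x) h) x) f)"
  proof (rule preord_iso_cong[OF preord_iso_trans[OF h_iso \<kappa>0_iso]])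
    fix f assume "f \<in> Car (hom_preord C D P)"
    then have f: "f \<in> hom C D P" by simp
    show "((\<lambda>f. \<lambda>x\<in>Car X. Comp C (\<kappa>0 x) f) \<circ> Comp C h) f =
        (\<lambda>x\<in>Car X. Comp C ((\<lambda>x\<in>Car X. Comp C (\<kappa>0 x) h) x) f)"
      unfolding o_apply by (rule restrict_ext) (use assoc[OF f h \<kappa>h] in simp)
  qed
qed

lemma ord_functorD:
  assumes "ord_functor C D F"
  shows "a \<in> Obj C \<Longrightarrow> FObj F a \<in> Obj D"
    "f \<in> hom C a b \<Longrightarrow> FArr F f \<in> hom D (FObj F a) (FObj F b)"
    "a \<in> Obj C \<Longrightarrow> FArr F (Idt C a) = Idt D (FObj F a)"
    "f \<in> hom C a b \<Longrightarrow> g \<in> hom C b c \<Longrightarrow> FArr F (Comp C g f) = Comp D (FArr F g) (FArr F f)"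
    "f \<in> hom C a b \<Longrightarrow> g \<in> hom C a b \<Longrightarrow> Le C f g \<Longrightarrow> Le D (FArr F f) (FArr F g)"
    "FObj F \<in> extensional (Obj C)" "FArr F \<in> extensional (Arr C)"
  using assms unfolding ord_functor_def hom_def by (auto simp: PiE_def Pi_def)

text \<open>Two powers of \<open>c\<close> by \<open>X\<close> are linked by mutually inverse
  comparison arrows compatible with their cones, and a functor preserves this. Hence preservation
  has to be verified at one power only, which may be chosen conveniently.\<close>

lemma functor_power_transport:
  assumes C: "ord_category C" and D: "ord_category D" and F: "ord_functor C D F" and X: "is_preord X"
    and pw0: "is_power C X c P0 \<kappa>0"
    and Fpw0: "is_power D X (FObj F c) (FObj F P0) (\<lambda>x\<in>Car X. FArr F (\<kappa>0 x))"
    and pw: "is_power C X c P \<kappa>"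
  shows "is_power D X (FObj F c) (FObj F P) (\<lambda>x\<in>Car X. FArr F (\<kappa> x))"
proof -
  interpret C: ord_category C by (rule C)
  interpret D: ord_category D by (rule D)
  have ob: "P \<in> Obj C" "P0 \<in> Obj C" using pw pw0 unfolding is_power_def by blast+
  have \<kappa>: "\<kappa> \<in> mono_maps X (hom_preord C P c)" and \<kappa>0: "\<kappa>0 \<in> mono_maps X (hom_preord C P0 c)"
    using pw pw0 unfolding is_power_def by blast+
  have \<kappa>h: "\<kappa> x \<in> hom C P c" "\<kappa>0 x \<in> hom C P0 c" if "x \<in> Car X" for x
    using mono_mapsD(1)[OF \<kappa> that] mono_mapsD(1)[OF \<kappa>0 that] by simp_all
  obtain h where h: "h \<in> hom C P P0" and h\<kappa>: "\<And>x. x \<in> Car X \<Longrightarrow> Comp C (\<kappa>0 x) h = \<kappa> x"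
    using C.power_factor[OF pw0 ob(1) \<kappa>] by blast
  obtain k where k: "k \<in> hom C P0 P" and k\<kappa>: "\<And>x. x \<in> Car X \<Longrightarrow> Comp C (\<kappa> x) k = \<kappa>0 x"
    using C.power_factor[OF pw ob(2) \<kappa>0] by blast
  have kh: "Comp C k h = Idt C P"
  proof (rule C.power_unique[OF pw C.comp_hom[OF h k] C.id_hom[OF ob(1)]])
    show "Comp C (\<kappa> x) (Comp C k h) = Comp C (\<kappa> x) (Idt C P)" if x: "x \<in> Car X" for x
      using C.assoc[OF h k \<kappa>h(1)[OF x]] k\<kappa>[OF x] h\<kappa>[OF x] C.id_right[OF \<kappa>h(1)[OF x]] by simp
  qed
  have hk: "Comp C h k = Idt C P0"
  proof (rule C.power_unique[OF pw0 C.comp_hom[OF k h] C.id_hom[OF ob(2)]])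
    show "Comp C (\<kappa>0 x) (Comp C h k) = Comp C (\<kappa>0 x) (Idt C P0)" if x: "x \<in> Car X" for x
      using C.assoc[OF k h \<kappa>h(2)[OF x]] k\<kappa>[OF x] h\<kappa>[OF x] C.id_right[OF \<kappa>h(2)[OF x]] by simp
  qed
  note Fh = ord_functorD(2)[OF F h] and Fk = ord_functorD(2)[OF F k]
  have "Comp D (FArr F k) (FArr F h) = Idt D (FObj F P)" "Comp D (FArr F h) (FArr F k) = Idt D (FObj F P0)"
    using ord_functorD(3,4)[OF F] kh hk h k ob by metis+
  from D.power_iso[OF X Fpw0 Fh Fk this]
  have "is_power D X (FObj F c) (FObj F P) (\<lambda>x\<in>Car X. Comp D ((\<lambda>x\<in>Car X. FArr F (\<kappa>0 x)) x) (FArr F h))" .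
  moreover have "(\<lambda>x\<in>Car X. Comp D ((\<lambda>x\<in>Car X. FArr F (\<kappa>0 x)) x) (FArr F h)) = (\<lambda>x\<in>Car X. FArr F (\<kappa> x))"
    by (rule restrict_ext) (use ord_functorD(4)[OF F h \<kappa>h(2)] h\<kappa> in simp)
  ultimately show ?thesis by simp
qed

section \<open>Opposite and full subcategories\<close>

lemma ord_category_op:
  assumes "ord_category C"
  shows "ord_category (op_cat C)"
proof -
  interpret ord_category C by (rule assms)
  have hom: "hom (op_cat C) a b = hom C b a" for a b by (auto simp: hom_def op_cat_def)
  have hp: "hom_preord (op_cat C) a b = hom_preord C b a" for a b
    unfolding hom_preord_def hom by (simp add: op_cat_def)
  show ?thesis
    by unfold_locales
      (auto simp: op_cat_def dom_obj cod_obj id_hom id_left id_right assoc hom_is_preord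
        hom[unfolded op_cat_def] hp[unfolded op_cat_def] intro: comp_hom comp_mono_left comp_mono_right)
qed

lemma ord_category_full_subcat:
  assumes "ord_category C" "S \<subseteq> Obj C"
  shows "ord_category (full_subcat C S)"
proof -
  interpret ord_category C by (rule assms)
  have hom: "hom (full_subcat C S) a b = (if a \<in> S \<and> b \<in> S then hom C a b else {})" for a b
    by (auto simp: hom_def full_subcat_def)
  have homI: "f \<in> hom C a b" if "f \<in> hom (full_subcat C S) a b" for f a b
    using that unfolding hom by (auto split: if_splits)
  have hp: "hom_preord (full_subcat C S) a b = hom_preord C a b" if "a \<in> S" "b \<in> S" for a b
    using that unfolding hom_preord_def hom by (simp add: full_subcat_def)
  have ob: "a \<in> Obj (full_subcat C S) \<longleftrightarrow> a \<in> S" for a by (simp add: full_subcat_def)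
  have cmp: "Comp (full_subcat C S) = Comp C" "Idt (full_subcat C S) = Idt C" "Le (full_subcat C S) = Le C"
    by (simp_all add: full_subcat_def)
  show ?thesis
  proof (unfold_locales, unfold ob cmp)
    show "Dom (full_subcat C S) f \<in> S" "Cod (full_subcat C S) f \<in> S" if "f \<in> Arr (full_subcat C S)" for f
      using that by (simp_all add: full_subcat_def)
    show "Idt C a \<in> hom (full_subcat C S) a a" if "a \<in> S" for a
      using that assms(2) id_hom unfolding hom by auto
    show "Comp C g f \<in> hom (full_subcat C S) a c"
      if "f \<in> hom (full_subcat C S) a b" "g \<in> hom (full_subcat C S) b c" for f g a b c
      using that comp_hom unfolding hom by (auto split: if_splits)
    show "is_preord (hom_preord (full_subcat C S) a b)" if "a \<in> S" "b \<in> S" for a b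
      using hp[OF that] hom_is_preord that assms(2) by (simp add: subset_iff)
  qed (blast intro: homI id_left id_right assoc comp_mono_left comp_mono_right)+
qed


section \<open>The theory of bounded preordered sets\<close>

definition bmaps :: "'a preord \<Rightarrow> 'a \<Rightarrow> 'a \<Rightarrow> 'b preord \<Rightarrow> 'b \<Rightarrow> 'b \<Rightarrow> ('a \<Rightarrow> 'b) preord" where
  "bmaps N z t M z' t' = \<lparr>Car = {m \<in> mono_maps N M. m z = z' \<and> m t = t'},
     Rel = {(h, k). h \<in> mono_maps N M \<and> h z = z' \<and> h t = t' \<and> k \<in> mono_maps N M \<and> k z = z' \<and> k t = t' \<and>
       (\<forall>x\<in>Car N. (h x, k x) \<in> Rel M)}\<rparr>"

lemma bmaps_simps [simp]:
  "m \<in> Car (bmaps N z t M z' t') \<longleftrightarrow> m \<in> mono_maps N M \<and> m z = z' \<and> m t = t'"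
  "(h, k) \<in> Rel (bmaps N z t M z' t') \<longleftrightarrow> h \<in> Car (bmaps N z t M z' t') \<and> k \<in> Car (bmaps N z t M z' t') \<and>
       (\<forall>x\<in>Car N. (h x, k x) \<in> Rel M)"
  by (auto simp: bmaps_def)

lemma is_preord_bmaps:
  assumes M: "is_preord M" shows "is_preord (bmaps N z t M z' t')"
  unfolding is_preord_iff
proof (intro conjI allI impI)
  show "Rel (bmaps N z t M z' t') \<subseteq> Car (bmaps N z t M z' t') \<times> Car (bmaps N z t M z' t')" by auto
  show "\<forall>h\<in>Car (bmaps N z t M z' t'). (h, h) \<in> Rel (bmaps N z t M z' t')"
    using preord_refl[OF M] mono_mapsD(1) by fastforce
  show "(f, h) \<in> Rel (bmaps N z t M z' t')"
    if "(f, g) \<in> Rel (bmaps N z t M z' t')" "(g, h) \<in> Rel (bmaps N z t M z' t')" for f g h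
    using that preord_trans[OF M] by simp blast
qed

text \<open>The map \<open>e\<close> makes room inside \<open>'a\<close> for two new elements, so
  that every preorder on a subset of \<open>'a\<close> can be enlarged by bounds without leaving the
  type. The same \<open>z\<close> and \<open>t\<close> serve for all preorders.\<close>

locale universe =
  fixes e :: "'a \<Rightarrow> 'a" and z t :: 'a
  assumes infinite_universe: "infinite (UNIV :: 'a set)"
    and inj_e: "inj e" and zt: "z \<noteq> t" and ez: "e x \<noteq> z" and et: "e x \<noteq> t"
begin

lemma e_eq [simp]: "e x = e y \<longleftrightarrow> x = y"
  using inj_e by (simp add: inj_eq)

lemma ezt [simp]: "e x \<noteq> z" "z \<noteq> e x" "e x \<noteq> t" "t \<noteq> e x" "z \<noteq> t" "t \<noteq> z"
  using ez et zt by metis+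

definition bd :: "'a preord \<Rightarrow> 'a preord" where
  "bd X = \<lparr>Car = insert z (insert t (e ` Car X)),
     Rel = {(e x, e y) | x y. (x, y) \<in> Rel X} \<union> {z} \<times> insert z (insert t (e ` Car X)) \<union>
       insert z (insert t (e ` Car X)) \<times> {t}\<rparr>"

lemma bd_Car: "y \<in> Car (bd X) \<longleftrightarrow> y = z \<or> y = t \<or> (\<exists>x\<in>Car X. y = e x)"
  by (auto simp: bd_def)

lemma bd_Car_simps [simp]: "z \<in> Car (bd X)" "t \<in> Car (bd X)" "e x \<in> Car (bd X) \<longleftrightarrow> x \<in> Car X"
  by (auto simp: bd_Car)

lemma bd_Rel: "(a, b) \<in> Rel (bd X) \<longleftrightarrow>
    (\<exists>x y. a = e x \<and> b = e y \<and> (x, y) \<in> Rel X) \<or> a = z \<and> b \<in> Car (bd X) \<or> a \<in> Car (bd X) \<and> b = t"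
  by (auto simp: bd_def)

lemma bd_Rel_e [simp]: "(e x, e y) \<in> Rel (bd X) \<longleftrightarrow> (x, y) \<in> Rel X"
  by (simp add: bd_Rel)

lemma is_preord_bd: assumes X: "is_preord X" shows "is_preord (bd X)"
  unfolding is_preord_iff
proof (intro conjI allI impI)
  show sub: "Rel (bd X) \<subseteq> Car (bd X) \<times> Car (bd X)"
    using preord_RelD[OF X] by (auto simp: bd_Rel)
  show "\<forall>x\<in>Car (bd X). (x, x) \<in> Rel (bd X)"
    using preord_refl[OF X] by (auto simp: bd_Rel bd_Car)
  show "(a, d) \<in> Rel (bd X)" if ab: "(a, b) \<in> Rel (bd X)" and bd: "(b, d) \<in> Rel (bd X)" for a b d
  proof (cases "a = z \<or> d = t")
    case True
    moreover have "a \<in> Car (bd X)" "d \<in> Car (bd X)" using sub ab bd by blast+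
    ultimately show ?thesis unfolding bd_Rel by blast
  next
    case False
    then have "b \<noteq> t" using bd unfolding bd_Rel by auto
    then obtain x y where xy: "a = e x" "b = e y" "(x, y) \<in> Rel X"
      using ab False unfolding bd_Rel by blast
    then obtain w where w: "d = e w" "(y, w) \<in> Rel X" using bd False unfolding bd_Rel by auto
    show ?thesis using preord_trans[OF X xy(3) w(2)] xy w by simp
  qed
qed

lemma bounded_bd: "is_preord X \<Longrightarrow> bounded_preord (bd X) z t"
  unfolding bounded_preord_def using is_preord_bd by (auto simp: bd_Rel)

lemma finite_bd [simp]: "finite (Car (bd X)) \<longleftrightarrow> finite (Car X)"
  by (simp add: bd_def finite_image_iff inj_on_subset[OF inj_e])

text \<open>As \<open>e\<close> is injective and misses \<open>z\<close> and \<open>t\<close>, the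
  preorder \<open>X\<close> can be read off \<open>bd X\<close>. This allows \<open>inv bd\<close>
  to recover an arity from an object of the theory when homomorphisms are built.\<close>

lemma bd_inj:
  assumes "bd X = bd Y"
  shows "X = Y"
proof (rule preord.equality)
  have "x \<in> Car X \<longleftrightarrow> x \<in> Car Y" for x using assms bd_Car_simps(3)[of x X] bd_Car_simps(3)[of x Y] by simp
  then show "Car X = Car Y" by blast
  have "(x, y) \<in> Rel X \<longleftrightarrow> (x, y) \<in> Rel Y" for x y using assms bd_Rel_e[of x y X] bd_Rel_e[of x y Y] by simp
  then show "Rel X = Rel Y" by auto
qed simp

definition lift :: "('a \<Rightarrow> 'b) \<Rightarrow> 'b \<Rightarrow> 'b \<Rightarrow> 'a \<Rightarrow> 'b" where
  "lift f z' t' y = (if y = z then z' else if y = t then t' else f (inv e y))"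

lemma lift_simps [simp]: "lift f z' t' z = z'" "lift f z' t' t = t'" "lift f z' t' (e x) = f x"
  using inv_f_f[OF inj_e] by (simp_all add: lift_def)

lemma lift_Car: "\<lbrakk>bounded_preord M z' t'; \<And>x. x \<in> Car X \<Longrightarrow> f x \<in> Car M; y \<in> Car (bd X)\<rbrakk> \<Longrightarrow> lift f z' t' y \<in> Car M"
  unfolding bounded_preord_def bd_Car by auto

lemma lift_Rel:
  assumes X: "is_preord X" and M: "bounded_preord M z' t'" and f: "\<And>x. x \<in> Car X \<Longrightarrow> f x \<in> Car M"
    and r: "\<And>x y. (x, y) \<in> Rel X \<Longrightarrow> (f x, f y) \<in> Rel M" and ab: "(a, b) \<in> Rel (bd X)"
  shows "(lift f z' t' a, lift f z' t' b) \<in> Rel M"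
proof -
  have "a \<in> Car (bd X)" "b \<in> Car (bd X)" using preord_RelD[OF is_preord_bd[OF X] ab] by auto
  from lift_Car[OF M f this(1)] lift_Car[OF M f this(2)] show ?thesis
    using ab r M unfolding bd_Rel bounded_preord_def by auto
qed

lemma lift_bmaps:
  assumes X: "is_preord X" and M: "bounded_preord M z' t'" and f: "f \<in> mono_maps X M"
  shows "restrict (lift f z' t') (Car (bd X)) \<in> Car (bmaps (bd X) z t M z' t')"
proof -
  have "restrict (lift f z' t') (Car (bd X)) \<in> mono_maps (bd X) M"
  proof (rule mono_mapsI)
    fix a b assume ab: "(a, b) \<in> Rel (bd X)"
    then have "a \<in> Car (bd X)" "b \<in> Car (bd X)" using preord_RelD[OF is_preord_bd[OF X]] by auto
    then show "(restrict (lift f z' t') (Car (bd X)) a, restrict (lift f z' t') (Car (bd X)) b) \<in> Rel M"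
      using lift_Rel[OF X M mono_mapsD(1)[OF f] mono_mapsD(3)[OF f] ab] by simp
  qed (use lift_Car[OF M mono_mapsD(1)[OF f]] in simp_all)
  then show ?thesis by simp
qed

text \<open>The universal property of \<open>bd X\<close> as the free bounded preorder on
  \<open>X\<close>, including the order on maps; \<open>e\<close> is the unit and
  \<open>lift\<close> the extension.\<close>

lemma bmaps_bd_iso:
  assumes X: "is_preord X" and M: "bounded_preord M z' t'"
  shows "preord_iso (bmaps (bd X) z t M z' t') (mono_preord X M) (\<lambda>m. \<lambda>x\<in>Car X. m (e x))" (is "preord_iso _ _ ?\<phi>")
proof (rule preord_isoI)
  have \<phi>: "?\<phi> m \<in> mono_maps X M" if "m \<in> mono_maps (bd X) M" for m
  proof (rule mono_mapsI)
    fix x y assume xy: "(x, y) \<in> Rel X"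
    then show "(?\<phi> m x, ?\<phi> m y) \<in> Rel M"
      using preord_RelD[OF X xy] mono_mapsD(3)[OF that, of "e x" "e y"] by simp
  qed (use mono_mapsD(1)[OF that] in simp_all)
  show "inj_on ?\<phi> (Car (bmaps (bd X) z t M z' t'))"
  proof (rule inj_onI)
    fix m n assume mn: "m \<in> Car (bmaps (bd X) z t M z' t')" "n \<in> Car (bmaps (bd X) z t M z' t')" and eq: "?\<phi> m = ?\<phi> n"
    show "m = n"
    proof (rule mono_maps_eqI[of m "bd X" M n M])
      fix y assume "y \<in> Car (bd X)"
      moreover have "m (e x) = n (e x)" if "x \<in> Car X" for x using fun_cong[OF eq, of x] that by simp
      ultimately show "m y = n y" using mn unfolding bd_Car by auto
    qed (use mn in simp_all)
  qed
  show "?\<phi> ` Car (bmaps (bd X) z t M z' t') = Car (mono_preord X M)"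
  proof (intro equalityI subsetI)
    fix f assume "f \<in> Car (mono_preord X M)"
    then have f: "f \<in> mono_maps X M" by simp
    show "f \<in> ?\<phi> ` Car (bmaps (bd X) z t M z' t')"
    proof (rule image_eqI[OF _ lift_bmaps[OF X M f]])
      show "f = ?\<phi> (restrict (lift f z' t') (Car (bd X)))"
        by (rule extensionalityI[OF mono_mapsD(2)[OF f]]) simp_all
    qed
  qed (use \<phi> in auto)
  fix m n assume mn: "m \<in> Car (bmaps (bd X) z t M z' t')" "n \<in> Car (bmaps (bd X) z t M z' t')"
  have "(z', z') \<in> Rel M" "(t', t') \<in> Rel M" using M unfolding bounded_preord_def by auto
  then have "(\<forall>y\<in>Car (bd X). (m y, n y) \<in> Rel M) \<longleftrightarrow> (\<forall>x\<in>Car X. (m (e x), n (e x)) \<in> Rel M)"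
    using mn by (auto simp: bd_Car)
  then show "(m, n) \<in> Rel (bmaps (bd X) z t M z' t') \<longleftrightarrow> (?\<phi> m, ?\<phi> n) \<in> Rel (mono_preord X M)"
    using mn \<phi> by simp
qed

definition bdm :: "'a pmap \<Rightarrow> 'a pmap" where
  "bdm f = pmap (bd (Src f)) (lift (\<lambda>x. e (Fn f x)) z t) (bd (Tgt f))"

lemma bdm_hom:
  assumes f: "f \<in> hom ORD X Y"
  shows "bdm f \<in> hom ORD (bd X) (bd Y)" "Fn (bdm f) z = z" "Fn (bdm f) t = t"
    "x \<in> Car X \<Longrightarrow> Fn (bdm f) (e x) = e (Fn f x)"
proof -
  note [simp] = hom_ORDD(1,2)[OF f]
  note X = hom_ORDD(3)[OF f] and Y = hom_ORDD(4)[OF f]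
  have "pmap (bd X) (lift (\<lambda>x. e (Fn f x)) z t) (bd Y) \<in> hom ORD (bd X) (bd Y)"
  proof (rule pmap_hom[OF is_preord_bd[OF X] is_preord_bd[OF Y]])
    show "lift (\<lambda>x. e (Fn f x)) z t y \<in> Car (bd Y)" if "y \<in> Car (bd X)" for y
      by (rule lift_Car[OF bounded_bd[OF Y] _ that]) (use hom_ORDD(5)[OF f] in simp)
    show "(lift (\<lambda>x. e (Fn f x)) z t a, lift (\<lambda>x. e (Fn f x)) z t b) \<in> Rel (bd Y)" if "(a, b) \<in> Rel (bd X)" for a b
      by (rule lift_Rel[OF X bounded_bd[OF Y] _ _ that]) (use hom_ORDD(5,6)[OF f] in simp_all)
  qed
  then show "bdm f \<in> hom ORD (bd X) (bd Y)" by (simp add: bdm_def)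
qed (use hom_ORDD(1,2)[OF f] in \<open>simp_all add: bdm_def\<close>)

text \<open>Powers in an opposite category are tensors, and the tensor of \<open>c\<close> by
  \<open>X\<close> among preorders is their product. The sections \<open>y \<mapsto> (x, y)\<close>
  are the components of its universal cocone.\<close>

definition pairing_map :: "'a preord \<Rightarrow> ('a \<times> 'a \<Rightarrow> 'a) \<Rightarrow> 'a preord \<Rightarrow> 'a \<Rightarrow> 'a pmap" where
  "pairing_map c p P x = pmap c (\<lambda>y. p (x, y)) P"

lemma pairing_map:
  assumes X: "is_preord X" and c: "is_preord c" and P: "is_preord P" and p: "preord_iso (prod_preord X c) P p"
  shows "x \<in> Car X \<Longrightarrow> pairing_map c p P x \<in> hom ORD c P"
    "y \<in> Car c \<Longrightarrow> Fn (pairing_map c p P x) y = p (x, y)"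
    "(x, x') \<in> Rel X \<Longrightarrow> Le ORD (pairing_map c p P x) (pairing_map c p P x')"
proof -
  have pC: "p (x, y) \<in> Car P" if "x \<in> Car X" "y \<in> Car c" for x y
    using preord_isoD(3)[OF p] that by (simp add: prod_preord_def)
  have pR: "(p (x, y), p (x', y')) \<in> Rel P" if "(x, x') \<in> Rel X" "(y, y') \<in> Rel c" for x x' y y'
    using preord_isoD(4)[OF p, of "(x, y)" "(x', y')"] that preord_RelD[OF X that(1)] preord_RelD[OF c that(2)]
    by (simp add: prod_preord_def)
  show "pairing_map c p P x \<in> hom ORD c P" if "x \<in> Car X"
    unfolding pairing_map_def by (rule pmap_hom[OF c P]) (use pC pR preord_refl[OF X] that in auto)
  show "Le ORD (pairing_map c p P x) (pairing_map c p P x')" if "(x, x') \<in> Rel X"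
    using pR[OF that preord_refl[OF c]] by (simp add: Le_ORD pairing_map_def)
qed (simp add: pairing_map_def)

text \<open>By freeness both sides are determined by values on generators, where the claim reduces
  to currying. So \<open>bd P\<close> is the tensor of \<open>bd c\<close> by \<open>X\<close> among
  bounded preorders.\<close>

lemma bmaps_power_iso:
  assumes X: "is_preord X" and c: "is_preord c" and P: "is_preord P" and p: "preord_iso (prod_preord X c) P p"
    and N: "bounded_preord N z' t'"
  shows "preord_iso (bmaps (bd P) z t N z' t') (mono_preord X (bmaps (bd c) z t N z' t'))
    (\<lambda>m. \<lambda>x\<in>Car X. \<lambda>y\<in>Car (bd c). m (Fn (bdm (pairing_map c p P x)) y))" (is "preord_iso _ _ ?\<phi>")
proof (rule preord_iso_cancel)
  have Np: "is_preord N" using N unfolding bounded_preord_def by simp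
  note pm = pairing_map[OF X c P p]
  show "preord_iso (mono_preord X (bmaps (bd c) z t N z' t')) (mono_preord X (mono_preord c N))
      (\<lambda>k. \<lambda>x\<in>Car X. (\<lambda>m. \<lambda>y\<in>Car c. m (e y)) (k x))"
    by (rule mono_preord_iso[OF X bmaps_bd_iso[OF c N]])
  show "preord_iso (bmaps (bd P) z t N z' t') (mono_preord X (mono_preord c N))
      ((\<lambda>m. \<lambda>x\<in>Car X. \<lambda>y\<in>Car c. m (p (x, y))) \<circ> (\<lambda>m. \<lambda>w\<in>Car P. m (e w)))"
    by (rule preord_iso_trans[OF bmaps_bd_iso[OF P N] curry_iso[OF X c P Np p]])
  fix m assume "m \<in> Car (bmaps (bd P) z t N z' t')"
  then have m: "m \<in> mono_maps (bd P) N" "m z = z'" "m t = t'" by simp_all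
  let ?b = "\<lambda>x. bdm (pairing_map c p P x)"
  have b: "?b x \<in> hom ORD (bd c) (bd P)" "Fn (?b x) z = z" "Fn (?b x) t = t"
    "\<And>y. y \<in> Car c \<Longrightarrow> Fn (?b x) (e y) = e (p (x, y))" if "x \<in> Car X" for x
    using bdm_hom[OF pm(1)[OF that]] pm(2) by simp_all
  have pC: "p (x, y) \<in> Car P" if "x \<in> Car X" "y \<in> Car c" for x y
    using hom_ORDD(5)[OF pm(1)[OF that(1)] that(2)] pm(2)[OF that(2)] by simp
  have \<phi>1: "?\<phi> m x \<in> Car (bmaps (bd c) z t N z' t')" if x: "x \<in> Car X" for x
  proof -
    have "?\<phi> m x \<in> mono_maps (bd c) N"
    proof (rule mono_mapsI)
      fix y y' assume yy: "(y, y') \<in> Rel (bd c)"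
      then show "(?\<phi> m x y, ?\<phi> m x y') \<in> Rel N"
        using x preord_RelD[OF is_preord_bd[OF c] yy] mono_mapsD(3)[OF m(1) hom_ORDD(6)[OF b(1)[OF x] yy]] by simp
    qed (use x mono_mapsD(1)[OF m(1) hom_ORDD(5)[OF b(1)[OF x]]] in simp_all)
    then show ?thesis using x m b(2,3)[OF x] by simp
  qed
  show "?\<phi> m \<in> Car (mono_preord X (bmaps (bd c) z t N z' t'))"
    unfolding mono_preord_simps(1)
  proof (rule mono_mapsI)
    fix x x' assume xx: "(x, x') \<in> Rel X"
    then have cx: "x \<in> Car X" "x' \<in> Car X" using preord_RelD[OF X] by auto
    have "(m (Fn (?b x) y), m (Fn (?b x') y)) \<in> Rel N" if "y \<in> Car (bd c)" for y
    proof (rule mono_mapsD(3)[OF m(1)])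
      have "(p (x, y), p (x', y)) \<in> Rel P" if "y \<in> Car c" for y
        using pm(3)[OF xx] that hom_ORDD(1,2)[OF pm(1)[OF cx(1)]] pm(2)[OF that] by (auto simp: Le_ORD)
      then show "(Fn (?b x) y, Fn (?b x') y) \<in> Rel (bd P)"
        using that b[OF cx(1)] b[OF cx(2)] unfolding bd_Car by (auto simp: bd_Rel)
    qed
    then show "(?\<phi> m x, ?\<phi> m x') \<in> Rel (bmaps (bd c) z t N z' t')"
      unfolding bmaps_simps(2) using \<phi>1[OF cx(1)] \<phi>1[OF cx(2)] cx by simp
  qed (use \<phi>1 in simp_all)
  show "(\<lambda>x\<in>Car X. (\<lambda>m. \<lambda>y\<in>Car c. m (e y)) (?\<phi> m x)) =
      ((\<lambda>m. \<lambda>x\<in>Car X. \<lambda>y\<in>Car c. m (p (x, y))) \<circ> (\<lambda>m. \<lambda>w\<in>Car P. m (e w))) m"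
    unfolding o_apply by (intro restrict_ext) (use b(4) pC in \<open>simp add: restrict_def fun_eq_iff\<close>)
qed

end

lemma mono_hom_preord_functor:
  assumes F: "ord_functor C D F" and X: "is_preord X" and \<kappa>: "\<kappa> \<in> mono_maps X (hom_preord C P c)"
  shows "(\<lambda>x\<in>Car X. FArr F (\<kappa> x)) \<in> mono_maps X (hom_preord D (FObj F P) (FObj F c))"
proof (rule mono_mapsI)
  have \<kappa>h: "\<kappa> x \<in> hom C P c" if "x \<in> Car X" for x using mono_mapsD(1)[OF \<kappa> that] by simp
  show "(\<lambda>x\<in>Car X. FArr F (\<kappa> x)) x \<in> Car (hom_preord D (FObj F P) (FObj F c))" if "x \<in> Car X" for x
    using ord_functorD(2)[OF F \<kappa>h] that by simp
  fix x y assume xy: "(x, y) \<in> Rel X"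
  then have c: "x \<in> Car X" "y \<in> Car X" using preord_RelD[OF X] by auto
  then show "((\<lambda>x\<in>Car X. FArr F (\<kappa> x)) x, (\<lambda>x\<in>Car X. FArr F (\<kappa> x)) y) \<in> Rel (hom_preord D (FObj F P) (FObj F c))"
    using mono_mapsD(3)[OF \<kappa> xy] ord_functorD(2)[OF F \<kappa>h] ord_functorD(5)[OF F \<kappa>h \<kappa>h] by simp
qed simp

section \<open>The arities and the opposite of their category\<close>

definition FP :: "'a preord set" where
  "FP = {X. is_preord X \<and> finite (Car X)}"

lemma FP_iff: "X \<in> FP \<longleftrightarrow> is_preord X \<and> finite (Car X)"
  by (simp add: FP_def)

lemma op_JJ_simps:
  "Obj (op_cat JJ) = FP" "Obj JJ = FP"
  "f \<in> Arr (op_cat JJ) \<longleftrightarrow> f \<in> Arr ORD \<and> Src f \<in> FP \<and> Tgt f \<in> FP"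
  "Comp (op_cat JJ) g f = Comp ORD f g" "Idt (op_cat JJ) = Idt ORD" "Le (op_cat JJ) = Le ORD"
  "Dom (op_cat JJ) = Tgt" "Cod (op_cat JJ) = Src"
  by (auto simp: op_cat_def JJ_def full_subcat_def FP_def)

lemma hom_op_JJ: "f \<in> hom (op_cat JJ) X Y \<longleftrightarrow> X \<in> FP \<and> Y \<in> FP \<and> f \<in> hom ORD Y X"
  unfolding hom_def by (auto simp: op_JJ_simps)

lemma ord_category_op_JJ: "ord_category (op_cat (JJ :: ('a preord, 'a pmap) ordcat))"
  unfolding JJ_def by (intro ord_category_op ord_category_full_subcat ord_category_ORD) auto

lemma Fn_iso_op_JJ:
  assumes "D \<in> FP" "c \<in> FP"
  shows "preord_iso (hom_preord (op_cat JJ) D c) (mono_preord c D) Fn"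
  by (rule Fn_iso[where c = c and D = D]) (use assms in \<open>auto simp: hom_op_JJ op_JJ_simps FP_iff hom_ORD_iff\<close>)

section \<open>The theory, its structure functor and its powers\<close>

context universe
begin

definition T :: "('a preord, 'a pmap) ordcat" where
  "T = \<lparr>Obj = bd ` FP,
     Arr = {f \<in> Arr ORD. Src f \<in> bd ` FP \<and> Tgt f \<in> bd ` FP \<and> Fn f z = z \<and> Fn f t = t},
     Dom = Tgt, Cod = Src, Idt = Idt ORD, Comp = (\<lambda>g f. Comp ORD f g), Le = Le ORD\<rparr>"

lemma T_simps [simp]:
  "Obj T = bd ` FP" "Dom T = Tgt" "Cod T = Src" "Idt T = Idt ORD" "Comp T g f = Comp ORD f g" "Le T = Le ORD"
  by (simp_all add: T_def)

lemma hom_T: "f \<in> hom T N M \<longleftrightarrow> N \<in> bd ` FP \<and> M \<in> bd ` FP \<and> f \<in> hom ORD M N \<and> Fn f z = z \<and> Fn f t = t"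
  unfolding hom_def by (auto simp: T_def)

lemma hom_TD:
  assumes "f \<in> hom T N M"
  shows "f \<in> hom ORD M N" "Fn f z = z" "Fn f t = t" "N \<in> bd ` FP" "M \<in> bd ` FP"
  using assms hom_T by blast+

lemma Arr_T_iff: "f \<in> Arr T \<longleftrightarrow> f \<in> hom T (Tgt f) (Src f)"
  unfolding hom_def by simp

lemma bd_FP: "N \<in> bd ` FP \<Longrightarrow> is_preord N \<and> z \<in> Car N \<and> t \<in> Car N \<and> finite (Car N) \<and> bounded_preord N z t"
  using bounded_bd is_preord_bd by (auto simp: FP_iff)

lemma ord_category_T: "ord_category T"
proof -
  interpret ORD: ord_category "ORD :: ('a preord, 'a pmap) ordcat" by (rule ord_category_ORD)
  show ?thesis
  proof
    fix f g h :: "'a pmap" and X Y Z W :: "'a preord"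
    show "Dom T f \<in> Obj T" "Cod T f \<in> Obj T" if "f \<in> Arr T"
      using that by (auto simp: T_def)
    show "Idt T X \<in> hom T X X" if "X \<in> Obj T"
      using that bd_FP[of X] by (auto simp: hom_T intro: Idt_ORD_hom)
    show "Comp T g f \<in> hom T X Z" if f: "f \<in> hom T X Y" and g: "g \<in> hom T Y Z"
      unfolding hom_T using hom_TD[OF f] hom_TD[OF g] Comp_ORD_hom[OF hom_TD(1)[OF g] hom_TD(1)[OF f]]
        hom_ORDD(1)[OF hom_TD(1)[OF g]] bd_FP[OF hom_TD(5)[OF g]] by simp
    show "Comp T (Idt T Y) f = f" if "f \<in> hom T X Y" using ORD.id_right[OF hom_TD(1)[OF that]] by simp
    show "Comp T f (Idt T X) = f" if "f \<in> hom T X Y" using ORD.id_left[OF hom_TD(1)[OF that]] by simp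
    show "Comp T h (Comp T g f) = Comp T (Comp T h g) f"
      if "f \<in> hom T X Y" "g \<in> hom T Y Z" "h \<in> hom T Z W"
      using ORD.assoc[OF hom_TD(1)[OF that(3)] hom_TD(1)[OF that(2)] hom_TD(1)[OF that(1)]] by simp
    show "is_preord (hom_preord T X Y)" if "X \<in> Obj T" "Y \<in> Obj T"
    proof -
      have "is_preord (hom_preord ORD Y X)" using that bd_FP by (intro ORD.hom_is_preord) auto
      then show ?thesis unfolding is_preord_def preorder_on_def refl_on_def trans_def
        using hom_TD(1) by (auto simp: hom_preord_def) blast+
    qed
    show "Le T (Comp T g f) (Comp T g' f)"
      if "f \<in> hom T X Y" "g \<in> hom T Y Z" "g' \<in> hom T Y Z" "Le T g g'" for g'
      using ORD.comp_mono_right[OF hom_TD(1)[OF that(2)] hom_TD(1)[OF that(3)] hom_TD(1)[OF that(1)]] that(4) by simp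
    show "Le T (Comp T g f) (Comp T g f')"
      if "f \<in> hom T X Y" "f' \<in> hom T X Y" "g \<in> hom T Y Z" "Le T f f'" for f'
      using ORD.comp_mono_left[OF hom_TD(1)[OF that(3)] hom_TD(1)[OF that(1)] hom_TD(1)[OF that(2)]] that(4) by simp
  qed
qed

definition \<tau> :: "('a preord, 'a pmap, 'a preord, 'a pmap) functr" where
  "\<tau> = \<lparr>FObj = restrict bd FP, FArr = restrict bdm (Arr (op_cat JJ))\<rparr>"

lemma \<tau>_simps [simp]: "X \<in> FP \<Longrightarrow> FObj \<tau> X = bd X" "f \<in> hom (op_cat JJ) X Y \<Longrightarrow> FArr \<tau> f = bdm f"
  by (auto simp: \<tau>_def hom_def)

lemma bdm_hom_T:
  assumes "X \<in> FP" "Y \<in> FP" "f \<in> hom ORD Y X"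
  shows "bdm f \<in> hom T (bd X) (bd Y)"
  using bdm_hom(1,2,3)[OF assms(3)] assms(1,2) by (simp add: hom_T)

lemma bd_cases:
  assumes "y \<in> Car (bd X)" "y = z \<Longrightarrow> Q" "y = t \<Longrightarrow> Q" "\<And>x. x \<in> Car X \<Longrightarrow> y = e x \<Longrightarrow> Q"
  shows Q
  using assms unfolding bd_Car by blast

lemma bdm_Idt: "is_preord X \<Longrightarrow> bdm (Idt ORD X) = Idt ORD (bd X)"
proof -
  assume X: "is_preord X"
  note i = Idt_ORD_hom[OF X]
  show ?thesis
  proof (rule hom_ORD_eqI[OF bdm_hom(1)[OF i] Idt_ORD_hom[OF is_preord_bd[OF X]]])
    show "Fn (bdm (Idt ORD X)) y = Fn (Idt ORD (bd X)) y" if "y \<in> Car (bd X)" for y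
      using that bdm_hom(2-4)[OF i] by (elim bd_cases) simp_all
  qed
qed

lemma bdm_Comp:
  assumes f: "f \<in> hom ORD X Y" and g: "g \<in> hom ORD Y Z"
  shows "bdm (Comp ORD g f) = Comp ORD (bdm g) (bdm f)"
proof (rule hom_ORD_eqI[OF bdm_hom(1)[OF Comp_ORD_hom[OF f g]] Comp_ORD_hom[OF bdm_hom(1)[OF f] bdm_hom(1)[OF g]]])
  note s = hom_ORDD(1)[OF f] hom_ORDD(1)[OF bdm_hom(1)[OF f]]
  show "Fn (bdm (Comp ORD g f)) y = Fn (Comp ORD (bdm g) (bdm f)) y" if "y \<in> Car (bd X)" for y
    using that bdm_hom(2-4)[OF f] bdm_hom(2-4)[OF g] bdm_hom(2-4)[OF Comp_ORD_hom[OF f g]] s hom_ORDD(5)[OF f]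
    by (elim bd_cases) simp_all
qed

lemma bdm_Le:
  assumes f: "f \<in> hom ORD X Y" and g: "g \<in> hom ORD X Y" and le: "Le ORD f g"
  shows "Le ORD (bdm f) (bdm g)"
  unfolding Le_ORD hom_ORDD(1,2)[OF bdm_hom(1)[OF f]]
proof
  fix y assume "y \<in> Car (bd X)"
  then show "(Fn (bdm f) y, Fn (bdm g) y) \<in> Rel (bd Y)"
    using bdm_hom(2-4)[OF f] bdm_hom(2-4)[OF g] le hom_ORDD(1,2)[OF f]
    by (elim bd_cases) (simp_all add: Le_ORD, simp_all add: bd_Rel)
qed

lemma \<tau>_functor: "ord_functor (op_cat JJ) T \<tau>"
proof -
  have h: "f \<in> hom ORD (Src f) (Tgt f)" if "f \<in> Arr (op_cat JJ)" for f :: "'a pmap"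
    using that Arr_ORD_iff[of f] by (simp add: op_JJ_simps)
  have FP: "Src f \<in> FP" "Tgt f \<in> FP" if "f \<in> Arr (op_cat JJ)" for f :: "'a pmap"
    using that by (simp_all add: op_JJ_simps)
  have b: "bdm f \<in> hom T (bd (Tgt f)) (bd (Src f))" if "f \<in> Arr (op_cat JJ)" for f
    by (rule bdm_hom_T[OF FP(2)[OF that] FP(1)[OF that] h[OF that]])
  have A: "FArr \<tau> f = bdm f" if "f \<in> Arr (op_cat JJ)" for f using that by (simp add: \<tau>_def)
  have I: "Idt ORD X \<in> Arr (op_cat JJ)" if "X \<in> FP" for X :: "'a preord"
    using that Idt_ORD_hom[of X] Arr_ORD_iff[of "Idt ORD X"] by (simp add: op_JJ_simps FP_iff)
  have C: "Comp ORD f g \<in> Arr (op_cat JJ)"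
    if "f \<in> Arr (op_cat JJ)" "g \<in> Arr (op_cat JJ)" "Tgt g = Src f" for f g :: "'a pmap"
    using Comp_ORD_hom[of g "Src g" "Src f" f "Tgt f"] h[OF that(1)] h[OF that(2)] that FP[OF that(1)] FP[OF that(2)]
      Arr_ORD_iff[of "Comp ORD f g"] by (simp add: op_JJ_simps)
  show ?thesis
    unfolding ord_functor_def
  proof (intro conjI ballI impI)
    show "FObj \<tau> \<in> Obj (op_cat JJ) \<rightarrow>\<^sub>E Obj T" by (auto simp: \<tau>_def op_JJ_simps)
    show "FArr \<tau> \<in> Arr (op_cat JJ) \<rightarrow>\<^sub>E Arr T"
      using b by (auto simp: \<tau>_def hom_def)
    show "Dom T (FArr \<tau> f) = FObj \<tau> (Dom (op_cat JJ) f)" "Cod T (FArr \<tau> f) = FObj \<tau> (Cod (op_cat JJ) f)"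
      if "f \<in> Arr (op_cat JJ)" for f
      using b[OF that] FP[OF that] A[OF that] by (simp_all add: op_JJ_simps hom_def)
    show "FArr \<tau> (Idt (op_cat JJ) X) = Idt T (FObj \<tau> X)" if "X \<in> Obj (op_cat JJ)" for X
      using that A[OF I] bdm_Idt by (simp add: op_JJ_simps FP_iff)
    show "FArr \<tau> (Comp (op_cat JJ) g f) = Comp T (FArr \<tau> g) (FArr \<tau> f)"
      if "f \<in> Arr (op_cat JJ)" "g \<in> Arr (op_cat JJ)" "Cod (op_cat JJ) f = Dom (op_cat JJ) g" for f g
      using that A[OF that(1)] A[OF that(2)] A[OF C[OF that(1,2)]] bdm_Comp[OF h[OF that(2)], of f "Tgt f"] h[OF that(1)]
      by (simp add: op_JJ_simps)
    show "Le T (FArr \<tau> f) (FArr \<tau> g)"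
      if "f \<in> Arr (op_cat JJ)" "g \<in> Arr (op_cat JJ)"
        "Dom (op_cat JJ) f = Dom (op_cat JJ) g \<and> Cod (op_cat JJ) f = Cod (op_cat JJ) g \<and> Le (op_cat JJ) f g" for f g
      using that A[OF that(1)] A[OF that(2)] bdm_Le[OF h[OF that(1)], of g] h[OF that(2)] by (simp add: op_JJ_simps)
  qed
qed

lemma Fn_iso_T:
  assumes "D \<in> bd ` FP" "c \<in> FP"
  shows "preord_iso (hom_preord T D (bd c)) (bmaps (bd c) z t D z t) Fn"
proof (rule Fn_iso[where c = "bd c" and D = D])
  show "is_preord (bd c)" "is_preord D" using assms(2) is_preord_bd[of c] bd_FP[OF assms(1)] by (simp_all add: FP_iff)
  have c: "bd c \<in> bd ` FP" using assms(2) by blast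
  show "f \<in> hom T D (bd c) \<longleftrightarrow> f \<in> hom ORD (bd c) D \<and> Fn f \<in> Car (bmaps (bd c) z t D z t)" for f
    unfolding hom_T bmaps_simps hom_ORD_iff using assms(1) c by blast
  show "Car (bmaps (bd c) z t D z t) \<subseteq> mono_maps (bd c) D" by auto
qed simp_all

text \<open>The product lives on pairs; a pairing function of the infinite type moves it back into
  the universe, and it stays finite.\<close>

lemma tensor_exists:
  fixes X c :: "'a preord"
  assumes "X \<in> FP" "c \<in> FP"
  shows "\<exists>P\<in>FP. \<exists>p. preord_iso (prod_preord X c) (P :: 'a preord) p"
proof -
  obtain q :: "'a \<times> 'a \<Rightarrow> 'a" where "bij_betw q (UNIV \<times> UNIV) UNIV"
    using card_of_Times_same_infinite[OF infinite_universe] card_of_ordIso by blast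
  then have q: "inj_on q (Car (prod_preord X c))" by (auto simp: bij_betw_def intro: inj_on_subset)
  have "is_preord (prod_preord X c)" using assms is_preord_prod by (auto simp: FP_iff)
  then have "preord_iso (prod_preord X c) (image_preord q (prod_preord X c)) q"
    "is_preord (image_preord q (prod_preord X c))" using preord_iso_image[OF q] is_preord_image[OF q] by auto
  moreover have "finite (Car (image_preord q (prod_preord X c)))"
    using assms by (simp add: image_preord_def prod_preord_def FP_iff)
  ultimately show ?thesis by (intro bexI[of _ "image_preord q (prod_preord X c)"] exI[of _ q]) (simp_all add: FP_iff)
qed

context
  fixes X c P :: "'a preord" and p
  assumes X: "X \<in> FP" and c: "c \<in> FP" and P: "P \<in> FP" and p: "preord_iso (prod_preord X c) P p"
begin

lemma XcP_preord: "is_preord X" "is_preord c" "is_preord P"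
  using X c P by (simp_all add: FP_iff)

lemmas pm = pairing_map[OF XcP_preord p]

lemma pairing_mono: "(\<lambda>x\<in>Car X. pairing_map c p P x) \<in> mono_maps X (hom_preord (op_cat JJ) P c)"
  by (rule mono_mapsI) (use pm preord_RelD[OF XcP_preord(1)] c P in \<open>auto simp: hom_op_JJ op_JJ_simps\<close>)

text \<open>Arrows into \<open>c\<close> in the opposite category are monotone maps out of
  \<open>c\<close>, so the universal property of the power is currying.\<close>

lemma power_op_JJ: "is_power (op_cat JJ) X c P (\<lambda>x\<in>Car X. pairing_map c p P x)"
proof (rule ord_category.power_if_iso[OF ord_category_op_JJ XcP_preord(1) _ _ pairing_mono])
  show "c \<in> Obj (op_cat JJ)" "P \<in> Obj (op_cat JJ)" using c P by (simp_all add: op_JJ_simps)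
  show "preord_iso (hom_preord (op_cat JJ) D c) (mono_preord c D) Fn" if "D \<in> Obj (op_cat JJ)" for D
    using that c by (intro Fn_iso_op_JJ) (simp_all add: op_JJ_simps)
  show "preord_iso (hom_preord (op_cat JJ) D P) (mono_preord X (mono_preord c D))
      ((\<lambda>m. \<lambda>x\<in>Car X. \<lambda>y\<in>Car c. m (p (x, y))) \<circ> Fn)" if "D \<in> Obj (op_cat JJ)" for D
    by (rule preord_iso_trans[OF Fn_iso_op_JJ curry_iso[OF XcP_preord _ p]])
      (use that P in \<open>simp_all add: op_JJ_simps FP_iff\<close>)
  fix D h x assume "h \<in> hom (op_cat JJ) D P" and x: "x \<in> Car X"
  then have h: "h \<in> hom ORD P D" by (simp add: hom_op_JJ)
  have "Fn (Comp ORD h (pairing_map c p P x)) = (\<lambda>y\<in>Car c. Fn h (p (x, y)))"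
    by (rule extensionalityI[OF hom_ORD_extensional[OF Comp_ORD_hom[OF pm(1)[OF x] h]]])
      (use pm(2) hom_ORDD(1)[OF pm(1)[OF x]] in simp_all)
  then show "Fn (Comp (op_cat JJ) ((\<lambda>x\<in>Car X. pairing_map c p P x) x) h) =
      ((\<lambda>m. \<lambda>x\<in>Car X. \<lambda>y\<in>Car c. m (p (x, y))) \<circ> Fn) h x"
    using x by (simp add: op_JJ_simps)
qed

text \<open>Free functors preserve tensors; read in the opposite category, \<open>bd\<close> takes
  the power by \<open>X\<close> to a power by \<open>X\<close>.\<close>

lemma power_T: "is_power T X (bd c) (bd P) (\<lambda>x\<in>Car X. bdm (pairing_map c p P x))"
proof (rule ord_category.power_if_iso[OF ord_category_T XcP_preord(1)])
  show "bd c \<in> Obj T" "bd P \<in> Obj T" using c P by simp_all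
  have k: "bdm (pairing_map c p P x) \<in> hom T (bd P) (bd c)" if "x \<in> Car X" for x
    by (rule bdm_hom_T[OF P c pm(1)[OF that]])
  have "Le T (bdm (pairing_map c p P x)) (bdm (pairing_map c p P y))" if "(x, y) \<in> Rel X" for x y
    using bdm_Le[OF pm(1) pm(1) pm(3)[OF that]] preord_RelD[OF XcP_preord(1) that] by simp
  then show "(\<lambda>x\<in>Car X. bdm (pairing_map c p P x)) \<in> mono_maps X (hom_preord T (bd P) (bd c))"
    by (intro mono_mapsI) (use k preord_RelD[OF XcP_preord(1)] in auto)
  show "preord_iso (hom_preord T D (bd c)) (bmaps (bd c) z t D z t) Fn" if "D \<in> Obj T" for D
    using that c by (intro Fn_iso_T) simp_all
  show "preord_iso (hom_preord T D (bd P)) (mono_preord X (bmaps (bd c) z t D z t))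
      ((\<lambda>m. \<lambda>x\<in>Car X. \<lambda>y\<in>Car (bd c). m (Fn (bdm (pairing_map c p P x)) y)) \<circ> Fn)" if "D \<in> Obj T" for D
    by (rule preord_iso_trans[OF Fn_iso_T bmaps_power_iso[OF XcP_preord p]]) (use that P bd_FP[of D] in simp_all)
  fix D h x assume h: "h \<in> hom T D (bd P)" and x: "x \<in> Car X"
  note kx = hom_TD(1)[OF k[OF x]]
  have "Fn (Comp ORD h (bdm (pairing_map c p P x))) = (\<lambda>y\<in>Car (bd c). Fn h (Fn (bdm (pairing_map c p P x)) y))"
    by (rule extensionalityI[OF hom_ORD_extensional[OF Comp_ORD_hom[OF kx hom_TD(1)[OF h]]]])
      (use hom_ORDD(1)[OF kx] in simp_all)
  then show "Fn (Comp T ((\<lambda>x\<in>Car X. bdm (pairing_map c p P x)) x) h) =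
      ((\<lambda>m. \<lambda>x\<in>Car X. \<lambda>y\<in>Car (bd c). m (Fn (bdm (pairing_map c p P x)) y)) \<circ> Fn) h x"
    using x by simp
qed

end

text \<open>For each \<open>X\<close> and \<open>c\<close> the product provides one power that is
  known to be preserved; every other power follows by
  \<open>functor_power_transport\<close>.\<close>

lemma ord_algebraic_theory: "ord_algebraic_theory T \<tau>"
proof -
  have "preserves_powers (FP :: 'a preord set) (op_cat JJ) T \<tau>"
    unfolding preserves_powers_def
  proof (intro ballI allI impI)
    fix X c P :: "'a preord" and \<kappa> assume X: "X \<in> FP" and pw: "is_power (op_cat JJ) X c P \<kappa>"
    have c: "c \<in> FP" using pw unfolding is_power_def by (simp add: op_JJ_simps)
    obtain P0 :: "'a preord" and p where P0: "P0 \<in> FP" and p: "preord_iso (prod_preord X c) P0 p" using tensor_exists[OF X c] by blast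
    have Xp: "is_preord X" using X by (simp add: FP_iff)
    have "FArr \<tau> (pairing_map c p P0 x) = bdm (pairing_map c p P0 x)" if "x \<in> Car X" for x
      using pm(1)[OF X c P0 p that] P0 c by (intro \<tau>_simps(2)) (simp add: hom_op_JJ)
    then have eq: "(\<lambda>x\<in>Car X. FArr \<tau> ((\<lambda>x\<in>Car X. pairing_map c p P0 x) x)) = (\<lambda>x\<in>Car X. bdm (pairing_map c p P0 x))"
      by (intro restrict_ext) simp
    show "is_power T X (FObj \<tau> c) (FObj \<tau> P) (\<lambda>x\<in>Car X. FArr \<tau> (\<kappa> x))"
      by (rule functor_power_transport[OF ord_category_op_JJ ord_category_T \<tau>_functor Xp power_op_JJ[OF X c P0 p] _ pw])
        (use power_T[OF X c P0 p] eq c P0 in simp)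
  qed
  moreover have "FObj \<tau> ` FP = bd ` FP" by (simp add: \<tau>_def)
  ultimately show ?thesis
    unfolding ord_algebraic_theory_def op_JJ_simps using ord_category_T \<tau>_functor by simp
qed

end


section \<open>Algebras\<close>

lemma hom_AlgD:
  assumes "\<alpha> \<in> hom (Alg S) A B"
  shows "Src \<alpha> = A" "Tgt \<alpha> = B" "is_algebra S A" "is_algebra S B"
    "a \<in> Obj S \<Longrightarrow> Fn \<alpha> a \<in> hom ORD (FObj A a) (FObj B a)" "Fn \<alpha> \<in> extensional (Obj S)"
    "f \<in> hom S a b \<Longrightarrow> Comp ORD (Fn \<alpha> b) (FArr A f) = Comp ORD (FArr B f) (Fn \<alpha> a)"
  using assms unfolding hom_def Alg_def is_alg_hom_def by (auto simp: PiE_def Pi_def hom_def)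

lemma hom_AlgI:
  assumes "is_algebra S A" "is_algebra S B" "\<And>a. a \<in> Obj S \<Longrightarrow> \<phi> a \<in> hom ORD (FObj A a) (FObj B a)"
    "\<phi> \<in> extensional (Obj S)"
    "\<And>f a b. f \<in> hom S a b \<Longrightarrow> Comp ORD (\<phi> b) (FArr A f) = Comp ORD (FArr B f) (\<phi> a)"
  shows "\<lparr>Src = A, Fn = \<phi>, Tgt = B\<rparr> \<in> hom (Alg S) A B"
  using assms unfolding hom_def[of "Alg S"] Alg_def is_alg_hom_def
  by (auto simp: PiE_def Pi_def) (simp add: hom_def)

lemma hom_Alg_eqI:
  assumes \<alpha>: "\<alpha> \<in> hom (Alg S) A B" and \<beta>: "\<beta> \<in> hom (Alg S) A B"
    and eq: "\<And>a. a \<in> Obj S \<Longrightarrow> Fn \<alpha> a = Fn \<beta> a"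
  shows "\<alpha> = \<beta>"
proof -
  have "Fn \<alpha> = Fn \<beta>" by (rule extensionalityI[OF hom_AlgD(6)[OF \<alpha>] hom_AlgD(6)[OF \<beta>] eq])
  then show ?thesis using hom_AlgD(1,2)[OF \<alpha>] hom_AlgD(1,2)[OF \<beta>] by (intro arrow.equality) simp_all
qed

lemma algebra_functor: "is_algebra S A \<Longrightarrow> ord_functor S ORD A"
  by (simp add: is_algebra_def)

lemma algebra_arr:
  assumes "is_algebra S A" "f \<in> hom S a b"
  shows "FArr A f \<in> hom ORD (FObj A a) (FObj A b)"
  by (rule ord_functorD(2)[OF algebra_functor[OF assms(1)] assms(2)])

lemma Alg_simps [simp]:
  "A \<in> Obj (Alg S) \<longleftrightarrow> is_algebra S A"
  "Dom (Alg S) = Src" "Cod (Alg S) = Tgt"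
  "Le (Alg S) \<alpha> \<beta> \<longleftrightarrow> (\<forall>a\<in>Obj S. Le ORD (Fn \<alpha> a) (Fn \<beta> a))"
  "a \<in> Obj S \<Longrightarrow> Fn (Idt (Alg S) A) a = Idt ORD (FObj A a)"
  "a \<in> Obj S \<Longrightarrow> Fn (Comp (Alg S) \<beta> \<alpha>) a = Comp ORD (Fn \<beta> a) (Fn \<alpha> a)"
  by (simp_all add: Alg_def)

lemma Arr_Alg_iff: "\<alpha> \<in> Arr (Alg S) \<longleftrightarrow> \<alpha> \<in> hom (Alg S) (Src \<alpha>) (Tgt \<alpha>)"
  by (simp add: hom_def)

lemma ord_category_Alg:
  assumes S: "ord_category S"
  shows "ord_category (Alg S :: (('o, 'm, 'a) alg, ('o, 'm, 'a) alg_hom) ordcat)"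
proof -
  interpret S: ord_category S by (rule S)
  interpret ORD: ord_category "ORD :: ('a preord, 'a pmap) ordcat" by (rule ord_category_ORD)
  have I: "Idt (Alg S) A \<in> hom (Alg S) A A" if A: "is_algebra S A" for A :: "('o, 'm, 'a) alg"
  proof -
    have "\<lparr>Src = A, Fn = (\<lambda>a\<in>Obj S. Idt ORD (FObj A a)), Tgt = A\<rparr> \<in> hom (Alg S) A A"
    proof (rule hom_AlgI[OF A A])
      have ob: "FObj A a \<in> Obj ORD" if "a \<in> Obj S" for a
        by (rule ord_functorD(1)[OF algebra_functor[OF A] that])
      show "(\<lambda>a\<in>Obj S. Idt ORD (FObj A a)) a \<in> hom ORD (FObj A a) (FObj A a)" if "a \<in> Obj S" for a
        using ORD.id_hom[OF ob[OF that]] that by simp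
      fix f a b assume f: "f \<in> hom S a b"
      then have "a \<in> Obj S" "b \<in> Obj S" using S.dom_obj S.cod_obj by (auto simp: hom_def)
      then show "Comp ORD ((\<lambda>a\<in>Obj S. Idt ORD (FObj A a)) b) (FArr A f) = Comp ORD (FArr A f) ((\<lambda>a\<in>Obj S. Idt ORD (FObj A a)) a)"
        using ORD.id_left[OF algebra_arr[OF A f]] ORD.id_right[OF algebra_arr[OF A f]] by simp
    qed simp
    then show ?thesis by (simp add: Alg_def)
  qed
  have C: "Comp (Alg S) \<beta> \<alpha> \<in> hom (Alg S) A D"
    if \<alpha>: "\<alpha> \<in> hom (Alg S) A B" and \<beta>: "\<beta> \<in> hom (Alg S) B D"
    for \<alpha> \<beta> and A B D :: "('o, 'm, 'a) alg"
  proof -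
    have "\<lparr>Src = A, Fn = (\<lambda>a\<in>Obj S. Comp ORD (Fn \<beta> a) (Fn \<alpha> a)), Tgt = D\<rparr> \<in> hom (Alg S) A D"
    proof (rule hom_AlgI[OF hom_AlgD(3)[OF \<alpha>] hom_AlgD(4)[OF \<beta>]])
      show "(\<lambda>a\<in>Obj S. Comp ORD (Fn \<beta> a) (Fn \<alpha> a)) a \<in> hom ORD (FObj A a) (FObj D a)" if "a \<in> Obj S" for a
        using ORD.comp_hom[OF hom_AlgD(5)[OF \<alpha> that] hom_AlgD(5)[OF \<beta> that]] that by simp
      fix f a b assume f: "f \<in> hom S a b"
      then have ab: "a \<in> Obj S" "b \<in> Obj S" using S.dom_obj S.cod_obj by (auto simp: hom_def)
      note h = algebra_arr[OF hom_AlgD(3)[OF \<alpha>] f] algebra_arr[OF hom_AlgD(4)[OF \<alpha>] f] algebra_arr[OF hom_AlgD(4)[OF \<beta>] f]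
      show "Comp ORD ((\<lambda>a\<in>Obj S. Comp ORD (Fn \<beta> a) (Fn \<alpha> a)) b) (FArr A f) =
          Comp ORD (FArr D f) ((\<lambda>a\<in>Obj S. Comp ORD (Fn \<beta> a) (Fn \<alpha> a)) a)"
        using ab ORD.assoc[OF h(1) hom_AlgD(5)[OF \<alpha> ab(2)] hom_AlgD(5)[OF \<beta> ab(2)]]
          ORD.assoc[OF hom_AlgD(5)[OF \<alpha> ab(1)] h(2) hom_AlgD(5)[OF \<beta> ab(2)]]
          ORD.assoc[OF hom_AlgD(5)[OF \<alpha> ab(1)] hom_AlgD(5)[OF \<beta> ab(1)] h(3)]
          hom_AlgD(7)[OF \<alpha> f] hom_AlgD(7)[OF \<beta> f] by simp
    qed simp
    then show ?thesis using hom_AlgD(1)[OF \<alpha>] hom_AlgD(2)[OF \<beta>] by (simp add: Alg_def)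
  qed
  show ?thesis
  proof
    fix \<alpha> \<beta> \<gamma> :: "('o, 'm, 'a) alg_hom" and A B D E :: "('o, 'm, 'a) alg"
    show "Dom (Alg S) \<alpha> \<in> Obj (Alg S)" "Cod (Alg S) \<alpha> \<in> Obj (Alg S)" if "\<alpha> \<in> Arr (Alg S)"
      using that hom_AlgD(3,4)[of \<alpha> S] unfolding Arr_Alg_iff by auto
    show "Idt (Alg S) A \<in> hom (Alg S) A A" if "A \<in> Obj (Alg S)" using that I by simp
    show "Comp (Alg S) \<beta> \<alpha> \<in> hom (Alg S) A D" if "\<alpha> \<in> hom (Alg S) A B" "\<beta> \<in> hom (Alg S) B D"
      by (rule C[OF that])
    show "Comp (Alg S) (Idt (Alg S) B) \<alpha> = \<alpha>" if \<alpha>: "\<alpha> \<in> hom (Alg S) A B"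
      by (rule hom_Alg_eqI[OF C[OF \<alpha> I[OF hom_AlgD(4)[OF \<alpha>]]] \<alpha>]) (use ORD.id_left[OF hom_AlgD(5)[OF \<alpha>]] in simp)
    show "Comp (Alg S) \<alpha> (Idt (Alg S) A) = \<alpha>" if \<alpha>: "\<alpha> \<in> hom (Alg S) A B"
      by (rule hom_Alg_eqI[OF C[OF I[OF hom_AlgD(3)[OF \<alpha>]] \<alpha>] \<alpha>]) (use ORD.id_right[OF hom_AlgD(5)[OF \<alpha>]] in simp)
    show "Comp (Alg S) \<gamma> (Comp (Alg S) \<beta> \<alpha>) = Comp (Alg S) (Comp (Alg S) \<gamma> \<beta>) \<alpha>"
      if \<alpha>: "\<alpha> \<in> hom (Alg S) A B" and \<beta>: "\<beta> \<in> hom (Alg S) B D" and \<gamma>: "\<gamma> \<in> hom (Alg S) D E"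
      by (rule hom_Alg_eqI[OF C[OF C[OF \<alpha> \<beta>] \<gamma>] C[OF \<alpha> C[OF \<beta> \<gamma>]]])
        (use ORD.assoc[OF hom_AlgD(5)[OF \<alpha>] hom_AlgD(5)[OF \<beta>] hom_AlgD(5)[OF \<gamma>]] in simp)
    show "is_preord (hom_preord (Alg S) A B)" if A: "A \<in> Obj (Alg S)" and B: "B \<in> Obj (Alg S)"
    proof -
      have P: "is_preord (hom_preord ORD (FObj A a) (FObj B a))" if "a \<in> Obj S" for a
      proof (rule ORD.hom_is_preord)
        show "FObj A a \<in> Obj ORD" "FObj B a \<in> Obj ORD"
          using ord_functorD(1)[OF algebra_functor[of S A] that] ord_functorD(1)[OF algebra_functor[of S B] that] A B
          by simp_all
      qed
      have r: "Le ORD (Fn \<alpha> a) (Fn \<alpha> a)" if "\<alpha> \<in> hom (Alg S) A B" "a \<in> Obj S" for \<alpha> a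
        using preord_refl[OF P[OF that(2)], of "Fn \<alpha> a"] hom_AlgD(5)[OF that] by simp
      have tr: "Le ORD (Fn \<alpha> a) (Fn \<gamma> a)"
        if h: "\<alpha> \<in> hom (Alg S) A B" "\<beta> \<in> hom (Alg S) A B" "\<gamma> \<in> hom (Alg S) A B" and a: "a \<in> Obj S"
          and le: "Le ORD (Fn \<alpha> a) (Fn \<beta> a)" "Le ORD (Fn \<beta> a) (Fn \<gamma> a)" for \<alpha> \<beta> \<gamma> a
        using preord_trans[OF P[OF a], of "Fn \<alpha> a" "Fn \<beta> a" "Fn \<gamma> a"] le hom_AlgD(5)[OF h(1) a] hom_AlgD(5)[OF h(2) a] hom_AlgD(5)[OF h(3) a] by simp
      show ?thesis
        unfolding is_preord_iff
      proof (intro conjI allI impI)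
        show "Rel (hom_preord (Alg S) A B) \<subseteq> Car (hom_preord (Alg S) A B) \<times> Car (hom_preord (Alg S) A B)" by auto
        show "\<forall>\<alpha>\<in>Car (hom_preord (Alg S) A B). (\<alpha>, \<alpha>) \<in> Rel (hom_preord (Alg S) A B)" using r by simp
        fix \<alpha> \<beta> \<gamma> assume "(\<alpha>, \<beta>) \<in> Rel (hom_preord (Alg S) A B)" "(\<beta>, \<gamma>) \<in> Rel (hom_preord (Alg S) A B)"
        then have h: "\<alpha> \<in> hom (Alg S) A B" "\<beta> \<in> hom (Alg S) A B" "\<gamma> \<in> hom (Alg S) A B"
          and le: "\<forall>a\<in>Obj S. Le ORD (Fn \<alpha> a) (Fn \<beta> a)" "\<forall>a\<in>Obj S. Le ORD (Fn \<beta> a) (Fn \<gamma> a)" by simp_all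
        show "(\<alpha>, \<gamma>) \<in> Rel (hom_preord (Alg S) A B)" using h tr[OF h] le by simp
      qed
    qed
    show "Le (Alg S) (Comp (Alg S) \<beta> \<alpha>) (Comp (Alg S) \<beta>' \<alpha>)"
      if "\<alpha> \<in> hom (Alg S) A B" "\<beta> \<in> hom (Alg S) B D" "\<beta>' \<in> hom (Alg S) B D" "Le (Alg S) \<beta> \<beta>'" for \<beta>'
      using that(4) ORD.comp_mono_left[OF hom_AlgD(5)[OF that(1)] hom_AlgD(5)[OF that(2)] hom_AlgD(5)[OF that(3)]] by simp
    show "Le (Alg S) (Comp (Alg S) \<beta> \<alpha>) (Comp (Alg S) \<beta> \<alpha>')"
      if "\<alpha> \<in> hom (Alg S) A B" "\<alpha>' \<in> hom (Alg S) A B" "\<beta> \<in> hom (Alg S) B D" "Le (Alg S) \<alpha> \<alpha>'" for \<alpha>'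
      using that(4) ORD.comp_mono_right[OF hom_AlgD(5)[OF that(1)] hom_AlgD(5)[OF that(2)] hom_AlgD(5)[OF that(3)]] by simp
  qed
qed

section \<open>Algebras and homomorphisms reduced to the carrier with its two constants\<close>

context universe
begin

text \<open>Any element could serve as the point; with \<open>z\<close> the generator of
  \<open>bd one\<close> is \<open>e z\<close>.\<close>

definition one :: "'a preord" where "one = \<lparr>Car = {z}, Rel = {(z, z)}\<rparr>"

definition emp :: "'a preord" where "emp = \<lparr>Car = {}, Rel = {}\<rparr>"

lemma one_emp [simp]: "one \<in> FP" "emp \<in> FP" "is_preord one" "is_preord emp" "Car one = {z}" "Car emp = {}"
  by (simp_all add: one_def emp_def FP_iff is_preord_iff)

text \<open>The term \<open>w\<close> of arity \<open>X\<close>: a variable \<open>e x\<close> or one of the constants \<open>z\<close>, \<open>t\<close>.\<close>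

definition opn :: "'a preord \<Rightarrow> 'a \<Rightarrow> 'a pmap" where
  "opn X w = pmap (bd one) (lift (\<lambda>_. w) z t) (bd X)"

lemma opn:
  assumes X: "X \<in> FP" and w: "w \<in> Car (bd X)"
  shows "opn X w \<in> hom T (bd X) (bd one)" "Fn (opn X w) (e z) = w" "Fn (opn X w) z = z" "Fn (opn X w) t = t"
proof -
  have Xp: "is_preord X" using X by (simp add: FP_iff)
  have "opn X w \<in> hom ORD (bd one) (bd X)"
    unfolding opn_def
  proof (rule pmap_hom)
    show "lift (\<lambda>_. w) z t y \<in> Car (bd X)" if "y \<in> Car (bd one)" for y
      by (rule lift_Car[OF bounded_bd[OF Xp] w that])
    show "(lift (\<lambda>_. w) z t a, lift (\<lambda>_. w) z t b) \<in> Rel (bd X)" if "(a, b) \<in> Rel (bd one)" for a b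
      by (rule lift_Rel[OF one_emp(3) bounded_bd[OF Xp] w _ that]) (use preord_refl[OF is_preord_bd[OF Xp] w] in simp)
  qed (use is_preord_bd Xp in simp_all)
  moreover show "Fn (opn X w) (e z) = w" "Fn (opn X w) z = z" "Fn (opn X w) t = t"
    by (simp_all add: opn_def)
  ultimately show "opn X w \<in> hom T (bd X) (bd one)" using X by (simp add: hom_T)
qed

lemma bd_one_cases:
  assumes "y \<in> Car (bd one)" "y = z \<Longrightarrow> Q" "y = t \<Longrightarrow> Q" "y = e z \<Longrightarrow> Q"
  shows Q
  using assms by (elim bd_cases) auto

text \<open>As \<open>bd one\<close> is free on \<open>e z\<close>, a morphism to it in
  \<open>T\<close> is determined by the image of \<open>e z\<close>. Hence the operations of arity
  \<open>X\<close> are exactly the variables and the two constants.\<close>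

lemma opn_unique:
  assumes X: "X \<in> FP" and f: "f \<in> hom T (bd X) (bd one)"
  shows "f = opn X (Fn f (e z))"
proof -
  note fh = hom_TD[OF f]
  have w: "Fn f (e z) \<in> Car (bd X)" using hom_ORDD(5)[OF fh(1)] by simp
  show ?thesis
  proof (rule hom_ORD_eqI[OF fh(1) hom_TD(1)[OF opn(1)[OF X w]]])
    show "Fn f y = Fn (opn X (Fn f (e z))) y" if "y \<in> Car (bd one)" for y
      using that opn(2-4)[OF X w] fh(2,3) by (elim bd_one_cases) simp_all
  qed
qed

definition act :: "('a preord, 'a pmap, 'a) alg \<Rightarrow> 'a pmap \<Rightarrow> 'a \<Rightarrow> 'a" where
  "act A f p = Fn (FArr A f) p"

abbreviation carrier :: "('a preord, 'a pmap, 'a) alg \<Rightarrow> 'a preord" where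
  "carrier A \<equiv> FObj A (bd one)"

text \<open>The object \<open>bd emp\<close> is the power by the empty preorder, so an algebra sends
  it to a one-element preorder. Its element is the argument to which nullary operations are
  applied.\<close>

definition point :: "('a preord, 'a pmap, 'a) alg \<Rightarrow> 'a" where
  "point A = (SOME p. p \<in> Car (FObj A (bd emp)))"

definition cst :: "('a preord, 'a pmap, 'a) alg \<Rightarrow> 'a \<Rightarrow> 'a" where
  "cst A w = act A (opn emp w) (point A)"

context
  fixes A :: "('a preord, 'a pmap, 'a) alg"
  assumes A: "is_algebra T A"
begin

lemma A_functor: "ord_functor T ORD A"
  by (rule algebra_functor[OF A])

lemma A_preord: "N \<in> bd ` FP \<Longrightarrow> is_preord (FObj A N)"
  using ord_functorD(1)[OF A_functor, of N] by simp

lemma act_Car: "f \<in> hom T N M \<Longrightarrow> p \<in> Car (FObj A N) \<Longrightarrow> act A f p \<in> Car (FObj A M)"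
  unfolding act_def by (rule hom_ORDD(5)[OF algebra_arr[OF A]])

lemma act_Comp:
  assumes f: "f \<in> hom T N M" and g: "g \<in> hom T M K" and p: "p \<in> Car (FObj A N)"
  shows "act A (Comp ORD f g) p = act A g (act A f p)"
  using ord_functorD(4)[OF A_functor f g] hom_ORDD(1)[OF algebra_arr[OF A f]] p by (simp add: act_def)

lemma act_Idt: "N \<in> bd ` FP \<Longrightarrow> p \<in> Car (FObj A N) \<Longrightarrow> act A (Idt ORD N) p = p"
  using ord_functorD(3)[OF A_functor, of N] by (simp add: act_def)

lemma act_Le:
  assumes f: "f \<in> hom T N M" and g: "g \<in> hom T N M" and le: "Le ORD f g" and p: "p \<in> Car (FObj A N)"
  shows "(act A f p, act A g p) \<in> Rel (FObj A M)"
  using ord_functorD(5)[OF A_functor f g] le p hom_ORDD(1,2)[OF algebra_arr[OF A f]] by (simp add: act_def Le_ORD)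

text \<open>Since \<open>X\<close> is the product of \<open>X\<close> and \<open>one\<close> via
  \<open>fst\<close>, the object \<open>bd X\<close> is the power of \<open>bd one\<close> by
  \<open>X\<close>, with the variables \<open>opn X (e x)\<close> as cone. The algebra preserves it,
  and powers of preorders are described by their elements.\<close>

lemma coordinates_iso:
  assumes X: "X \<in> FP"
  shows "preord_iso (FObj A (bd X)) (mono_preord X (carrier A)) (\<lambda>p. \<lambda>x\<in>Car X. act A (opn X (e x)) p)"
proof -
  have Xp: "is_preord X" using X by (simp add: FP_iff)
  have f: "preord_iso (prod_preord X one) X fst"
    by (rule preord_isoI) (auto simp: prod_preord_def one_def inj_on_def)
  have eq: "bdm (pairing_map one fst X x) = opn X (e x)" if x: "x \<in> Car X" for x
  proof -
    note k = pm(1)[OF X one_emp(1) X f x]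
    have "bdm (pairing_map one fst X x) \<in> hom T (bd X) (bd one)" by (rule bdm_hom_T[OF X one_emp(1) k])
    moreover have "Fn (bdm (pairing_map one fst X x)) (e z) = e x"
      using bdm_hom(4)[OF k] pm(2)[OF X one_emp(1) X f] by simp
    ultimately show ?thesis using opn_unique[OF X] by metis
  qed
  have "is_power T X (bd one) (bd X) (\<lambda>x\<in>Car X. bdm (pairing_map one fst X x))"
    by (rule power_T[OF X one_emp(1) X f])
  then have "is_power ORD X (carrier A) (FObj A (bd X)) (\<lambda>x\<in>Car X. FArr A ((\<lambda>x\<in>Car X. bdm (pairing_map one fst X x)) x))"
    using A X unfolding is_algebra_def preserves_powers_def op_JJ_simps by blast
  from power_ORD_elements[OF Xp this] show ?thesis
    by (rule preord_iso_cong) (auto simp: evaluation_def act_def eq intro!: restrict_ext)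
qed

lemma coordinates_eqI:
  assumes X: "X \<in> FP" and pq: "p \<in> Car (FObj A (bd X))" "q \<in> Car (FObj A (bd X))"
    and eq: "\<And>x. x \<in> Car X \<Longrightarrow> act A (opn X (e x)) p = act A (opn X (e x)) q"
  shows "p = q"
proof -
  have "(\<lambda>x\<in>Car X. act A (opn X (e x)) p) = (\<lambda>x\<in>Car X. act A (opn X (e x)) q)" using eq by (intro restrict_ext)
  then show ?thesis using inj_onD[OF preord_isoD(1)[OF coordinates_iso[OF X]]] pq by blast
qed

lemma coordinates_Rel:
  assumes X: "X \<in> FP" and pq: "p \<in> Car (FObj A (bd X))" "q \<in> Car (FObj A (bd X))"
    and le: "\<And>x. x \<in> Car X \<Longrightarrow> (act A (opn X (e x)) p, act A (opn X (e x)) q) \<in> Rel (carrier A)"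
  shows "(p, q) \<in> Rel (FObj A (bd X))"
  using preord_isoD(4)[OF coordinates_iso[OF X] pq] preord_isoD(3)[OF coordinates_iso[OF X] pq(1)]
    preord_isoD(3)[OF coordinates_iso[OF X] pq(2)] le by simp

lemma coordinates_ex:
  assumes X: "X \<in> FP" and k: "\<And>x. x \<in> Car X \<Longrightarrow> k x \<in> Car (carrier A)"
    "\<And>x y. (x, y) \<in> Rel X \<Longrightarrow> (k x, k y) \<in> Rel (carrier A)"
  shows "\<exists>p\<in>Car (FObj A (bd X)). \<forall>x\<in>Car X. act A (opn X (e x)) p = k x"
proof -
  have Xp: "is_preord X" using X by (simp add: FP_iff)
  have "restrict k (Car X) \<in> mono_maps X (carrier A)"
    by (rule mono_mapsI) (use k preord_RelD[OF Xp] in auto)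
  then have "restrict k (Car X) \<in> (\<lambda>p. \<lambda>x\<in>Car X. act A (opn X (e x)) p) ` Car (FObj A (bd X))"
    unfolding preord_isoD(2)[OF coordinates_iso[OF X]] by simp
  then obtain p where "restrict k (Car X) = (\<lambda>x\<in>Car X. act A (opn X (e x)) p)" and p: "p \<in> Car (FObj A (bd X))"
    by (rule imageE)
  then have "act A (opn X (e x)) p = k x" if "x \<in> Car X" for x using that by (metis restrict_apply')
  then show ?thesis using p by blast
qed

lemma point: "point A \<in> Car (FObj A (bd emp))" "p \<in> Car (FObj A (bd emp)) \<Longrightarrow> p = point A"
proof -
  have "\<exists>p. p \<in> Car (FObj A (bd emp))" using coordinates_ex[OF one_emp(2), of "\<lambda>_. undefined"] by (auto simp: emp_def)
  then show 1: "point A \<in> Car (FObj A (bd emp))" unfolding point_def by (rule someI_ex)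
  show "p = point A" if "p \<in> Car (FObj A (bd emp))" by (rule coordinates_eqI[OF one_emp(2) that 1]) simp
qed

text \<open>A constant of arity \<open>X\<close> factors through \<open>bd emp\<close> along the
  inclusion \<open>?b\<close> of the bounds into \<open>bd X\<close>. The action of
  \<open>?b\<close> sends every \<open>p\<close> to the only element available, so the result does
  not depend on \<open>X\<close> or \<open>p\<close>.\<close>

lemma act_constant:
  assumes X: "X \<in> FP" and p: "p \<in> Car (FObj A (bd X))" and w: "w = z \<or> w = t"
  shows "act A (opn X w) p = cst A w"
proof -
  let ?b = "pmap (bd emp) (\<lambda>y. y) (bd X)"
  have Xp: "is_preord X" using X by (simp add: FP_iff)
  have b: "?b \<in> hom T (bd X) (bd emp)"
  proof -
    have "?b \<in> hom ORD (bd emp) (bd X)"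
      by (rule pmap_hom) (use is_preord_bd[OF Xp] is_preord_bd[OF one_emp(4)] in \<open>auto simp: bd_Car bd_Rel emp_def\<close>)
    then show ?thesis using X by (simp add: hom_T)
  qed
  have w': "w \<in> Car (bd Y)" for Y using w by auto
  have "opn X w = Comp ORD ?b (opn emp w)"
  proof (rule hom_ORD_eqI[OF hom_TD(1)[OF opn(1)[OF X w']] Comp_ORD_hom[OF hom_TD(1)[OF opn(1)[OF one_emp(2) w']] hom_TD(1)[OF b]]])
    show "Fn (opn X w) y = Fn (Comp ORD ?b (opn emp w)) y" if "y \<in> Car (bd one)" for y
      using that opn(2-4)[OF X w'] opn(2-4)[OF one_emp(2) w'] hom_ORDD(1)[OF hom_TD(1)[OF opn(1)[OF one_emp(2) w']]] w'
      by (elim bd_one_cases) simp_all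
  qed
  then show ?thesis
    using act_Comp[OF b opn(1)[OF one_emp(2) w'] p] point(2)[OF act_Car[OF b p]] by (simp add: cst_def)
qed

lemma opn_one: "opn one (e z) = Idt ORD (bd one)"
proof -
  have "Idt ORD (bd one) \<in> hom T (bd one) (bd one)"
    using Idt_ORD_hom[OF is_preord_bd[OF one_emp(3)]] by (simp add: hom_T)
  from opn_unique[OF one_emp(1) this] show ?thesis by simp
qed

text \<open>The inequations of the variety are inequalities between operations: in \<open>T\<close>
  the identity \<open>opn one (e z)\<close> lies between the constants \<open>opn one z\<close> and
  \<open>opn one t\<close>, and an algebra is monotone on hom-sets.\<close>

lemma carrier_bounded: "bounded_preord (carrier A) (cst A z) (cst A t)"
proof -
  have c: "cst A z \<in> Car (carrier A)" "cst A t \<in> Car (carrier A)"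
    unfolding cst_def using act_Car[OF opn(1)[OF one_emp(2)] point(1)] by simp_all
  have le: "Le ORD (opn one z) (opn one (e z))" "Le ORD (opn one (e z)) (opn one t)"
  proof -
    have S: "Src (opn one w) = bd one" "Tgt (opn one w) = bd one" for w by (simp_all add: opn_def)
    have "(Fn (opn one z) y, Fn (opn one (e z)) y) \<in> Rel (bd one) \<and> (Fn (opn one (e z)) y, Fn (opn one t) y) \<in> Rel (bd one)"
      if "y \<in> Car (bd one)" for y
      using that opn(2-4)[OF one_emp(1), of z] opn(2-4)[OF one_emp(1), of t] opn(2-4)[OF one_emp(1), of "e z"]
      by (elim bd_one_cases) (auto simp: bd_Rel)
    then show "Le ORD (opn one z) (opn one (e z))" "Le ORD (opn one (e z)) (opn one t)" by (auto simp: Le_ORD S)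
  qed
  have "(cst A z, p) \<in> Rel (carrier A) \<and> (p, cst A t) \<in> Rel (carrier A)" if p: "p \<in> Car (carrier A)" for p
  proof -
    have "act A (opn one (e z)) p = p" unfolding opn_one by (rule act_Idt) (use p in auto)
    moreover have "act A (opn one z) p = cst A z" "act A (opn one t) p = cst A t"
      by (rule act_constant[OF one_emp(1) p]; simp)+
    ultimately show ?thesis
      using act_Le[OF opn(1)[OF one_emp(1)] opn(1)[OF one_emp(1)] le(1) p]
        act_Le[OF opn(1)[OF one_emp(1)] opn(1)[OF one_emp(1)] le(2) p] by simp
  qed
  then show ?thesis unfolding bounded_preord_def using c A_preord[of "bd one"] by simp
qed

end

lemma alg_hom_act:
  assumes \<alpha>: "\<alpha> \<in> hom (Alg T) A B" and f: "f \<in> hom T N M" and p: "p \<in> Car (FObj A N)"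
  shows "Fn (Fn \<alpha> M) (act A f p) = act B f (Fn (Fn \<alpha> N) p)"
proof -
  have "N \<in> Obj T" using hom_TD(4)[OF f] by simp
  note c = hom_ORDD(1)[OF hom_AlgD(5)[OF \<alpha> this]] hom_ORDD(1)[OF algebra_arr[OF hom_AlgD(3)[OF \<alpha>] f]]
  have "Fn (Comp ORD (Fn \<alpha> M) (FArr A f)) p = Fn (Comp ORD (FArr B f) (Fn \<alpha> N)) p"
    using hom_AlgD(7)[OF \<alpha> f] by simp
  then show ?thesis using p c by (simp add: act_def)
qed

lemma alg_hom_component:
  assumes \<alpha>: "\<alpha> \<in> hom (Alg T) A B" and N: "N \<in> bd ` FP"
  shows "Fn \<alpha> N \<in> hom ORD (FObj A N) (FObj B N)"
  using hom_AlgD(5)[OF \<alpha>] N by simp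

lemma alg_hom_cst:
  assumes \<alpha>: "\<alpha> \<in> hom (Alg T) A B" and w: "w = z \<or> w = t"
  shows "Fn (Fn \<alpha> (bd one)) (cst A w) = cst B w"
proof -
  note AB = hom_AlgD(3)[OF \<alpha>] hom_AlgD(4)[OF \<alpha>]
  have w': "w \<in> Car (bd emp)" using w by auto
  have "Fn (Fn \<alpha> (bd emp)) (point A) = point B"
    by (rule point(2)[OF AB(2)]) (rule hom_ORDD(5)[OF alg_hom_component[OF \<alpha>] point(1)[OF AB(1)]], simp)
  then show ?thesis
    using alg_hom_act[OF \<alpha> opn(1)[OF one_emp(2) w'] point(1)[OF AB(1)]] by (simp add: cst_def)
qed

text \<open>Naturality at the variables \<open>opn X (e x)\<close> expresses the component at
  \<open>bd X\<close> coordinatewise through the one at \<open>bd one\<close>, and the order of the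
  power is the coordinatewise one.\<close>

lemma alg_hom_le:
  assumes \<alpha>: "\<alpha> \<in> hom (Alg T) A B" and \<beta>: "\<beta> \<in> hom (Alg T) A B"
    and le: "\<And>p. p \<in> Car (carrier A) \<Longrightarrow> (Fn (Fn \<alpha> (bd one)) p, Fn (Fn \<beta> (bd one)) p) \<in> Rel (carrier B)"
  shows "Le (Alg T) \<alpha> \<beta>"
proof -
  have "(Fn (Fn \<alpha> N) p, Fn (Fn \<beta> N) p) \<in> Rel (FObj B N)" if N: "N \<in> bd ` FP" and p: "p \<in> Car (FObj A N)" for N p
  proof -
    obtain X where X: "X \<in> FP" "N = bd X" using N by blast
    have "(Fn (Fn \<alpha> (bd X)) p, Fn (Fn \<beta> (bd X)) p) \<in> Rel (FObj B (bd X))"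
    proof (rule coordinates_Rel[OF hom_AlgD(4)[OF \<alpha>] X(1)])
      show "Fn (Fn \<alpha> (bd X)) p \<in> Car (FObj B (bd X))" "Fn (Fn \<beta> (bd X)) p \<in> Car (FObj B (bd X))"
        using hom_ORDD(5)[OF alg_hom_component[OF \<alpha> N] p] hom_ORDD(5)[OF alg_hom_component[OF \<beta> N] p] X by simp_all
      fix x assume "x \<in> Car X"
      then have o: "opn X (e x) \<in> hom T (bd X) (bd one)" using opn(1)[OF X(1)] by simp
      have p': "p \<in> Car (FObj A (bd X))" using p X by simp
      show "(act B (opn X (e x)) (Fn (Fn \<alpha> (bd X)) p), act B (opn X (e x)) (Fn (Fn \<beta> (bd X)) p)) \<in> Rel (carrier B)"
        using alg_hom_act[OF \<alpha> o p'] alg_hom_act[OF \<beta> o p'] le[OF act_Car[OF hom_AlgD(3)[OF \<alpha>] o p']] by simp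
    qed
    then show ?thesis using X by simp
  qed
  then show ?thesis using hom_ORDD(1,2)[OF alg_hom_component[OF \<alpha>]] by (simp add: Le_ORD)
qed

lemma alg_hom_eqI:
  assumes \<alpha>: "\<alpha> \<in> hom (Alg T) A B" and \<beta>: "\<beta> \<in> hom (Alg T) A B"
    and eq: "\<And>p. p \<in> Car (carrier A) \<Longrightarrow> Fn (Fn \<alpha> (bd one)) p = Fn (Fn \<beta> (bd one)) p"
  shows "\<alpha> = \<beta>"
proof (rule hom_Alg_eqI[OF \<alpha> \<beta>])
  fix N assume "N \<in> Obj T"
  then obtain X where X: "X \<in> FP" "N = bd X" by auto
  have N: "bd X \<in> bd ` FP" using X by blast
  have "Fn \<alpha> (bd X) = Fn \<beta> (bd X)"
  proof (rule hom_ORD_eqI[OF alg_hom_component[OF \<alpha> N] alg_hom_component[OF \<beta> N]])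
    fix p assume p: "p \<in> Car (FObj A (bd X))"
    show "Fn (Fn \<alpha> (bd X)) p = Fn (Fn \<beta> (bd X)) p"
    proof (rule coordinates_eqI[OF hom_AlgD(4)[OF \<alpha>] X(1)])
      show "Fn (Fn \<alpha> (bd X)) p \<in> Car (FObj B (bd X))" "Fn (Fn \<beta> (bd X)) p \<in> Car (FObj B (bd X))"
        by (rule hom_ORDD(5)[OF alg_hom_component[OF \<alpha> N] p], rule hom_ORDD(5)[OF alg_hom_component[OF \<beta> N] p])
      fix x assume "x \<in> Car X"
      then have o: "opn X (e x) \<in> hom T (bd X) (bd one)" using opn(1)[OF X(1)] by simp
      show "act B (opn X (e x)) (Fn (Fn \<alpha> (bd X)) p) = act B (opn X (e x)) (Fn (Fn \<beta> (bd X)) p)"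
        using alg_hom_act[OF \<alpha> o p] alg_hom_act[OF \<beta> o p] eq[OF act_Car[OF hom_AlgD(3)[OF \<alpha>] o p]] by simp
    qed
  qed
  then show "Fn \<alpha> N = Fn \<beta> N" using X by simp
qed

text \<open>The map is applied to each coordinate. Naturality holds because each coordinate of a
  morphism of \<open>T\<close> is an operation, hence a variable or a constant, and \<open>m\<close>
  is compatible with both kinds.\<close>

lemma alg_hom_extension:
  assumes A: "is_algebra T A" and B: "is_algebra T B" and m: "m \<in> mono_maps (carrier A) (carrier B)"
    and mz: "m (cst A z) = cst B z" and mt: "m (cst A t) = cst B t"
  shows "\<exists>\<alpha>\<in>hom (Alg T) A B. \<forall>p\<in>Car (carrier A). Fn (Fn \<alpha> (bd one)) p = m p"
proof -
  have o: "opn X (e x) \<in> hom T (bd X) (bd one)" if "X \<in> FP" "x \<in> Car X" for X x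
    using opn(1) that by simp
  have "\<exists>q. q \<in> Car (FObj B (bd X)) \<and> (\<forall>x\<in>Car X. act B (opn X (e x)) q = m (act A (opn X (e x)) p))"
    if X: "X \<in> FP" and p: "p \<in> Car (FObj A (bd X))" for X p
  proof -
    have c: "(\<lambda>x\<in>Car X. act A (opn X (e x)) p) \<in> mono_maps X (carrier A)"
      using preord_isoD(3)[OF coordinates_iso[OF A X] p] by simp
    have Xp: "is_preord X" using X by (simp add: FP_iff)
    have "\<exists>q\<in>Car (FObj B (bd X)). \<forall>x\<in>Car X. act B (opn X (e x)) q = m (act A (opn X (e x)) p)"
    proof (rule coordinates_ex[OF B X])
      show "m (act A (opn X (e x)) p) \<in> Car (carrier B)" if "x \<in> Car X" for x
        by (rule mono_mapsD(1)[OF m act_Car[OF A o[OF X that] p]])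
      show "(m (act A (opn X (e x)) p), m (act A (opn X (e y)) p)) \<in> Rel (carrier B)" if "(x, y) \<in> Rel X" for x y
        using mono_mapsD(3)[OF m mono_mapsD(3)[OF c that]] preord_RelD[OF Xp that] by simp
    qed
    then show ?thesis by blast
  qed
  \<comment> \<open>\<open>E X\<close> applies \<open>m\<close> to every coordinate; monotonicity of
    \<open>m\<close> ensures that the resulting family again belongs to the power by
    \<open>X\<close>.\<close>
  then obtain E where EC: "\<And>X p. X \<in> FP \<Longrightarrow> p \<in> Car (FObj A (bd X)) \<Longrightarrow> E X p \<in> Car (FObj B (bd X))"
    and E: "\<And>X p x. X \<in> FP \<Longrightarrow> p \<in> Car (FObj A (bd X)) \<Longrightarrow> x \<in> Car X \<Longrightarrow>
      act B (opn X (e x)) (E X p) = m (act A (opn X (e x)) p)"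
    by metis
  define \<phi> where "\<phi> = (\<lambda>N\<in>bd ` FP. pmap (FObj A N) (E (inv bd N)) (FObj B N))"
  have bd: "inv bd (bd X) = X" for X using inv_f_f[of bd X] bd_inj by (auto simp: inj_def)
  have \<phi>: "\<phi> (bd X) = pmap (FObj A (bd X)) (E X) (FObj B (bd X))" if "X \<in> FP" for X
    using that bd by (simp add: \<phi>_def)
  have \<phi>h: "\<phi> (bd X) \<in> hom ORD (FObj A (bd X)) (FObj B (bd X))" if X: "X \<in> FP" for X
    unfolding \<phi>[OF X]
  proof (rule pmap_hom[OF A_preord[OF A] A_preord[OF B] EC[OF X]])
    fix p q assume pq: "(p, q) \<in> Rel (FObj A (bd X))"
    have N: "bd X \<in> bd ` FP" using X by blast
    have c: "p \<in> Car (FObj A (bd X))" "q \<in> Car (FObj A (bd X))" using preord_RelD[OF A_preord[OF A N] pq] by auto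
    show "(E X p, E X q) \<in> Rel (FObj B (bd X))"
    proof (rule coordinates_Rel[OF B X EC[OF X c(1)] EC[OF X c(2)]])
      fix x assume x: "x \<in> Car X"
      have "(act A (opn X (e x)) p, act A (opn X (e x)) q) \<in> Rel (carrier A)"
        using hom_ORDD(6)[OF algebra_arr[OF A o[OF X x]] pq] by (simp add: act_def)
      then show "(act B (opn X (e x)) (E X p), act B (opn X (e x)) (E X q)) \<in> Rel (carrier B)"
        using E[OF X c(1) x] E[OF X c(2) x] mono_mapsD(3)[OF m] by simp
    qed
  qed (use X in simp_all)
  \<comment> \<open>For variables this defines \<open>E\<close>; for the two constants it is
    preservation of the bounds by \<open>m\<close>.\<close>
  have Eopn: "act B (opn X w) (E X p) = m (act A (opn X w) p)"
    if X: "X \<in> FP" and p: "p \<in> Car (FObj A (bd X))" and w: "w \<in> Car (bd X)" for X p w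
    using w
  proof (rule bd_cases)
    show "act B (opn X w) (E X p) = m (act A (opn X w) p)" if "w = z"
      using act_constant[OF A X p, of w] act_constant[OF B X EC[OF X p], of w] that mz by simp
    show "act B (opn X w) (E X p) = m (act A (opn X w) p)" if "w = t"
      using act_constant[OF A X p, of w] act_constant[OF B X EC[OF X p], of w] that mt by simp
  qed (use E[OF X p] in simp)
  have nat: "E Y (act A f p) = act B f (E X p)"
    if X: "X \<in> FP" and Y: "Y \<in> FP" and f: "f \<in> hom T (bd X) (bd Y)" and p: "p \<in> Car (FObj A (bd X))" for X Y f p
  proof (rule coordinates_eqI[OF B Y EC[OF Y act_Car[OF A f p]] act_Car[OF B f EC[OF X p]]])
    fix y assume y: "y \<in> Car Y"
    interpret ord_category T by (rule ord_category_T)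
    have h: "Comp ORD f (opn Y (e y)) \<in> hom T (bd X) (bd one)" using comp_hom[OF f o[OF Y y]] by simp
    \<comment> \<open>The coordinate \<open>y\<close> of \<open>f\<close> is an operation of arity
      \<open>X\<close>; \<open>w\<close> is the term it stands for, so \<open>Eopn\<close> settles
      this coordinate.\<close>
    define w where "w = Fn (Comp ORD f (opn Y (e y))) (e z)"
    have eq: "Comp ORD f (opn Y (e y)) = opn X w" unfolding w_def by (rule opn_unique[OF X h])
    have w: "w \<in> Car (bd X)" unfolding w_def using hom_ORDD(5)[OF hom_TD(1)[OF h]] by simp
    show "act B (opn Y (e y)) (E Y (act A f p)) = act B (opn Y (e y)) (act B f (E X p))"
      using act_Comp[OF A f o[OF Y y] p] act_Comp[OF B f o[OF Y y] EC[OF X p]] E[OF Y act_Car[OF A f p] y]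
        Eopn[OF X p w] eq by simp
  qed
  have "\<lparr>Src = A, Fn = \<phi>, Tgt = B\<rparr> \<in> hom (Alg T) A B"
  proof (rule hom_AlgI[OF A B])
    show "\<phi> N \<in> hom ORD (FObj A N) (FObj B N)" if "N \<in> Obj T" for N using that \<phi>h by auto
    show "\<phi> \<in> extensional (Obj T)" by (simp add: \<phi>_def)
    fix f N M assume f: "f \<in> hom T N M"
    obtain X Y where X: "X \<in> FP" "N = bd X" and Y: "Y \<in> FP" "M = bd Y" using hom_TD(4,5)[OF f] by blast
    note f' = f[unfolded X Y]
    note af = algebra_arr[OF A f'] algebra_arr[OF B f']
    show "Comp ORD (\<phi> M) (FArr A f) = Comp ORD (FArr B f) (\<phi> N)"
      unfolding X Y
    proof (rule hom_ORD_eqI[OF Comp_ORD_hom[OF af(1) \<phi>h[OF Y(1)]] Comp_ORD_hom[OF \<phi>h[OF X(1)] af(2)]])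
      fix p assume p: "p \<in> Car (FObj A (bd X))"
      show "Fn (Comp ORD (\<phi> (bd Y)) (FArr A f)) p = Fn (Comp ORD (FArr B f) (\<phi> (bd X))) p"
        using nat[OF X(1) Y(1) f' p] p hom_ORDD(1)[OF af(1)] hom_ORDD(5)[OF af(1) p] \<phi>[OF X(1)] \<phi>[OF Y(1)]
        by (simp add: act_def)
    qed
  qed
  moreover have "Fn (\<phi> (bd one)) p = m p" if p: "p \<in> Car (carrier A)" for p
  proof -
    have "act B (opn one (e z)) (E one p) = m (act A (opn one (e z)) p)" by (rule E) (use p in simp_all)
    moreover have "act A (opn one (e z)) p = p" unfolding opn_one[OF A] by (rule act_Idt[OF A _ p]) simp
    moreover have "act B (opn one (e z)) (E one p) = E one p"
      unfolding opn_one[OF A] by (rule act_Idt[OF B]) (use EC[of one p] p in simp_all)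
    ultimately show ?thesis using \<phi>[of one] p by simp
  qed
  ultimately show ?thesis by (intro bexI) auto
qed

section \<open>The algebra of a bounded preordered set\<close>

definition code :: "'a preord \<Rightarrow> ('a \<Rightarrow> 'a) \<Rightarrow> 'a" where
  "code N = (SOME c. inj_on c (extensional (Car N)))"

lemma inj_code:
  assumes "N \<in> bd ` FP"
  shows "inj_on (code N) (extensional (Car N))"
proof -
  have "\<exists>c :: ('a \<Rightarrow> 'a) \<Rightarrow> 'a. inj_on c (extensional (Car N))"
    using bd_FP[OF assms] by (intro finite_family_injection infinite_universe) simp
  then show ?thesis unfolding code_def by (rule someI_ex)
qed

context
  fixes M :: "'a preord" and b0 b1 :: 'a
  assumes M: "bounded_preord M b0 b1"
begin

text \<open>Bounded maps on \<open>bd X\<close> are the monotone maps on \<open>X\<close>, so \<open>maps (bd X)\<close> is the power of \<open>M\<close>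
  by \<open>X\<close>; \<open>code\<close> moves it into the universe.\<close>

definition maps :: "'a preord \<Rightarrow> ('a \<Rightarrow> 'a) preord" where
  "maps N = bmaps N z t M b0 b1"

definition Mo :: "'a preord \<Rightarrow> 'a preord" where
  "Mo N = image_preord (code N) (maps N)"

text \<open>Decode, precompose with \<open>f\<close>, code again. A morphism of \<open>T\<close>
  from \<open>N\<close> to \<open>K\<close> is a bounded map from \<open>K\<close> to
  \<open>N\<close>, which is why its target indexes the source of the result.\<close>

definition precomp :: "'a pmap \<Rightarrow> 'a pmap" where
  "precomp f = pmap (Mo (Tgt f))
     (\<lambda>p. code (Src f) (compose (Car (Src f)) (the_inv_into (Car (maps (Tgt f))) (code (Tgt f)) p) (Fn f))) (Mo (Src f))"

text \<open>The contravariant hom functor into \<open>M\<close>, restricted to the finite free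
  bounded preorders; it is covariant on \<open>T\<close>, their opposite.\<close>

definition model :: "('a preord, 'a pmap, 'a) alg" where
  "model = \<lparr>FObj = (\<lambda>N\<in>bd ` FP. Mo N), FArr = (\<lambda>f\<in>Arr T. precomp f)\<rparr>"

lemma M_preord: "is_preord M"
  using M by (simp add: bounded_preord_def)

lemma inj_code_maps: "N \<in> bd ` FP \<Longrightarrow> inj_on (code N) (Car (maps N))"
  by (rule inj_on_subset[OF inj_code]) (auto simp: maps_def dest: mono_mapsD(2))

lemma Mo_iso: "N \<in> bd ` FP \<Longrightarrow> preord_iso (maps N) (Mo N) (code N)"
  unfolding Mo_def using inj_code_maps is_preord_bmaps[OF M_preord] by (intro preord_iso_image) (simp_all add: maps_def)

lemma Mo_preord: "N \<in> bd ` FP \<Longrightarrow> is_preord (Mo N)"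
  unfolding Mo_def using inj_code_maps is_preord_bmaps[OF M_preord] by (intro is_preord_image) (simp_all add: maps_def)

lemma Mo_cases:
  assumes "N \<in> bd ` FP" "p \<in> Car (Mo N)"
  obtains m where "m \<in> Car (maps N)" "p = code N m"
  using assms preord_isoD(2)[OF Mo_iso[OF assms(1)]] by auto

lemma code_Car: "N \<in> bd ` FP \<Longrightarrow> m \<in> Car (maps N) \<Longrightarrow> code N m \<in> Car (Mo N)"
  by (rule preord_isoD(3)[OF Mo_iso])

lemma compose_maps:
  assumes f: "f \<in> hom T N K" and m: "m \<in> Car (maps N)"
  shows "compose (Car K) m (Fn f) \<in> Car (maps K)"
proof -
  note fh = hom_TD[OF f]
  have m': "m \<in> mono_maps N M" "m z = b0" "m t = b1" using m by (simp_all add: maps_def)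
  have K: "is_preord K" "z \<in> Car K" "t \<in> Car K" using bd_FP[OF fh(5)] by auto
  have "compose (Car K) m (Fn f) \<in> mono_maps K M"
  proof (rule mono_mapsI)
    fix x y assume xy: "(x, y) \<in> Rel K"
    then show "(compose (Car K) m (Fn f) x, compose (Car K) m (Fn f) y) \<in> Rel M"
      using preord_RelD[OF K(1) xy] mono_mapsD(3)[OF m'(1) hom_ORDD(6)[OF fh(1) xy]] by (simp add: compose_def)
  qed (use mono_mapsD(1)[OF m'(1) hom_ORDD(5)[OF fh(1)]] in \<open>simp_all add: compose_def\<close>)
  then show ?thesis using K m' fh by (simp add: maps_def compose_def)
qed

lemma precomp_code:
  assumes f: "f \<in> hom T N K" and m: "m \<in> Car (maps N)"
  shows "Fn (precomp f) (code N m) = code K (compose (Car K) m (Fn f))"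
  using the_inv_into_f_f[OF inj_code_maps[OF hom_TD(4)[OF f]] m] code_Car[OF hom_TD(4)[OF f] m] hom_ORDD(1,2)[OF hom_TD(1)[OF f]]
  by (simp add: precomp_def)

lemma precomp_hom:
  assumes f: "f \<in> hom T N K"
  shows "precomp f \<in> hom ORD (Mo N) (Mo K)"
proof -
  note N = hom_TD(4)[OF f] and K = hom_TD(5)[OF f]
  have st: "Src f = K" "Tgt f = N" using hom_ORDD(1,2)[OF hom_TD(1)[OF f]] by auto
  define h where "h = (\<lambda>p. code K (compose (Car K) (the_inv_into (Car (maps N)) (code N) p) (Fn f)))"
  have h: "h (code N m) = code K (compose (Car K) m (Fn f))" if "m \<in> Car (maps N)" for m
    using the_inv_into_f_f[OF inj_code_maps[OF N] that] by (simp add: h_def)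
  have "pmap (Mo N) h (Mo K) \<in> hom ORD (Mo N) (Mo K)"
  proof (rule pmap_hom[OF Mo_preord[OF N] Mo_preord[OF K]])
    show "h p \<in> Car (Mo K)" if "p \<in> Car (Mo N)" for p
      by (rule Mo_cases[OF N that]) (use h code_Car[OF K compose_maps[OF f]] in simp)
    fix p q assume pq: "(p, q) \<in> Rel (Mo N)"
    then have c: "p \<in> Car (Mo N)" "q \<in> Car (Mo N)" using preord_RelD[OF Mo_preord[OF N]] by auto
    obtain m where m: "m \<in> Car (maps N)" "p = code N m" by (rule Mo_cases[OF N c(1)])
    obtain n where n: "n \<in> Car (maps N)" "q = code N n" by (rule Mo_cases[OF N c(2)])
    have mn: "(m, n) \<in> Rel (maps N)" using preord_isoD(4)[OF Mo_iso[OF N] m(1) n(1)] pq m n by simp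
    have "(compose (Car K) m (Fn f), compose (Car K) n (Fn f)) \<in> Rel (maps K)"
      using compose_maps[OF f m(1)] compose_maps[OF f n(1)] mn hom_ORDD(5)[OF hom_TD(1)[OF f]]
      unfolding maps_def bmaps_simps(2) by (simp add: compose_def)
    then show "(h p, h q) \<in> Rel (Mo K)"
      using preord_isoD(4)[OF Mo_iso[OF K] compose_maps[OF f m(1)] compose_maps[OF f n(1)]] h m n by simp
  qed
  then show ?thesis unfolding precomp_def st h_def .
qed

lemma model_functor: "ord_functor T ORD model"
proof -
  interpret T: ord_category T by (rule ord_category_T)
  have h: "f \<in> hom T (Tgt f) (Src f)" if "f \<in> Arr T" for f using that Arr_T_iff by blast
  have ob: "Src f \<in> bd ` FP" "Tgt f \<in> bd ` FP" if "f \<in> Arr T" for f using hom_TD(4,5)[OF h[OF that]] by auto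
  have O: "FObj model N = Mo N" if "N \<in> bd ` FP" for N using that by (simp add: model_def)
  have F: "FArr model f = precomp f" if "f \<in> Arr T" for f using that by (simp add: model_def)
  have ArrI: "f \<in> Arr T" if "f \<in> hom T N K" for f N K using that by (simp add: hom_def)
  show ?thesis
    unfolding ord_functor_def
  proof (intro conjI ballI impI)
    show "FObj model \<in> Obj T \<rightarrow>\<^sub>E Obj ORD" using Mo_preord by (auto simp: model_def)
    show "FArr model \<in> Arr T \<rightarrow>\<^sub>E Arr ORD" using precomp_hom[OF h] by (auto simp: model_def hom_def)
    show "Dom ORD (FArr model f) = FObj model (Dom T f)" "Cod ORD (FArr model f) = FObj model (Cod T f)"
      if "f \<in> Arr T" for f
      using F[OF that] O[OF ob(1)[OF that]] O[OF ob(2)[OF that]] by (simp_all add: precomp_def)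
    show "FArr model (Idt T N) = Idt ORD (FObj model N)" if "N \<in> Obj T" for N
    proof -
      have N: "N \<in> bd ` FP" using that by simp
      have i: "Idt ORD N \<in> hom T N N" using T.id_hom[OF that] by simp
      have "precomp (Idt ORD N) = Idt ORD (Mo N)"
      proof (rule hom_ORD_eqI[OF precomp_hom[OF i] Idt_ORD_hom[OF Mo_preord[OF N]]])
        fix p assume p: "p \<in> Car (Mo N)"
        obtain m where m: "m \<in> Car (maps N)" "p = code N m" by (rule Mo_cases[OF N p])
        have "compose (Car N) m (Fn (Idt ORD N)) = m"
          by (rule extensionalityI[of _ "Car N"]) (use m in \<open>auto simp: maps_def compose_def dest: mono_mapsD(2)\<close>)
        then show "Fn (precomp (Idt ORD N)) p = Fn (Idt ORD (Mo N)) p"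
          using precomp_code[OF i m(1)] m(2) p by simp
      qed
      then show ?thesis using F[OF ArrI[OF i]] O[OF N] by simp
    qed
    show "FArr model (Comp T g f) = Comp ORD (FArr model g) (FArr model f)"
      if f: "f \<in> Arr T" and g: "g \<in> Arr T" and "Cod T f = Dom T g" for f g
    proof -
      let ?N = "Tgt f" and ?K = "Src f" and ?L = "Src g"
      have fh: "f \<in> hom T ?N ?K" and gh: "g \<in> hom T ?K ?L" using h[OF f] h[OF g] that(3) by simp_all
      have gf: "Comp ORD f g \<in> hom T ?N ?L" using T.comp_hom[OF fh gh] by simp
      have "precomp (Comp ORD f g) = Comp ORD (precomp g) (precomp f)"
      proof (rule hom_ORD_eqI[OF precomp_hom[OF gf] Comp_ORD_hom[OF precomp_hom[OF fh] precomp_hom[OF gh]]])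
        fix p assume p: "p \<in> Car (Mo ?N)"
        obtain m where m: "m \<in> Car (maps ?N)" "p = code ?N m" by (rule Mo_cases[OF ob(2)[OF f] p])
        have "compose (Car ?L) m (Fn (Comp ORD f g)) = compose (Car ?L) (compose (Car ?K) m (Fn f)) (Fn g)"
          by (rule extensionalityI[of _ "Car ?L"]) (use hom_ORDD(5)[OF hom_TD(1)[OF gh]] in \<open>simp_all add: compose_def\<close>)
        then show "Fn (precomp (Comp ORD f g)) p = Fn (Comp ORD (precomp g) (precomp f)) p"
          using precomp_code[OF gf m(1)] precomp_code[OF fh m(1)] precomp_code[OF gh compose_maps[OF fh m(1)]]
            m(2) p hom_ORDD(1)[OF precomp_hom[OF fh]] by simp
      qed
      then show ?thesis using F[OF f] F[OF g] F[OF ArrI[OF gf]] by simp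
    qed
    show "Le ORD (FArr model f) (FArr model g)"
      if f: "f \<in> Arr T" and g: "g \<in> Arr T" and fg: "Dom T f = Dom T g \<and> Cod T f = Cod T g \<and> Le T f g" for f g
    proof -
      let ?N = "Tgt f" and ?K = "Src f"
      have fh: "f \<in> hom T ?N ?K" and gh: "g \<in> hom T ?N ?K" using h[OF f] h[OF g] fg by simp_all
      have "(Fn (precomp f) p, Fn (precomp g) p) \<in> Rel (Mo ?K)" if p: "p \<in> Car (Mo ?N)" for p
      proof -
        obtain m where m: "m \<in> Car (maps ?N)" "p = code ?N m" by (rule Mo_cases[OF ob(2)[OF f] p])
        have mm: "m \<in> mono_maps ?N M" using m by (simp add: maps_def)
        have "(m (Fn f x), m (Fn g x)) \<in> Rel M" if "x \<in> Car ?K" for x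
          by (rule mono_mapsD(3)[OF mm]) (use fg that in \<open>auto simp: Le_ORD\<close>)
        then have "(compose (Car ?K) m (Fn f), compose (Car ?K) m (Fn g)) \<in> Rel (maps ?K)"
          using compose_maps[OF fh m(1)] compose_maps[OF gh m(1)]
          unfolding maps_def bmaps_simps(2) by (simp add: compose_def)
        then show ?thesis
          using preord_isoD(4)[OF Mo_iso[OF ob(1)[OF f]] compose_maps[OF fh m(1)] compose_maps[OF gh m(1)]]
            precomp_code[OF fh m(1)] precomp_code[OF gh m(1)] m(2) by simp
      qed
      then show ?thesis using F[OF f] F[OF g] hom_ORDD(1,2)[OF precomp_hom[OF fh]] by (simp add: Le_ORD)
    qed
  qed
qed

text \<open>Hom functors into \<open>M\<close> turn tensors into powers: for the explicit power this
  is \<open>bmaps_power_iso\<close> conjugated by the codes. All other powers follow by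
  transport.\<close>

lemma model_algebra: "is_algebra T model"
  unfolding is_algebra_def preserves_powers_def op_JJ_simps
proof (intro conjI ballI allI impI model_functor)
  fix X C P :: "'a preord" and \<kappa> assume X: "X \<in> FP" and pw: "is_power T X C P \<kappa>"
  have "C \<in> bd ` FP" using pw unfolding is_power_def by simp
  then obtain c where c: "c \<in> FP" "C = bd c" by blast
  obtain P0 :: "'a preord" and p where P0: "P0 \<in> FP" and p: "preord_iso (prod_preord X c) P0 p"
    using tensor_exists[OF X c(1)] by blast
  let ?b = "\<lambda>x. bdm (pairing_map c p P0 x)"
  have XcP: "is_preord X" "is_preord c" "is_preord P0" using X c P0 by (simp_all add: FP_iff)
  have N: "bd c \<in> bd ` FP" "bd P0 \<in> bd ` FP" using c P0 by auto
  note pw0 = power_T[OF X c(1) P0 p]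
  have b: "?b x \<in> hom T (bd P0) (bd c)" if "x \<in> Car X" for x
    by (rule bdm_hom_T[OF P0 c(1) pm(1)[OF X c(1) P0 p that]])
  have O: "FObj model (bd c) = Mo (bd c)" "FObj model (bd P0) = Mo (bd P0)" using N by (simp_all add: model_def)
  have F: "FArr model (?b x) = precomp (?b x)" if "x \<in> Car X" for x using b[OF that] by (simp add: model_def hom_def)
  let ?\<kappa> = "\<lambda>x\<in>Car X. FArr model ((\<lambda>x\<in>Car X. ?b x) x)"
  have "is_power ORD X (FObj model (bd c)) (FObj model (bd P0)) ?\<kappa>"
  proof (rule power_ORD_if_elements[OF XcP(1)])
    show "?\<kappa> \<in> mono_maps X (hom_preord ORD (FObj model (bd P0)) (FObj model (bd c)))"
      by (rule mono_hom_preord_functor[OF model_functor XcP(1)]) (use pw0[unfolded is_power_def] in blast)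
    show "is_preord (FObj model (bd c))" "is_preord (FObj model (bd P0))" using O Mo_preord N by simp_all
    have 1: "preord_iso (Mo (bd P0)) (maps (bd P0)) (the_inv_into (Car (maps (bd P0))) (code (bd P0)))"
      by (rule preord_iso_inverse[OF Mo_iso[OF N(2)]])
    have 2: "preord_iso (maps (bd P0)) (mono_preord X (maps (bd c)))
        (\<lambda>m. \<lambda>x\<in>Car X. \<lambda>y\<in>Car (bd c). m (Fn (?b x) y))"
      unfolding maps_def by (rule bmaps_power_iso[OF XcP p M])
    have 3: "preord_iso (mono_preord X (maps (bd c))) (mono_preord X (Mo (bd c))) (\<lambda>k. \<lambda>x\<in>Car X. code (bd c) (k x))"
      by (rule mono_preord_iso[OF XcP(1) Mo_iso[OF N(1)]])
    \<comment> \<open>Evaluation along the cone is the composite of decoding, restriction along the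
      sections of the product, and coding each component.\<close>
    show "preord_iso (FObj model (bd P0)) (mono_preord X (FObj model (bd c))) (evaluation X ?\<kappa>)"
      unfolding O
    proof (rule preord_iso_cong[OF preord_iso_trans[OF 1 preord_iso_trans[OF 2 3]]])
      fix q assume q: "q \<in> Car (Mo (bd P0))"
      obtain m where m: "m \<in> Car (maps (bd P0))" "q = code (bd P0) m" by (rule Mo_cases[OF N(2) q])
      have "(\<lambda>x\<in>Car X. code (bd c) (\<lambda>y\<in>Car (bd c). m (Fn (?b x) y))) = evaluation X ?\<kappa> q"
        unfolding evaluation_def
        by (rule restrict_ext) (use F precomp_code[OF b m(1)] m(2) in \<open>simp add: compose_def\<close>)
      moreover have "the_inv_into (Car (maps (bd P0))) (code (bd P0)) q = m"
        using the_inv_into_f_f[OF inj_code_maps[OF N(2)] m(1)] m(2) by simp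
      ultimately show "((\<lambda>k. \<lambda>x\<in>Car X. code (bd c) (k x)) \<circ> (\<lambda>m. \<lambda>x\<in>Car X. \<lambda>y\<in>Car (bd c). m (Fn (?b x) y)) \<circ>
          the_inv_into (Car (maps (bd P0))) (code (bd P0))) q = evaluation X ?\<kappa> q"
        by (simp cong: restrict_cong)
    qed
  qed
  from functor_power_transport[OF ord_category_T ord_category_ORD model_functor XcP(1) pw0 this pw[unfolded c]]
  show "is_power ORD X (FObj model C) (FObj model P) (\<lambda>x\<in>Car X. FArr model (\<kappa> x))" unfolding c .
qed

text \<open>Bounded maps out of \<open>bd one\<close> are monotone maps out of \<open>one\<close>,
  that is, elements of \<open>M\<close>; the isomorphism decodes and evaluates at
  \<open>e z\<close>.\<close>

lemma model_carrier:
  "\<exists>j. preord_iso (carrier model) M j \<and> j (cst model z) = b0 \<and> j (cst model t) = b1"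
proof -
  have N: "bd one \<in> bd ` FP" "bd emp \<in> bd ` FP" by auto
  have O: "carrier model = Mo (bd one)" "FObj model (bd emp) = Mo (bd emp)" using N by (simp_all add: model_def)
  let ?d = "the_inv_into (Car (maps (bd one))) (code (bd one))"
  have 1: "preord_iso (Mo (bd one)) (maps (bd one)) ?d" by (rule preord_iso_inverse[OF Mo_iso[OF N(1)]])
  have 2: "preord_iso (maps (bd one)) (mono_preord one M) (\<lambda>m. \<lambda>x\<in>Car one. m (e x))"
    unfolding maps_def by (rule bmaps_bd_iso[OF one_emp(3) M])
  have 3: "preord_iso (mono_preord one M) M (\<lambda>m. m z)"
  proof (rule preord_isoI)
    show "inj_on (\<lambda>m. m z) (Car (mono_preord one M))"
      by (rule inj_onI) (auto intro: mono_maps_eqI)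
    show "(\<lambda>m. m z) ` Car (mono_preord one M) = Car M"
    proof (intro equalityI subsetI)
      fix x assume x: "x \<in> Car M"
      have "(\<lambda>y\<in>Car one. x) \<in> mono_maps one M"
        by (rule mono_mapsI) (use x preord_refl[OF M_preord] in \<open>auto simp: one_def\<close>)
      then show "x \<in> (\<lambda>m. m z) ` Car (mono_preord one M)" by (force intro: image_eqI[of _ _ "\<lambda>y\<in>Car one. x"])
    qed (auto intro: mono_mapsD(1))
  qed auto
  let ?j = "(\<lambda>m. m z) \<circ> ((\<lambda>m. \<lambda>x\<in>Car one. m (e x)) \<circ> ?d)"
  have "preord_iso (carrier model) M ?j" unfolding O by (rule preord_iso_trans[OF preord_iso_trans[OF 1 2] 3])
  \<comment> \<open>The element \<open>point model\<close> codes the unique bounded map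
    \<open>m\<close> from \<open>bd emp\<close> to \<open>M\<close>. The constant is
    \<open>m\<close> precomposed with \<open>opn emp w\<close>, whose value at \<open>e z\<close> is
    \<open>m w\<close>, a bound of \<open>M\<close>.\<close>
  moreover have "?j (cst model w) = (if w = z then b0 else b1)" if w: "w = z \<or> w = t" for w
  proof -
    have w': "w \<in> Car (bd emp)" using w by auto
    note o = opn(1)[OF one_emp(2) w']
    have "point model \<in> Car (Mo (bd emp))" using point(1)[OF model_algebra] O by simp
    then obtain m where m: "m \<in> Car (maps (bd emp))" "point model = code (bd emp) m" by (rule Mo_cases[OF N(2)])
    have "FArr model (opn emp w) = precomp (opn emp w)" using o by (simp add: model_def hom_def)
    then have "cst model w = code (bd one) (compose (Car (bd one)) m (Fn (opn emp w)))"
      using precomp_code[OF o m(1)] m(2) by (simp add: cst_def act_def)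
    then have "?d (cst model w) = compose (Car (bd one)) m (Fn (opn emp w))"
      using the_inv_into_f_f[OF inj_code_maps[OF N(1)] compose_maps[OF o m(1)]] by simp
    then have "?j (cst model w) = m w" using opn(2)[OF one_emp(2) w'] by (simp add: compose_def)
    then show ?thesis using m(1) w by (auto simp: maps_def)
  qed
  ultimately show ?thesis by (intro exI[of _ ?j]) (simp del: o_apply)
qed

end

text \<open>Fullness comes from \<open>alg_hom_extension\<close>, faithfulness from
  \<open>alg_hom_eqI\<close>, the comparison of orders from \<open>alg_hom_le\<close>, and essential
  surjectivity from \<open>model\<close>. Thus the conservativity results and the counterexample
  apply to \<open>Alg T\<close>.\<close>

theorem bounded_preord_category_Alg:
  "bounded_preord_category (Alg T :: (('a preord, 'a pmap, 'a) alg, ('a preord, 'a pmap, 'a) alg_hom) ordcat)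
     carrier (\<lambda>A. cst A z) (\<lambda>A. cst A t) (\<lambda>\<alpha>. Fn (Fn \<alpha> (bd one)))"
proof (intro bounded_preord_category.intro bounded_preord_category_axioms.intro)
  show "ord_category (Alg T :: (('a preord, 'a pmap, 'a) alg, ('a preord, 'a pmap, 'a) alg_hom) ordcat)"
    by (rule ord_category_Alg[OF ord_category_T])
  show "infinite (UNIV :: 'a set)" by (rule infinite_universe)
  have N: "bd one \<in> bd ` FP" by simp
  fix A B D :: "('a preord, 'a pmap, 'a) alg" and \<alpha> \<beta> :: "('a preord, 'a pmap, 'a) alg_hom" and m x b0 b1 and M :: "'a preord"
  show "bounded_preord (carrier A) (cst A z) (cst A t)" if "A \<in> Obj (Alg T)"
    using that carrier_bounded by simp
  show "Fn (Fn \<alpha> (bd one)) \<in> mono_maps (carrier A) (carrier B)" if "\<alpha> \<in> hom (Alg T) A B"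
    using alg_hom_component[OF that N] unfolding hom_ORD_iff by blast
  show "Fn (Fn \<alpha> (bd one)) (cst A z) = cst B z" "Fn (Fn \<alpha> (bd one)) (cst A t) = cst B t" if "\<alpha> \<in> hom (Alg T) A B"
    by (rule alg_hom_cst[OF that]; simp)+
  show "Fn (Fn (Comp (Alg T) \<beta> \<alpha>) (bd one)) x = Fn (Fn \<beta> (bd one)) (Fn (Fn \<alpha> (bd one)) x)"
    if "\<alpha> \<in> hom (Alg T) A B" "\<beta> \<in> hom (Alg T) B D" "x \<in> Car (carrier A)"
    using hom_ORDD(1)[OF alg_hom_component[OF that(1) N]] that(3) by simp
  show "Fn (Fn (Idt (Alg T) A) (bd one)) x = x" if "x \<in> Car (carrier A)"
    using that by simp
  show "\<exists>\<alpha>\<in>hom (Alg T) A B. \<forall>x\<in>Car (carrier A). Fn (Fn \<alpha> (bd one)) x = m x"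
    if "A \<in> Obj (Alg T)" "B \<in> Obj (Alg T)" "m \<in> mono_maps (carrier A) (carrier B)"
      "m (cst A z) = cst B z" "m (cst A t) = cst B t"
    using that by (intro alg_hom_extension) simp_all
  show "\<alpha> = \<beta>" if "\<alpha> \<in> hom (Alg T) A B" "\<beta> \<in> hom (Alg T) A B"
    "\<And>x. x \<in> Car (carrier A) \<Longrightarrow> Fn (Fn \<alpha> (bd one)) x = Fn (Fn \<beta> (bd one)) x"
    by (rule alg_hom_eqI[OF that])
  show "Le (Alg T) \<alpha> \<beta> \<longleftrightarrow> (\<forall>x\<in>Car (carrier A). (Fn (Fn \<alpha> (bd one)) x, Fn (Fn \<beta> (bd one)) x) \<in> Rel (carrier B))"
    if \<alpha>: "\<alpha> \<in> hom (Alg T) A B" and \<beta>: "\<beta> \<in> hom (Alg T) A B"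
  proof
    assume "Le (Alg T) \<alpha> \<beta>"
    then have "Le ORD (Fn \<alpha> (bd one)) (Fn \<beta> (bd one))" by simp
    then show "\<forall>x\<in>Car (carrier A). (Fn (Fn \<alpha> (bd one)) x, Fn (Fn \<beta> (bd one)) x) \<in> Rel (carrier B)"
      using hom_ORDD(1,2)[OF alg_hom_component[OF \<alpha> N]] by (simp add: Le_ORD)
  qed (rule alg_hom_le[OF \<alpha> \<beta>], blast)
  show "\<exists>A\<in>Obj (Alg T). \<exists>j. preord_iso (carrier A) M j \<and> j (cst A z) = b0 \<and> j (cst A t) = b1"
    if "bounded_preord M b0 b1"
    using model_algebra[OF that] model_carrier[OF that] by (intro bexI[of _ "model M b0 b1"]) simp_all
qed

end

text \<open>An infinite set is in bijection with itself minus a point; doing this twice gives a map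
  \<open>e\<close> that misses both \<open>z\<close> and \<open>t\<close>.\<close>

lemma universe_exists:
  assumes "infinite (UNIV :: 'a set)"
  shows "\<exists>(e :: 'a \<Rightarrow> 'a) z t. universe e z t"
proof -
  obtain z t :: 'a where zt: "z \<noteq> t"
    using assms by (metis (full_types) UNIV_eq_I finite.emptyI finite.insertI insertI1)
  obtain f :: "'a \<Rightarrow> 'a" where f: "bij_betw f UNIV (UNIV - {z})"
    using infinite_imp_bij_betw[OF assms] by blast
  obtain g :: "'a \<Rightarrow> 'a" where g: "bij_betw g (UNIV - {z}) (UNIV - {z} - {t})"
    using infinite_imp_bij_betw[of "UNIV - {z}" t] assms by auto
  have "bij_betw (g \<circ> f) UNIV (UNIV - {z} - {t})" by (rule bij_betw_trans[OF f g])
  then have "universe (g \<circ> f) z t"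
    unfolding universe_def bij_betw_def using assms zt by blast
  then show ?thesis by blast
qed

text \<open>Functors are extensional on objects and on arrows, hence the restricted
  identities.\<close>

lemma ord_functor_id:
  "ord_functor C C \<lparr>FObj = \<lambda>a\<in>Obj C. a, FArr = \<lambda>f\<in>Arr C. f\<rparr>" if "ord_category C"
proof -
  interpret ord_category C by (rule that)
  show ?thesis
    unfolding ord_functor_def using dom_obj cod_obj id_hom comp_hom by (auto simp: hom_def)
qed

lemma ord_isomorphic_refl: "ord_isomorphic C C" if "ord_category C"
  unfolding ord_isomorphic_def
  using ord_functor_id[OF that]
  by (intro exI[of _ "\<lparr>FObj = \<lambda>a\<in>Obj C. a, FArr = \<lambda>f\<in>Arr C. f\<rparr>"]) simp

theorem proposition3p5:
  assumes "infinite (UNIV :: 'a set)"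
  shows "(\<exists>V :: (('a preord, 'a pmap, 'a) alg, ('a preord, 'a pmap, 'a) alg_hom) ordcat.
            ordered_variety V \<and> lax_protomodular V \<and> \<not> ord_maltsev V) \<and>
         (\<exists>V :: (('a preord, 'a pmap, 'a) alg, ('a preord, 'a pmap, 'a) alg_hom) ordcat.
            ordered_variety V \<and> colax_protomodular V \<and> \<not> ord_maltsev V)"
proof -
  obtain e :: "'a \<Rightarrow> 'a" and z t where "universe e z t" using universe_exists[OF assms] by blast
  then interpret universe e z t .
  let ?V = "Alg T :: (('a preord, 'a pmap, 'a) alg, ('a preord, 'a pmap, 'a) alg_hom) ordcat"
  interpret V: bounded_preord_category ?V carrier "\<lambda>A. cst A z" "\<lambda>A. cst A t" "\<lambda>\<alpha>. Fn (Fn \<alpha> (bd one))"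
    by (rule bounded_preord_category_Alg)
  have "ordered_variety ?V"
    unfolding ordered_variety_def
    using V.ord_category_axioms ord_algebraic_theory ord_isomorphic_refl by blast
  then show ?thesis
    using V.lax_protomodular V.colax_protomodular V.not_ord_maltsev by blast
qed

end
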